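(* Let $n\ge1$, let $\mathfrak g_{\mathbb{R}^n}$ be the Lie algebra of the abelian Lie group $\mathbb{R}^n$, let $\langle,\rangle$ be the standard inner product on $\mathfrak g_{\mathbb{R}^n}\cong\mathbb{R}^n$, and denote the corresponding left-invariant (Euclidean) metric by $g^E$. Then: (1) All left-invariant statistical structures on $\mathbb{R}^n$ are conjugate symmetric, i.e. $\mathcal{L}\mathrm{Stat}(\mathbb{R}^n)=\mathcal{L}\mathrm{Stat}^{\mathrm{CS}}(\mathbb{R}^n)$. (2) Let $C\in S^3(\mathfrak g_{\mathbb{R}^n}^* )$. The following are equivalent: (i) the left-invariant statistical structure $(\langle,\rangle,C)$ on $\mathbb{R}^n$ is dually flat; (ii) there exists an orthonormal basis $\{e_1,\dots,e_n\}$ of $(\mathfrak g_{\mathbb{R}^n},\langle,\rangle)$, with dual basis $\{x_1,\dots,x_n\}$, such that $C=\sum_{i=1}^n\lambda_i x_i^3$ for some $\lambda_i\in\mathbb{R}$. (3) $\mathcal{ML}\mathrm{Stat}(\mathbb{R}^n)=\mathcal{ML}\mathrm{Stat}^{\mathrm{CS}}(\mathbb{R}^n)\cong(\mathbb{R}_{>0}\times O(n))\backslash S^3(\mathfrak g_{\mathbb{R}^n}^* )$. (4) Let $\mathcal B=\{e_1,\dots,e_n\}$ be an orthonormal basis of $(\mathfrak g_{\mathbb{R}^n},\langle,\rangle)$ with dual basis $\{x_1,\dots,x_n\}$, and put $V_{\mathcal B}:=\{\sum_{i=1}^n\lambda_ix_i^3\mid\lambda_i\in\mathbb{R}\}\subset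 S^3(\mathfrak g_{\mathbb{R}^n}^* )$. Then $$\mathcal{ML}\mathrm{Stat}^{\mathrm{DF}}(\mathbb{R}^n)\cong(\mathbb{R}_{>0}\times O(n))\backslash O(n).V_{\mathcal B}\cong\mathbb{R}_{>0}\backslash\{\lambda\in\mathbb{R}^n\mid\lambda_1\ge\dots\ge\lambda_n\ge0\}.$$ Here $\cong$ means homeomorphic.
   Context: A statistical structure on a manifold $M$ is a pair $(g,\nabla)$ of a Riemannian metric $g$ and a torsion-free affine connection $\nabla$ such that the $(0,3)$-tensor field $C:=\nabla g$, $C(X,Y,Z)=(\nabla_X g)(Y,Z)$ (the cubic form), is totally symmetric. For fixed $g$, $\nabla\mapsto\nabla g$ is a bijection onto the symmetric $(0,3)$-tensor fields, so $(g,C)$ is also called a statistical structure. The dual connection $\overline\nabla$ is defined by $Xg(Y,Z)=g(\nabla_XY,Z)+g(Y,\overline\nabla_XZ)$. With $R^\nabla$ the curvature tensor, $(g,\nabla)$ is conjugate symmetric if $R^\nabla=R^{\overline\nabla}$, and dually flat if $R^\nabla=0$. For a Lie group $G$ with Lie algebra $\mathfrak g$, a statistical structure $(g,\nabla)$ on $G$ is left-invariant if both $g$ and $\nabla$ are invariant under left translations. $\mathcal{L}\mathrm{Stat}(G)$, $\mathcal{L}\mathrm{Stat}^{\mathrm{CS}}(G)$, $\mathcal{L}\mathrm{Stat}^{\mathrm{DF}}(G)$ are the sets of all left-invariant, resp. left-invariant conjugate symmetric, resp. left-invariant dually flat, statistical structures. $\mathcal{L}\mathrm{Stat}(G)$ is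 identified via $(g,\nabla)\mapsto(g,\nabla g)$ with $\widetilde{\mathfrak M}(G)\times S^3(\mathfrak g^* )$, where $\widetilde{\mathfrak M}(G)$ is the space of left-invariant Riemannian metrics (= inner products on $\mathfrak g$), and carries the corresponding topology. $\mathbb{R}_{>0}\times\mathrm{Aut}(G)$ acts by $(r,\varphi).(g,\nabla)=(r\,(\varphi^{-1})^*g,(\varphi^{-1})^*\nabla)$, preserving the three sets; $\mathcal{ML}\mathrm{Stat}(G)$, $\mathcal{ML}\mathrm{Stat}^{\mathrm{CS}}(G)$, $\mathcal{ML}\mathrm{Stat}^{\mathrm{DF}}(G)$ are the respective orbit spaces with the quotient topology. $S^k(\mathfrak g^* )$ denotes symmetric $k$-tensors, with products $(x_1\cdots x_k)(X_1,\dots,X_k)=\frac1{k!}\sum_{\sigma\in\mathfrak S_k}\prod_i x_{\sigma(i)}(X_i)$. On $S^3(\mathfrak g_{\mathbb{R}^n}^* )$, $O(n)=O(\mathfrak g_{\mathbb{R}^n},\langle,\rangle)$ acts by $k.C=C(k^{-1}\cdot,k^{-1}\cdot,k^{-1}\cdot)$ and $\mathbb{R}_{>0}$ by positive scaling; $\mathbb{R}_{>0}$ acts on $\mathbb{R}^n$ by positive scaling. (The isotropy subgroup of $\mathbb{R}_{>0}\times\mathrm{Aut}(\mathbb{R}^n)$ at $g^E$ is isomorphic to $\mathbb{R}_{>0}\times O(n)$ and acts on cubic forms with the same orbits.) *)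

theory Defs
  imports "HOL-Analysis.Analysis"
begin

section \<open>Tensor calculus on the manifold underlying a Euclidean space\<close>

text \<open>
  A Euclidean space \<open>'a\<close> is regarded as a smooth manifold (with its global chart) and as a Lie group
  under \<open>+\<close>. Every tangent space is \<open>'a\<close>, so vector fields are smooth maps \<open>'a \<Rightarrow> 'a\<close>.
\<close>

primrec C_k :: "nat \<Rightarrow> ('a::real_normed_vector \<Rightarrow> 'b::real_normed_vector) \<Rightarrow> bool" where
  "C_k 0 f \<longleftrightarrow> continuous_on UNIV f"
| "C_k (Suc k) f \<longleftrightarrow> (\<forall>x. f differentiable (at x)) \<and> (\<forall>v. C_k k (\<lambda>x. frechet_derivative f (at x) v))"

definition smooth :: "('a::real_normed_vector \<Rightarrow> 'b::real_normed_vector) \<Rightarrow> bool" where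
  "smooth f \<longleftrightarrow> (\<forall>k. C_k k f)"

type_synonym 'a vfield = "'a \<Rightarrow> 'a"
type_synonym 'a form2 = "'a \<Rightarrow> 'a \<Rightarrow> real"
type_synonym 'a form3 = "'a \<Rightarrow> 'a \<Rightarrow> 'a \<Rightarrow> real"
type_synonym 'a metric = "'a \<Rightarrow> 'a form2"
type_synonym 'a connection = "'a vfield \<Rightarrow> 'a vfield \<Rightarrow> 'a vfield"
type_synonym 'a stat = "'a metric \<times> 'a connection"

definition vfields :: "'a::euclidean_space vfield set" where
  "vfields = {X. smooth X}"

definition deriv_along :: "'a::euclidean_space vfield \<Rightarrow> ('a \<Rightarrow> 'b::real_normed_vector) \<Rightarrow> 'a \<Rightarrow> 'b" where
  "deriv_along X f = (\<lambda>p. frechet_derivative f (at p) (X p))"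

definition lie_bracket :: "'a::euclidean_space vfield \<Rightarrow> 'a vfield \<Rightarrow> 'a vfield" where
  "lie_bracket X Y = (\<lambda>p. deriv_along X Y p - deriv_along Y X p)"

definition inner_product :: "'a::euclidean_space form2 \<Rightarrow> bool" where
  "inner_product h \<longleftrightarrow> bilinear h \<and> (\<forall>u v. h u v = h v u) \<and> (\<forall>u. u \<noteq> 0 \<longrightarrow> h u u > 0)"

definition riemannian_metric :: "'a::euclidean_space metric \<Rightarrow> bool" where
  "riemannian_metric g \<longleftrightarrow> (\<forall>p. inner_product (g p)) \<and> (\<forall>u v. smooth (\<lambda>p. g p u v))"

definition metric_apply :: "'a::euclidean_space metric \<Rightarrow> 'a vfield \<Rightarrow> 'a vfield \<Rightarrow> 'a \<Rightarrow> real" where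
  "metric_apply g X Y = (\<lambda>p. g p (X p) (Y p))"

text \<open>
  A connection is an operator on smooth vector fields; it is taken extensional, i.e. with the value
  \<open>undefined\<close> elsewhere, so that equality of connections is equality of functions.
\<close>

definition affine_connection :: "'a::euclidean_space connection \<Rightarrow> bool" where
  "affine_connection D \<longleftrightarrow>
     D \<in> vfields \<rightarrow>\<^sub>E (vfields \<rightarrow>\<^sub>E vfields) \<and>
     (\<forall>X\<in>vfields. \<forall>Y\<in>vfields. \<forall>Z\<in>vfields.
        D (\<lambda>p. X p + Y p) Z = (\<lambda>p. D X Z p + D Y Z p) \<and>
        D X (\<lambda>p. Y p + Z p) = (\<lambda>p. D X Y p + D X Z p)) \<and>
     (\<forall>X\<in>vfields. \<forall>Y\<in>vfields. \<forall>f :: 'a \<Rightarrow> real. smooth f \<longrightarrow>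
        D (\<lambda>p. f p *\<^sub>R X p) Y = (\<lambda>p. f p *\<^sub>R D X Y p) \<and>
        D X (\<lambda>p. f p *\<^sub>R Y p) = (\<lambda>p. deriv_along X f p *\<^sub>R Y p + f p *\<^sub>R D X Y p))"

definition torsion_free :: "'a::euclidean_space connection \<Rightarrow> bool" where
  "torsion_free D \<longleftrightarrow>
     (\<forall>X\<in>vfields. \<forall>Y\<in>vfields. \<forall>p. D X Y p - D Y X p = lie_bracket X Y p)"

definition curvature :: "'a::euclidean_space connection \<Rightarrow> 'a vfield \<Rightarrow> 'a vfield \<Rightarrow> 'a vfield \<Rightarrow> 'a vfield" where
  "curvature D X Y Z = (\<lambda>p. D X (D Y Z) p - D Y (D X Z) p - D (lie_bracket X Y) Z p)"

definition cubic_form ::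
    "'a::euclidean_space metric \<Rightarrow> 'a connection \<Rightarrow> 'a vfield \<Rightarrow> 'a vfield \<Rightarrow> 'a vfield \<Rightarrow> 'a \<Rightarrow> real" where
  "cubic_form g D X Y Z =
     (\<lambda>p. deriv_along X (metric_apply g Y Z) p - metric_apply g (D X Y) Z p - metric_apply g Y (D X Z) p)"

definition statistical_structure :: "'a::euclidean_space stat \<Rightarrow> bool" where
  "statistical_structure = (\<lambda>(g, D).
     riemannian_metric g \<and> affine_connection D \<and> torsion_free D \<and>
     (\<forall>X\<in>vfields. \<forall>Y\<in>vfields. \<forall>Z\<in>vfields.
        cubic_form g D X Y Z = cubic_form g D Y X Z \<and>
        cubic_form g D X Y Z = cubic_form g D X Z Y))"

definition dual_connection :: "'a::euclidean_space metric \<Rightarrow> 'a connection \<Rightarrow> 'a connection" where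
  "dual_connection g D = (THE D'. affine_connection D' \<and>
     (\<forall>X\<in>vfields. \<forall>Y\<in>vfields. \<forall>Z\<in>vfields. \<forall>p.
        deriv_along X (metric_apply g Y Z) p = metric_apply g (D X Y) Z p + metric_apply g Y (D' X Z) p))"

definition conjugate_symmetric :: "'a::euclidean_space stat \<Rightarrow> bool" where
  "conjugate_symmetric = (\<lambda>(g, D). \<forall>X\<in>vfields. \<forall>Y\<in>vfields. \<forall>Z\<in>vfields.
     curvature D X Y Z = curvature (dual_connection g D) X Y Z)"

definition dually_flat :: "'a::euclidean_space stat \<Rightarrow> bool" where
  "dually_flat = (\<lambda>(g, D). \<forall>X\<in>vfields. \<forall>Y\<in>vfields. \<forall>Z\<in>vfields. curvature D X Y Z = (\<lambda>p. 0))"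

text \<open>In the next three definitions \<open>\<phi>\<close> is meant to be a diffeomorphism.\<close>

definition pushforward :: "('a::euclidean_space \<Rightarrow> 'a) \<Rightarrow> 'a vfield \<Rightarrow> 'a vfield" where
  "pushforward \<phi> X = (\<lambda>p. frechet_derivative \<phi> (at (inv \<phi> p)) (X (inv \<phi> p)))"

definition pullback_metric :: "('a::euclidean_space \<Rightarrow> 'a) \<Rightarrow> 'a metric \<Rightarrow> 'a metric" where
  "pullback_metric \<phi> g =
     (\<lambda>p u v. g (\<phi> p) (frechet_derivative \<phi> (at p) u) (frechet_derivative \<phi> (at p) v))"

definition pullback_connection :: "('a::euclidean_space \<Rightarrow> 'a) \<Rightarrow> 'a connection \<Rightarrow> 'a connection" where
  "pullback_connection \<phi> D =
     (\<lambda>X\<in>vfields. \<lambda>Y\<in>vfields. pushforward (inv \<phi>) (D (pushforward \<phi> X) (pushforward \<phi> Y)))"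


section \<open>Left-invariant statistical structures on the additive Lie group\<close>

definition left_invariant :: "'a::euclidean_space stat \<Rightarrow> bool" where
  "left_invariant = (\<lambda>(g, D). \<forall>a.
     pullback_metric (\<lambda>p. a + p) g = g \<and> pullback_connection (\<lambda>p. a + p) D = D)"

definition LStat :: "'a::euclidean_space stat set" where
  "LStat = {s. statistical_structure s \<and> left_invariant s}"

definition LStat_CS :: "'a::euclidean_space stat set" where
  "LStat_CS = {s \<in> LStat. conjugate_symmetric s}"

definition LStat_DF :: "'a::euclidean_space stat set" where
  "LStat_DF = {s \<in> LStat. dually_flat s}"

text \<open>
  The Lie algebra consists of the left-invariant, i.e. constant, vector fields and is identified with
  \<open>'a\<close>. The identification of \<open>LStat\<close> with pairs of an inner product and a symmetric 3-tensor
  evaluates \<open>g\<close> and \<open>\<nabla>g\<close> on left-invariant vector fields; there the result is a constant function,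
  which we read off at the neutral element.
\<close>

definition S3 :: "'a::euclidean_space form3 set" where
  "S3 = {C. (\<forall>v w. linear (\<lambda>u. C u v w)) \<and> (\<forall>u w. linear (\<lambda>v. C u v w)) \<and> (\<forall>u v. linear (\<lambda>w. C u v w)) \<and>
            (\<forall>u v w. C u v w = C v u w \<and> C u v w = C u w v)}"

definition lstat_ident :: "'a::euclidean_space stat \<Rightarrow> 'a form2 \<times> 'a form3" where
  "lstat_ident = (\<lambda>(g, D).
     (\<lambda>u v. metric_apply g (\<lambda>_. u) (\<lambda>_. v) 0,
      \<lambda>u v w. cubic_form g D (\<lambda>_. u) (\<lambda>_. v) (\<lambda>_. w) 0))"

text \<open>
  Since \<open>lstat_ident\<close> is injective on \<open>LStat\<close> with image all pairs of an inner product and an element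
  of \<open>S3\<close>, its inverse gives the left-invariant statistical structure written \<open>(h, C)\<close>.
\<close>

definition lstat_of :: "'a::euclidean_space form2 \<Rightarrow> 'a form3 \<Rightarrow> 'a stat" where
  "lstat_of h C = inv_into LStat lstat_ident (h, C)"

text \<open>
  The function types carry the topology of pointwise convergence, which restricts to the usual
  vector space topology on the finite-dimensional spaces of multilinear forms.
\<close>

definition lstat_topology :: "'a::euclidean_space stat topology" where
  "lstat_topology = pullback_topology LStat lstat_ident euclidean"


section \<open>Group actions and moduli spaces\<close>

definition orbit :: "'g set \<Rightarrow> ('g \<Rightarrow> 'x \<Rightarrow> 'x) \<Rightarrow> 'x \<Rightarrow> 'x set" where
  "orbit G act x = (\<lambda>a. act a x) ` G"

definition orbit_space :: "'g set \<Rightarrow> ('g \<Rightarrow> 'x \<Rightarrow> 'x) \<Rightarrow> 'x topology \<Rightarrow> 'x set topology" where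
  "orbit_space G act T = topology (\<lambda>U.
     U \<subseteq> orbit G act ` topspace T \<and> openin T {x \<in> topspace T. orbit G act x \<in> U})"

lemma openin_orbit_space:
  "openin (orbit_space G act T) U \<longleftrightarrow>
     U \<subseteq> orbit G act ` topspace T \<and> openin T {x \<in> topspace T. orbit G act x \<in> U}"
proof -
  let ?P = "\<lambda>U. U \<subseteq> orbit G act ` topspace T \<and> openin T {x \<in> topspace T. orbit G act x \<in> U}"
  have "istopology ?P"
    unfolding istopology_def
  proof (intro conjI allI impI)
    fix S U assume "?P S" "?P U"
    moreover have "{x \<in> topspace T. orbit G act x \<in> S \<inter> U} =
        {x \<in> topspace T. orbit G act x \<in> S} \<inter> {x \<in> topspace T. orbit G act x \<in> U}"
      by auto
    ultimately show "S \<inter> U \<subseteq> orbit G act ` topspace T"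
      and "openin T {x \<in> topspace T. orbit G act x \<in> S \<inter> U}"
      by auto
  next
    fix K assume K: "\<forall>S\<in>K. ?P S"
    then show "\<Union>K \<subseteq> orbit G act ` topspace T" by blast
    have "{x \<in> topspace T. orbit G act x \<in> \<Union>K} =
        (\<Union>S\<in>K. {x \<in> topspace T. orbit G act x \<in> S})"
      by auto
    then show "openin T {x \<in> topspace T. orbit G act x \<in> \<Union>K}"
      using K by auto
  qed
  then show ?thesis
    unfolding orbit_space_def by (simp add: topology_inverse')
qed

definition Lie_Aut :: "('a::euclidean_space \<Rightarrow> 'a) set" where
  "Lie_Aut = {\<phi>. bij \<phi> \<and> (\<forall>a b. \<phi> (a + b) = \<phi> a + \<phi> b) \<and> smooth \<phi> \<and> smooth (inv \<phi>)}"

definition stat_act :: "real \<times> ('a::euclidean_space \<Rightarrow> 'a) \<Rightarrow> 'a stat \<Rightarrow> 'a stat" where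
  "stat_act = (\<lambda>(r, \<phi>) (g, D).
     (\<lambda>p u v. r * pullback_metric (inv \<phi>) g p u v, pullback_connection (inv \<phi>) D))"

definition moduli_space :: "'a::euclidean_space stat set \<Rightarrow> 'a stat set topology" where
  "moduli_space S = orbit_space ({0<..} \<times> Lie_Aut) stat_act (subtopology lstat_topology S)"

definition MLStat :: "'a::euclidean_space stat set topology" where
  "MLStat = moduli_space LStat"

definition MLStat_CS :: "'a::euclidean_space stat set topology" where
  "MLStat_CS = moduli_space LStat_CS"

definition MLStat_DF :: "'a::euclidean_space stat set topology" where
  "MLStat_DF = moduli_space LStat_DF"

definition O_group :: "('a::euclidean_space \<Rightarrow> 'a) set" where
  "O_group = {k. orthogonal_transformation k}"

definition cubic_act :: "real \<times> ('a::euclidean_space \<Rightarrow> 'a) \<Rightarrow> 'a form3 \<Rightarrow> 'a form3" where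
  "cubic_act = (\<lambda>(r, k) C. \<lambda>u v w. r * C (inv k u) (inv k v) (inv k w))"


section \<open>Orthonormal bases and diagonal cubic forms\<close>

definition orthonormal_basis :: "('n::finite \<Rightarrow> real ^ 'n) \<Rightarrow> bool" where
  "orthonormal_basis e \<longleftrightarrow> (\<forall>i j. e i \<bullet> e j = (if i = j then 1 else 0)) \<and> span (range e) = UNIV"

definition dual_basis :: "('n::finite \<Rightarrow> real ^ 'n) \<Rightarrow> ('n \<Rightarrow> real ^ 'n \<Rightarrow> real) \<Rightarrow> bool" where
  "dual_basis e x \<longleftrightarrow> (\<forall>i. linear (x i)) \<and> (\<forall>i j. x i (e j) = (if i = j then 1 else 0))"

definition sym_prod :: "('a \<Rightarrow> real) list \<Rightarrow> 'a list \<Rightarrow> real" where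
  "sym_prod xs Xs = (1 / fact (length xs)) *
     (\<Sum>\<sigma> | \<sigma> permutes {..<length xs}. \<Prod>i<length xs. (xs ! \<sigma> i) (Xs ! i))"

definition diag_cubic :: "('n::finite \<Rightarrow> real ^ 'n \<Rightarrow> real) \<Rightarrow> real ^ 'n \<Rightarrow> (real ^ 'n) form3" where
  "diag_cubic x l = (\<lambda>X Y Z. \<Sum>i\<in>UNIV. l $ i * sym_prod [x i, x i, x i] [X, Y, Z])"

definition V_diag :: "('n::finite \<Rightarrow> real ^ 'n \<Rightarrow> real) \<Rightarrow> (real ^ 'n) form3 set" where
  "V_diag x = {diag_cubic x l | l. True}"

definition O_orbit_V :: "('n::finite \<Rightarrow> real ^ 'n \<Rightarrow> real) \<Rightarrow> (real ^ 'n) form3 set" where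
  "O_orbit_V x = {cubic_act (1, k) C | k C. k \<in> O_group \<and> C \<in> V_diag x}"

text \<open>
  The linear order on the index type \<open>'n\<close> plays the role of the order on \<open>{1, \<dots>, n}\<close>.
\<close>

definition ordered_cone :: "(real ^ 'n::{finite,linorder}) set" where
  "ordered_cone = {l. (\<forall>i j. i \<le> j \<longrightarrow> l $ j \<le> l $ i) \<and> (\<forall>i. 0 \<le> l $ i)}"

end

theory Submission
  imports Defs
begin

text \<open>
  In the global chart a connection that is invariant under translations differs from the flat one by a
  constant bilinear map \<open>A\<close>, and then \<open>\<nabla>g = C\<close> together with symmetry of \<open>A\<close> and of \<open>C\<close> says
  \<open>h (A u v) w = - C u v w / 2\<close> for the constant value \<open>h\<close> of the metric. So structures are the same
  as pairs \<open>(h, C)\<close> (\<open>lstat_ident_bij_betw\<close>). The dual connection belongs to \<open>- A\<close>, and the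
  curvature is the commutator \<open>A u (A v w) - A v (A u w)\<close> (\<open>curvature_conn\<close>), which is even in \<open>A\<close>;
  hence every structure is conjugate symmetric.

  Flatness means that the commutative product \<open>A\<close>, whose multiplications are self-adjoint, has commuting
  multiplications. Let \<open>e\<close> maximise the cubic form \<open>A v v \<bullet> v\<close> on the unit sphere. Then \<open>e\<close> is an
  eigenvector of \<open>A e\<close>, with the maximum \<open>M\<close> as eigenvalue, and commutativity forces the eigenvalues of
  \<open>A e\<close> on the orthogonal complement of \<open>e\<close> to be \<open>0\<close> or \<open>M\<close>; another eigenvector for \<open>M > 0\<close>
  would contradict maximality. So \<open>A e\<close> vanishes on the complement, the complement is closed under the product,
  and induction on the dimension gives an orthonormal basis of pairwise annihilating vectors
  (\<open>orthogonal_idempotents\<close>), in which \<open>C\<close> is diagonal.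

  For the moduli spaces, two orbit spaces are homeomorphic as soon as there are continuous maps between
  the total spaces that respect orbits and are inverse to each other up to the actions
  (\<open>orbit_spaces_homeomorphic\<close>). The Gram--Schmidt process yields a frame of \<open>h\<close> that depends
  continuously on \<open>h\<close>; expressing \<open>C\<close> in it gives such a map from structures to cubic forms, and
  \<open>C \<mapsto> (\<bullet>, C)\<close> is its counterpart. The maps \<open>k / r\<close> with \<open>k\<close> orthogonal account for the positive
  scalings of cubic forms.

  On diagonal forms, \<open>l \<mapsto> \<Sum>\<^sub>i l\<^sub>i x\<^sub>i\<^sup>3\<close> goes from the cone to cubic forms. In the other direction one takes
  the decreasingly ordered absolute values of the coefficients. That these are well defined and continuous
  rests on the identity \<open>\<Sum>\<^sub>a\<^sub>b C(v, a, b)\<^sup>2 = \<Sum>\<^sub>i l\<^sub>i\<^sup>2 x\<^sub>i(v)\<^sup>2\<close>: the numbers \<open>l\<^sub>i\<^sup>2\<close> are the ordered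
  eigenvalues of a quadratic form depending polynomially on \<open>C\<close>, and by a dimension count
  (\<open>eigenvalue_compare\<close>) they move by no more than the quadratic form does.
\<close>

section \<open>Calculus of smooth maps\<close>

lemma C_k_imp_continuous: "C_k k f \<Longrightarrow> continuous_on UNIV f"
  by (cases k) (auto intro!: differentiable_imp_continuous_on simp: differentiable_on_def)

text \<open>The recursive definition of \<open>C_k\<close> does not mention continuity of the map at positive orders, so
  the inclusions between the classes rest on continuity of differentiable maps.\<close>

lemma C_k_Suc_imp: "C_k (Suc k) f \<Longrightarrow> C_k k f"
proof (induction k arbitrary: f)
  case 0
  then show ?case using C_k_imp_continuous[OF 0] by simp
next
  case (Suc k)
  then show ?case by (metis C_k.simps(2))
qed

lemma C_k_const: "C_k k (\<lambda>x. c)"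
  by (induction k arbitrary: c) auto

lemma C_k_add:
  "C_k k f \<Longrightarrow> C_k k g \<Longrightarrow> C_k k (\<lambda>x. f x + g x)"
proof (induction k arbitrary: f g)
  case 0
  then show ?case by (auto intro: continuous_intros)
next
  case (Suc k)
  have "frechet_derivative (\<lambda>x. f x + g x) (at x) v
      = frechet_derivative f (at x) v + frechet_derivative g (at x) v" for x v
    using Suc.prems
    by (subst frechet_derivative_at[symmetric, OF has_derivative_add])
       (auto simp: frechet_derivative_works)
  with Suc show ?case by auto
qed

lemma frechet_derivative_bilinear:
  assumes "bounded_bilinear B" "f differentiable (at x)" "g differentiable (at x)"
  shows "frechet_derivative (\<lambda>x. B (f x) (g x)) (at x) v
      = B (f x) (frechet_derivative g (at x) v) + B (frechet_derivative f (at x) v) (g x)"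
  using assms
  by (subst frechet_derivative_at[symmetric, OF bounded_bilinear.FDERIV])
     (auto simp: frechet_derivative_works)

lemma C_k_bilinear:
  assumes "bounded_bilinear B"
  shows "C_k k f \<Longrightarrow> C_k k g \<Longrightarrow> C_k k (\<lambda>x. B (f x) (g x))"
proof (induction k arbitrary: f g)
  case 0
  then show ?case
    using bounded_bilinear.continuous_on[OF assms] by auto
next
  case (Suc k)
  have "f differentiable (at x)" "g differentiable (at x)" for x
    using Suc.prems by auto
  moreover have "C_k k f" "C_k k g" using Suc.prems C_k_Suc_imp by blast+
  moreover have "(\<lambda>x. B (f x) (g x)) differentiable (at x)" for x
    by (rule differentiableI[OF bounded_bilinear.FDERIV[OF assms
          calculation(1)[unfolded frechet_derivative_works] calculation(2)[unfolded frechet_derivative_works]]])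
  ultimately show ?case
    using Suc by (auto simp: frechet_derivative_bilinear[OF assms] intro!: C_k_add)
qed

lemma frechet_derivative_affine:
  fixes L :: "'a::euclidean_space \<Rightarrow> 'b::euclidean_space"
  assumes "linear L"
  shows "frechet_derivative (\<lambda>p. a + L p) (at x) = L"
  using assms
  by (intro frechet_derivative_at[symmetric])
     (auto intro!: derivative_eq_intros linear_imp_has_derivative)

lemma differentiable_affine:
  fixes L :: "'a::euclidean_space \<Rightarrow> 'b::euclidean_space"
  assumes "linear L"
  shows "(\<lambda>p. a + L p) differentiable (at x)"
  using assms by (intro differentiable_add differentiable_const linear_imp_differentiable)

lemma frechet_derivative_compose_affine:
  fixes L :: "'a::euclidean_space \<Rightarrow> 'b::euclidean_space"
  assumes "linear L" "f differentiable (at (a + L x))"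
  shows "frechet_derivative (\<lambda>p. f (a + L p)) (at x) v = frechet_derivative f (at (a + L x)) (L v)"
  using frechet_derivative_compose[OF differentiable_affine[OF assms(1), of a x] assms(2)]
  by (simp add: o_def frechet_derivative_affine[OF assms(1)])

lemma C_k_compose_affine:
  fixes L :: "'a::euclidean_space \<Rightarrow> 'b::euclidean_space"
  assumes "linear L"
  shows "C_k k f \<Longrightarrow> C_k k (\<lambda>p. f (a + L p))"
proof (induction k arbitrary: f)
  case 0
  have "continuous_on UNIV (\<lambda>p. a + L p)"
    using assms by (intro continuous_intros linear_continuous_on linear_conv_bounded_linear[THEN iffD1])
  with 0 show ?case
    by (auto intro: continuous_on_compose2)
next
  case (Suc k)
  have "(\<lambda>p. f (a + L p)) differentiable (at x)" for x
    using differentiable_chain_at[OF differentiable_affine[OF assms, of a x], of f] Suc.prems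
    by (simp add: o_def)
  moreover have "C_k k (\<lambda>p. frechet_derivative f (at (a + L p)) (L v))" for v
    using Suc.IH[of "\<lambda>p. frechet_derivative f (at p) (L v)"] Suc.prems by simp
  ultimately show ?case
    using Suc.prems by (auto simp: frechet_derivative_compose_affine[OF assms])
qed

lemma smooth_differentiable: "smooth f \<Longrightarrow> f differentiable (at x)"
  unfolding smooth_def by (metis C_k.simps(2))

lemma smooth_has_derivative: "smooth f \<Longrightarrow> (f has_derivative frechet_derivative f (at x)) (at x)"
  using smooth_differentiable frechet_derivative_works by blast

lemma smooth_const [simp]: "smooth (\<lambda>x. c)"
  by (simp add: smooth_def C_k_const)

lemma smooth_add: "smooth f \<Longrightarrow> smooth g \<Longrightarrow> smooth (\<lambda>x. f x + g x)"
  by (simp add: smooth_def C_k_add)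

lemma smooth_bilinear:
  "bounded_bilinear B \<Longrightarrow> smooth f \<Longrightarrow> smooth g \<Longrightarrow> smooth (\<lambda>x. B (f x) (g x))"
  by (simp add: smooth_def C_k_bilinear)

lemmas smooth_scaleR = smooth_bilinear[OF bounded_bilinear_scaleR]
lemmas smooth_inner = smooth_bilinear[OF bounded_bilinear_inner]

lemma smooth_minus: "smooth f \<Longrightarrow> smooth g \<Longrightarrow> smooth (\<lambda>x. f x - g x)"
  using smooth_add[of f "\<lambda>x. (-1) *\<^sub>R g x"] smooth_scaleR[of "\<lambda>_. -1" g] by simp

lemma smooth_sum:
  "finite I \<Longrightarrow> (\<And>i. i \<in> I \<Longrightarrow> smooth (f i)) \<Longrightarrow> smooth (\<lambda>x. \<Sum>i\<in>I. f i x)"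
  by (induction I rule: finite_induct) (auto intro: smooth_add)

lemma smooth_compose_affine:
  fixes L :: "'a::euclidean_space \<Rightarrow> 'b::euclidean_space"
  assumes "linear L" "smooth f"
  shows "smooth (\<lambda>p. f (a + L p))"
  using assms by (simp add: smooth_def C_k_compose_affine)

lemma smooth_frechet_derivative: "smooth f \<Longrightarrow> smooth (\<lambda>p. frechet_derivative f (at p) v)"
  unfolding smooth_def by (metis C_k.simps(2))

lemma smooth_linear:
  fixes L :: "'a::euclidean_space \<Rightarrow> 'b::euclidean_space"
  shows "linear L \<Longrightarrow> smooth f \<Longrightarrow> smooth (\<lambda>x. L (f x))"
proof -
  assume L: "linear L" and f: "smooth f"
  have "L (f x) = (\<Sum>b\<in>Basis. (f x \<bullet> b) *\<^sub>R L b)" for x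
    using linear_sum[OF L, of "\<lambda>b. (f x \<bullet> b) *\<^sub>R b" Basis]
    by (simp add: linear_scale[OF L] euclidean_representation)
  then show ?thesis
    using f by (auto intro!: smooth_sum smooth_scaleR smooth_inner)
qed

lemma frechet_derivative_linear_comp:
  fixes L :: "'a::euclidean_space \<Rightarrow> 'b::euclidean_space"
  assumes "linear L" "smooth f"
  shows "frechet_derivative (\<lambda>x. L (f x)) (at p) v = L (frechet_derivative f (at p) v)"
  using assms linear_conv_bounded_linear
  by (subst frechet_derivative_at[symmetric, OF bounded_linear.has_derivative])
     (auto intro: smooth_has_derivative)

lemma frechet_derivative_smooth_expand:
  fixes f :: "'a::euclidean_space \<Rightarrow> 'b::euclidean_space"
  assumes "smooth f"
  shows "frechet_derivative f (at p) v = (\<Sum>b\<in>Basis. (v \<bullet> b) *\<^sub>R frechet_derivative f (at p) b)"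
proof -
  have L: "linear (frechet_derivative f (at p))"
    by (simp add: assms linear_frechet_derivative smooth_differentiable)
  show ?thesis
    using linear_sum[OF L, of "\<lambda>b. (v \<bullet> b) *\<^sub>R b" Basis]
    by (simp add: linear_scale[OF L] euclidean_representation)
qed

lemma smooth_deriv_along:
  assumes "smooth X" "smooth (f :: 'a::euclidean_space \<Rightarrow> 'b::euclidean_space)"
  shows "smooth (deriv_along X f)"
proof -
  have "deriv_along X f = (\<lambda>p. \<Sum>b\<in>Basis. (X p \<bullet> b) *\<^sub>R frechet_derivative f (at p) b)"
    unfolding deriv_along_def by (rule ext) (rule frechet_derivative_smooth_expand[OF assms(2)])
  then show ?thesis
    using assms by (auto intro!: smooth_sum smooth_scaleR smooth_inner smooth_frechet_derivative)
qed

lemma smooth_bilinear_apply: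
  fixes A :: "'a::euclidean_space \<Rightarrow> 'a \<Rightarrow> 'b::real_normed_vector"
  assumes "bilinear A" "smooth X" "smooth Y"
  shows "smooth (\<lambda>p. A (X p) (Y p))"
  using assms bilinear_conv_bounded_bilinear smooth_bilinear by blast

text \<open>The second difference over the parallelogram spanned by \<open>h u\<close> and \<open>h v\<close> is, by the mean value
  theorem applied in each direction, \<open>h\<^sup>2\<close> times a mixed derivative at some point of it.\<close>

lemma second_difference_mean_value:
  fixes g :: "'a::euclidean_space \<Rightarrow> real"
  assumes g: "smooth g" and h: "h > 0"
  obtains s t where "0 < s" "s < h" "0 < t" "t < h"
    "g (p + h *\<^sub>R u + h *\<^sub>R v) - g (p + h *\<^sub>R u) - g (p + h *\<^sub>R v) + g p
      = h * h * frechet_derivative (\<lambda>q. frechet_derivative g (at q) u) (at (p + s *\<^sub>R u + t *\<^sub>R v)) v"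
proof -
  have line: "((\<lambda>s. f (q + s *\<^sub>R w)) has_real_derivative frechet_derivative f (at (q + s *\<^sub>R w)) w) (at s)"
    if "smooth f" for f :: "'a \<Rightarrow> real" and q w s
  proof -
    have "((\<lambda>s. f (q + s *\<^sub>R w)) has_derivative (\<lambda>r. frechet_derivative f (at (q + s *\<^sub>R w)) (r *\<^sub>R w))) (at s)"
      by (rule has_derivative_compose[OF _ smooth_has_derivative[OF that]])
         (auto intro!: derivative_eq_intros)
    moreover have "frechet_derivative f (at (q + s *\<^sub>R w)) (r *\<^sub>R w)
        = frechet_derivative f (at (q + s *\<^sub>R w)) w * r" for r
      by (simp add: that linear_frechet_derivative linear_scale smooth_differentiable)
    ultimately show ?thesis by (simp add: has_field_derivative_def)
  qed
  define d where "d = (\<lambda>q. frechet_derivative g (at q) u)"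
  have d: "smooth d" unfolding d_def by (rule smooth_frechet_derivative[OF g])
  let ?F = "\<lambda>s. g ((p + h *\<^sub>R v) + s *\<^sub>R u) - g (p + s *\<^sub>R u)"
  obtain s where s: "0 < s" "s < h" "?F h - ?F 0 = (h - 0) * (d ((p + h *\<^sub>R v) + s *\<^sub>R u) - d (p + s *\<^sub>R u))"
    using MVT2[OF h, of ?F "\<lambda>s. d ((p + h *\<^sub>R v) + s *\<^sub>R u) - d (p + s *\<^sub>R u)"]
      DERIV_diff[OF line[OF g] line[OF g]] unfolding d_def by blast
  let ?G = "\<lambda>t. d ((p + s *\<^sub>R u) + t *\<^sub>R v)"
  obtain t where t: "0 < t" "t < h" "?G h - ?G 0 = (h - 0) * frechet_derivative d (at ((p + s *\<^sub>R u) + t *\<^sub>R v)) v"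
    using MVT2[OF h, of ?G "\<lambda>t. frechet_derivative d (at ((p + s *\<^sub>R u) + t *\<^sub>R v)) v"] line[OF d]
    by blast
  show ?thesis
    by (rule that[OF s(1,2) t(1,2)]) (use s(3) t(3) in \<open>simp add: algebra_simps d_def\<close>)
qed

text \<open>Evaluating the second difference in both orders shows that the two mixed derivatives agree at some
  points arbitrarily close to \<open>p\<close>; continuity does the rest.\<close>

lemma frechet_derivative_swap_real:
  fixes g :: "'a::euclidean_space \<Rightarrow> real"
  assumes g: "smooth g"
  shows "frechet_derivative (\<lambda>q. frechet_derivative g (at q) u) (at p) v
       = frechet_derivative (\<lambda>q. frechet_derivative g (at q) v) (at p) u"
    (is "?a p = ?b p")
proof -
  have cont: "isCont ?a p" "isCont ?b p"
    using smooth_frechet_derivative[OF smooth_frechet_derivative[OF g]]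
    by (meson differentiable_imp_continuous_within smooth_differentiable)+
  define h where "h = (\<lambda>n. inverse (real (Suc n)))"
  have h: "h n > 0" for n by (simp add: h_def)
  have h0: "h \<longlonglongrightarrow> 0" unfolding h_def by (rule LIMSEQ_inverse_real_of_nat)
  have "\<forall>n. \<exists>s t s' t'. 0 < s \<and> s < h n \<and> 0 < t \<and> t < h n \<and> 0 < s' \<and> s' < h n \<and> 0 < t' \<and> t' < h n \<and>
      ?a (p + s *\<^sub>R u + t *\<^sub>R v) = ?b (p + s' *\<^sub>R v + t' *\<^sub>R u)"
  proof
    fix n
    obtain s t where st: "0 < s" "s < h n" "0 < t" "t < h n"
      "g (p + h n *\<^sub>R u + h n *\<^sub>R v) - g (p + h n *\<^sub>R u) - g (p + h n *\<^sub>R v) + g p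
        = h n * h n * ?a (p + s *\<^sub>R u + t *\<^sub>R v)"
      by (rule second_difference_mean_value[OF g h])
    obtain s' t' where st': "0 < s'" "s' < h n" "0 < t'" "t' < h n"
      "g (p + h n *\<^sub>R v + h n *\<^sub>R u) - g (p + h n *\<^sub>R v) - g (p + h n *\<^sub>R u) + g p
        = h n * h n * ?b (p + s' *\<^sub>R v + t' *\<^sub>R u)"
      by (rule second_difference_mean_value[OF g h])
    have "g (p + h n *\<^sub>R v + h n *\<^sub>R u) = g (p + h n *\<^sub>R u + h n *\<^sub>R v)"
      by (simp add: algebra_simps)
    then have "h n * h n * ?a (p + s *\<^sub>R u + t *\<^sub>R v) = h n * h n * ?b (p + s' *\<^sub>R v + t' *\<^sub>R u)"
      using st(5) st'(5) by linarith
    then have "?a (p + s *\<^sub>R u + t *\<^sub>R v) = ?b (p + s' *\<^sub>R v + t' *\<^sub>R u)"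
      using h[of n] by simp
    with st st' show "\<exists>s t s' t'. 0 < s \<and> s < h n \<and> 0 < t \<and> t < h n \<and> 0 < s' \<and> s' < h n \<and> 0 < t' \<and> t' < h n \<and>
      ?a (p + s *\<^sub>R u + t *\<^sub>R v) = ?b (p + s' *\<^sub>R v + t' *\<^sub>R u)" by blast
  qed
  then obtain s t s' t' where st: "\<And>n. 0 < s n \<and> s n < h n" "\<And>n. 0 < t n \<and> t n < h n"
      "\<And>n. 0 < s' n \<and> s' n < h n" "\<And>n. 0 < t' n \<and> t' n < h n"
      "\<And>n. ?a (p + s n *\<^sub>R u + t n *\<^sub>R v) = ?b (p + s' n *\<^sub>R v + t' n *\<^sub>R u)"
    by metis
  have squeeze: "r \<longlonglongrightarrow> 0" if "\<And>n. 0 < r n \<and> r n < h n" for r :: "nat \<Rightarrow> real"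
    using that by (intro tendsto_sandwich[OF _ _ tendsto_const h0]) (auto intro!: always_eventually less_imp_le)
  have "(\<lambda>n. p + s n *\<^sub>R u + t n *\<^sub>R v) \<longlonglongrightarrow> p + 0 *\<^sub>R u + 0 *\<^sub>R v"
       "(\<lambda>n. p + s' n *\<^sub>R v + t' n *\<^sub>R u) \<longlonglongrightarrow> p + 0 *\<^sub>R v + 0 *\<^sub>R u"
    using squeeze st by (auto intro!: tendsto_intros simp del: scaleR_zero_left)
  then have "(\<lambda>n. ?a (p + s n *\<^sub>R u + t n *\<^sub>R v)) \<longlonglongrightarrow> ?a p"
            "(\<lambda>n. ?b (p + s' n *\<^sub>R v + t' n *\<^sub>R u)) \<longlonglongrightarrow> ?b p"
    using isCont_tendsto_compose[OF cont(1)] isCont_tendsto_compose[OF cont(2)] by auto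
  then show ?thesis unfolding st(5) by (rule LIMSEQ_unique)
qed

lemma frechet_derivative_swap:
  fixes f :: "'a::euclidean_space \<Rightarrow> 'b::euclidean_space"
  assumes f: "smooth f"
  shows "frechet_derivative (\<lambda>q. frechet_derivative f (at q) u) (at p) v
       = frechet_derivative (\<lambda>q. frechet_derivative f (at q) v) (at p) u"
proof (rule euclidean_eqI)
  fix b :: 'b
  have lin: "linear (\<lambda>y::'b. y \<bullet> b)" by (simp add: bounded_linear.linear bounded_linear_inner_left)
  have "frechet_derivative (\<lambda>q. frechet_derivative f (at q) u) (at p) v \<bullet> b
      = frechet_derivative (\<lambda>q. frechet_derivative (\<lambda>x. f x \<bullet> b) (at q) u) (at p) v" for u v
    by (simp add: frechet_derivative_linear_comp[OF lin] f smooth_frechet_derivative)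
  then show "frechet_derivative (\<lambda>q. frechet_derivative f (at q) u) (at p) v \<bullet> b
      = frechet_derivative (\<lambda>q. frechet_derivative f (at q) v) (at p) u \<bullet> b"
    using frechet_derivative_swap_real[OF smooth_linear[OF lin f], of u p v] by metis
qed

text \<open>This product rule for \<open>q \<mapsto> DZ\<^sub>q (Y q)\<close> isolates a term that depends only on the values of \<open>Y\<close> and
  of the direction \<open>w\<close> at \<open>p\<close> and is symmetric in them; it is the term that cancels in the curvature.\<close>

lemma frechet_derivative_deriv_along:
  fixes Z :: "'a::euclidean_space \<Rightarrow> 'b::euclidean_space"
  assumes Y: "smooth Y" and Z: "smooth Z"
  shows "frechet_derivative (deriv_along Y Z) (at p) w
     = frechet_derivative Z (at p) (frechet_derivative Y (at p) w)
     + frechet_derivative (\<lambda>q. frechet_derivative Z (at q) (Y p)) (at p) w"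
proof -
  let ?D = "\<lambda>f v. frechet_derivative f (at p) v"
  have eq: "deriv_along Y Z = (\<lambda>q. \<Sum>b\<in>Basis. (Y q \<bullet> b) *\<^sub>R frechet_derivative Z (at q) b)"
    unfolding deriv_along_def by (rule ext) (rule frechet_derivative_smooth_expand[OF Z])
  have "((\<lambda>q. \<Sum>b\<in>Basis. (Y q \<bullet> b) *\<^sub>R frechet_derivative Z (at q) b) has_derivative
     (\<lambda>w. \<Sum>b\<in>Basis. (Y p \<bullet> b) *\<^sub>R ?D (\<lambda>q. frechet_derivative Z (at q) b) w + (?D Y w \<bullet> b) *\<^sub>R ?D Z b)) (at p)"
    using smooth_has_derivative[OF Y, of p] smooth_has_derivative[OF smooth_frechet_derivative[OF Z], of _ p]
    by (auto intro!: derivative_eq_intros)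
  then have "?D (deriv_along Y Z) w
     = (\<Sum>b\<in>Basis. (Y p \<bullet> b) *\<^sub>R ?D (\<lambda>q. frechet_derivative Z (at q) b) w) + (\<Sum>b\<in>Basis. (?D Y w \<bullet> b) *\<^sub>R ?D Z b)"
    unfolding eq by (subst frechet_derivative_at[symmetric], assumption) (simp add: sum.distrib)
  also have "(\<Sum>b\<in>Basis. (?D Y w \<bullet> b) *\<^sub>R ?D Z b) = ?D Z (?D Y w)"
    by (rule frechet_derivative_smooth_expand[OF Z, symmetric])
  also have "(\<Sum>b\<in>Basis. (Y p \<bullet> b) *\<^sub>R ?D (\<lambda>q. frechet_derivative Z (at q) b) w)
     = ?D (\<lambda>q. frechet_derivative Z (at q) (Y p)) w"
  proof -
    have "?D (\<lambda>q. frechet_derivative Z (at q) (Y p)) w = ?D (\<lambda>q. frechet_derivative Z (at q) w) (Y p)"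
      by (rule frechet_derivative_swap[OF Z])
    also have "\<dots> = (\<Sum>b\<in>Basis. (Y p \<bullet> b) *\<^sub>R ?D (\<lambda>q. frechet_derivative Z (at q) w) b)"
      by (rule frechet_derivative_smooth_expand[OF smooth_frechet_derivative[OF Z]])
    also have "\<dots> = (\<Sum>b\<in>Basis. (Y p \<bullet> b) *\<^sub>R ?D (\<lambda>q. frechet_derivative Z (at q) b) w)"
      by (rule sum.cong[OF refl]) (rule arg_cong[OF frechet_derivative_swap[OF Z]])
    finally show ?thesis by (rule sym)
  qed
  finally show ?thesis by simp
qed


section \<open>Translation-invariant connections\<close>

lemma deriv_along_const [simp]: "deriv_along X (\<lambda>_. c) = (\<lambda>_. 0)"
  by (simp add: deriv_along_def)

lemma deriv_along_add_left:
  assumes "smooth f"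
  shows "deriv_along (\<lambda>p. X p + Y p) f p = deriv_along X f p + deriv_along Y f p"
  using linear_frechet_derivative[OF smooth_differentiable[OF assms]]
  by (simp add: deriv_along_def linear_add)

lemma deriv_along_scaleR_left:
  assumes "smooth f"
  shows "deriv_along (\<lambda>p. c p *\<^sub>R X p) f p = c p *\<^sub>R deriv_along X f p"
  using linear_frechet_derivative[OF smooth_differentiable[OF assms]]
  by (simp add: deriv_along_def linear_scale)

lemma deriv_along_add:
  assumes "smooth f" "smooth g"
  shows "deriv_along X (\<lambda>p. f p + g p) p = deriv_along X f p + deriv_along X g p"
  unfolding deriv_along_def
  by (subst frechet_derivative_at[symmetric, OF has_derivative_add[OF
        smooth_has_derivative[OF assms(1)] smooth_has_derivative[OF assms(2)]]]) simp

lemma deriv_along_bilinear: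
  assumes "bounded_bilinear B" "smooth f" "smooth g"
  shows "deriv_along X (\<lambda>p. B (f p) (g p)) p = B (f p) (deriv_along X g p) + B (deriv_along X f p) (g p)"
  unfolding deriv_along_def
  by (rule frechet_derivative_bilinear[OF assms(1) smooth_differentiable[OF assms(2)] smooth_differentiable[OF assms(3)]])

text \<open>The connection with constant Christoffel symbols \<open>A\<close>, made extensional outside the smooth vector
  fields.\<close>

definition conn :: "('a::euclidean_space \<Rightarrow> 'a \<Rightarrow> 'a) \<Rightarrow> 'a connection" where
  "conn A = (\<lambda>X\<in>vfields. \<lambda>Y\<in>vfields. \<lambda>p. deriv_along X Y p + A (X p) (Y p))"

lemma const_vfields [simp]: "(\<lambda>_. u) \<in> vfields"
  by (simp add: vfields_def)

lemma conn_apply: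
  "X \<in> vfields \<Longrightarrow> Y \<in> vfields \<Longrightarrow> conn A X Y = (\<lambda>p. deriv_along X Y p + A (X p) (Y p))"
  by (simp add: conn_def)

lemma conn_const: "conn A (\<lambda>_. u) (\<lambda>_. v) = (\<lambda>_. A u v)"
  by (simp add: conn_apply)

lemma conn_in_vfields:
  "bilinear A \<Longrightarrow> X \<in> vfields \<Longrightarrow> Y \<in> vfields \<Longrightarrow> conn A X Y \<in> vfields"
  by (simp add: conn_apply) (simp add: vfields_def smooth_add smooth_deriv_along smooth_bilinear_apply)

lemma affine_connection_conn:
  assumes A: "bilinear A"
  shows "affine_connection (conn A)"
  unfolding affine_connection_def
proof (intro conjI ballI allI impI)
  have "conn A X \<in> vfields \<rightarrow>\<^sub>E vfields" if "X \<in> vfields" for X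
    using that conn_in_vfields[OF A that] by (auto simp: conn_def PiE_iff)
  moreover have "conn A \<in> extensional vfields" by (simp add: conn_def)
  ultimately show "conn A \<in> vfields \<rightarrow>\<^sub>E vfields \<rightarrow>\<^sub>E vfields"
    by (simp only: PiE_iff) blast
next
  fix X Y Z :: "'a vfield" assume "X \<in> vfields" "Y \<in> vfields" "Z \<in> vfields"
  then show "conn A (\<lambda>p. X p + Y p) Z = (\<lambda>p. conn A X Z p + conn A Y Z p)"
    "conn A X (\<lambda>p. Y p + Z p) = (\<lambda>p. conn A X Y p + conn A X Z p)"
    by (auto simp: conn_def vfields_def smooth_add deriv_along_add_left deriv_along_add
        bilinear_ladd[OF A] bilinear_radd[OF A])
next
  fix X Y :: "'a vfield" and f :: "'a \<Rightarrow> real" assume "X \<in> vfields" "Y \<in> vfields" "smooth f"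
  then show "conn A (\<lambda>p. f p *\<^sub>R X p) Y = (\<lambda>p. f p *\<^sub>R conn A X Y p)"
    "conn A X (\<lambda>p. f p *\<^sub>R Y p) = (\<lambda>p. deriv_along X f p *\<^sub>R Y p + f p *\<^sub>R conn A X Y p)"
    by (auto simp: conn_def vfields_def smooth_scaleR deriv_along_scaleR_left
        deriv_along_bilinear[OF bounded_bilinear_scaleR] bilinear_lmul[OF A] bilinear_rmul[OF A] algebra_simps)
qed

lemma affine_connectionD:
  assumes "affine_connection D" "X \<in> vfields" "Y \<in> vfields"
  shows "Z \<in> vfields \<Longrightarrow> D (\<lambda>p. X p + Z p) Y = (\<lambda>p. D X Y p + D Z Y p)"
    and "Z \<in> vfields \<Longrightarrow> D X (\<lambda>p. Y p + Z p) = (\<lambda>p. D X Y p + D X Z p)"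
    and "smooth f \<Longrightarrow> D (\<lambda>p. f p *\<^sub>R X p) Y = (\<lambda>p. f p *\<^sub>R D X Y p)"
    and "smooth f \<Longrightarrow> D X (\<lambda>p. f p *\<^sub>R Y p) = (\<lambda>p. deriv_along X f p *\<^sub>R Y p + f p *\<^sub>R D X Y p)"
  using assms unfolding affine_connection_def by blast+

text \<open>The next two lemmas expand a connection along a moving linear combination of vector fields; they
  turn the values on constant fields into the whole connection.\<close>

lemma affine_connection_sum_left:
  assumes D: "affine_connection D" and "finite I" "\<And>i. i \<in> I \<Longrightarrow> smooth (f i)" "\<And>i. V i \<in> vfields"
    and Y: "Y \<in> vfields"
  shows "D (\<lambda>p. \<Sum>i\<in>I. f i p *\<^sub>R V i p) Y = (\<lambda>p. \<Sum>i\<in>I. f i p *\<^sub>R D (V i) Y p)"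
  using assms(2,3)
proof (induction I rule: finite_induct)
  case empty
  show ?case using affine_connectionD(3)[OF D const_vfields[of 0] Y, of "\<lambda>_. 0"] by simp
next
  case (insert i I)
  have sm: "(\<lambda>p. f i p *\<^sub>R V i p) \<in> vfields" "(\<lambda>p. \<Sum>i\<in>I. f i p *\<^sub>R V i p) \<in> vfields"
    using insert.prems assms(4) insert.hyps(1) by (auto simp: vfields_def intro!: smooth_sum smooth_scaleR)
  have "D (\<lambda>p. f i p *\<^sub>R V i p + (\<Sum>i\<in>I. f i p *\<^sub>R V i p)) Y
      = (\<lambda>p. D (\<lambda>p. f i p *\<^sub>R V i p) Y p + D (\<lambda>p. \<Sum>i\<in>I. f i p *\<^sub>R V i p) Y p)"
    by (rule affine_connectionD(1)[OF D sm(1) Y sm(2)])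
  moreover have "D (\<lambda>p. f i p *\<^sub>R V i p) Y = (\<lambda>p. f i p *\<^sub>R D (V i) Y p)"
    using affine_connectionD(3)[OF D assms(4) Y] insert.prems by blast
  ultimately show ?case using insert by simp
qed

lemma affine_connection_sum_right:
  assumes D: "affine_connection D" and "finite I" "\<And>i. i \<in> I \<Longrightarrow> smooth (f i)" "\<And>i. V i \<in> vfields"
    and X: "X \<in> vfields"
  shows "D X (\<lambda>p. \<Sum>i\<in>I. f i p *\<^sub>R V i p)
      = (\<lambda>p. \<Sum>i\<in>I. deriv_along X (f i) p *\<^sub>R V i p + f i p *\<^sub>R D X (V i) p)"
  using assms(2,3)
proof (induction I rule: finite_induct)
  case empty
  show ?case using affine_connectionD(4)[OF D X const_vfields[of 0], of "\<lambda>_. 0"] by simp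
next
  case (insert i I)
  have sm: "(\<lambda>p. f i p *\<^sub>R V i p) \<in> vfields" "(\<lambda>p. \<Sum>i\<in>I. f i p *\<^sub>R V i p) \<in> vfields"
    using insert.prems assms(4) insert.hyps(1) by (auto simp: vfields_def intro!: smooth_sum smooth_scaleR)
  have "D X (\<lambda>p. f i p *\<^sub>R V i p + (\<Sum>i\<in>I. f i p *\<^sub>R V i p))
      = (\<lambda>p. D X (\<lambda>p. f i p *\<^sub>R V i p) p + D X (\<lambda>p. \<Sum>i\<in>I. f i p *\<^sub>R V i p) p)"
    by (rule affine_connectionD(2)[OF D X sm(1) sm(2)])
  moreover have "D X (\<lambda>p. f i p *\<^sub>R V i p) = (\<lambda>p. deriv_along X (f i) p *\<^sub>R V i p + f i p *\<^sub>R D X (V i) p)"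
    using affine_connectionD(4)[OF D X assms(4)] insert.prems by blast
  ultimately show ?case using insert by simp
qed

text \<open>A connection is determined by its values on constant fields, by expanding both arguments in the
  standard basis. The component functions of the second argument contribute its directional derivative
  through the Leibniz rule.\<close>

lemma affine_connection_const_coefficients:
  assumes D: "affine_connection D" and A: "\<And>u v. D (\<lambda>_. u) (\<lambda>_. v) = (\<lambda>_. A u v)"
  shows "bilinear A" and "D = conn A"
proof -
  have ladd: "A (u + u') v = A u v + A u' v" and radd: "A u (v + v') = A u v + A u v'" for u u' v v'
    using affine_connectionD(1,2)[OF D const_vfields const_vfields const_vfields]
    by (simp_all add: A fun_eq_iff)
  have lmul: "A (c *\<^sub>R u) v = c *\<^sub>R A u v" and rmul: "A u (c *\<^sub>R v) = c *\<^sub>R A u v" for c u v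
    using affine_connectionD(3,4)[OF D const_vfields const_vfields smooth_const]
    by (simp_all add: A fun_eq_iff)
  show bil: "bilinear A"
    by (auto simp: bilinear_def ladd radd lmul rmul intro!: linearI)
  have "D X Y = conn A X Y" if X: "X \<in> vfields" and Y: "Y \<in> vfields" for X Y
  proof -
    have sm: "smooth X" "smooth Y" using X Y by (auto simp: vfields_def)
    have c: "smooth (\<lambda>p. X p \<bullet> b)" "smooth (\<lambda>p. Y p \<bullet> b)" for b
      using sm by (auto intro: smooth_inner)
    have dY: "deriv_along V (\<lambda>p. Y p \<bullet> c) p = deriv_along V Y p \<bullet> c" for c V p
      using deriv_along_bilinear[OF bounded_bilinear_inner sm(2), of "\<lambda>_. c" V p] by simp
    \<comment> \<open>First differentiate along a constant field, expanding only the second argument.\<close>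
    have Db: "D (\<lambda>_. b) Y = (\<lambda>p. deriv_along (\<lambda>_. b) Y p + A b (Y p))" for b
    proof -
      have "D (\<lambda>_. b) Y = D (\<lambda>_. b) (\<lambda>p. \<Sum>c\<in>Basis. (Y p \<bullet> c) *\<^sub>R (\<lambda>_. c) p)"
        by (simp add: euclidean_representation)
      also have "\<dots> = (\<lambda>p. \<Sum>c\<in>Basis. deriv_along (\<lambda>_. b) (\<lambda>p. Y p \<bullet> c) p *\<^sub>R c + (Y p \<bullet> c) *\<^sub>R A b c)"
        using affine_connection_sum_right[OF D finite_Basis, of "\<lambda>c p. Y p \<bullet> c" "\<lambda>c _. c" "\<lambda>_. b"] c
        by (simp add: A)
      also have "\<dots> = (\<lambda>p. deriv_along (\<lambda>_. b) Y p + A b (Y p))"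
      proof
        fix p
        have "A b (Y p) = (\<Sum>c\<in>Basis. (Y p \<bullet> c) *\<^sub>R A b c)"
          using linear_sum[of "A b" "\<lambda>c. (Y p \<bullet> c) *\<^sub>R c" Basis] bil
          by (simp add: bilinear_def euclidean_representation rmul)
        then show "(\<Sum>c\<in>Basis. deriv_along (\<lambda>_. b) (\<lambda>p. Y p \<bullet> c) p *\<^sub>R c + (Y p \<bullet> c) *\<^sub>R A b c)
            = deriv_along (\<lambda>_. b) Y p + A b (Y p)"
          by (simp add: sum.distrib dY euclidean_representation)
      qed
      finally show ?thesis .
    qed
    have "D X Y = D (\<lambda>p. \<Sum>b\<in>Basis. (X p \<bullet> b) *\<^sub>R (\<lambda>_. b) p) Y"
      by (simp add: euclidean_representation)
    also have "\<dots> = (\<lambda>p. \<Sum>b\<in>Basis. (X p \<bullet> b) *\<^sub>R (deriv_along (\<lambda>_. b) Y p + A b (Y p)))"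
      using affine_connection_sum_left[OF D finite_Basis, of "\<lambda>b p. X p \<bullet> b" "\<lambda>b _. b" Y] c Y
      by (simp add: Db)
    also have "\<dots> = conn A X Y"
    proof
      fix p
      have "A (X p) (Y p) = (\<Sum>b\<in>Basis. (X p \<bullet> b) *\<^sub>R A b (Y p))"
        using linear_sum[of "\<lambda>u. A u (Y p)" "\<lambda>c. (X p \<bullet> c) *\<^sub>R c" Basis] bil
        by (simp add: bilinear_def euclidean_representation lmul)
      moreover have "deriv_along X Y p = (\<Sum>b\<in>Basis. (X p \<bullet> b) *\<^sub>R deriv_along (\<lambda>_. b) Y p)"
        unfolding deriv_along_def by (rule frechet_derivative_smooth_expand[OF sm(2)])
      ultimately show "(\<Sum>b\<in>Basis. (X p \<bullet> b) *\<^sub>R (deriv_along (\<lambda>_. b) Y p + A b (Y p))) = conn A X Y p"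
        by (simp add: conn_apply X Y scaleR_add_right sum.distrib)
    qed
    finally show ?thesis .
  qed
  note eq = this
  have D': "D \<in> vfields \<rightarrow>\<^sub>E vfields \<rightarrow>\<^sub>E vfields"
    using D unfolding affine_connection_def by blast
  have A': "conn A \<in> vfields \<rightarrow>\<^sub>E vfields \<rightarrow>\<^sub>E vfields"
    using affine_connection_conn[OF bil] unfolding affine_connection_def by blast
  show "D = conn A"
    by (rule PiE_ext[OF D' A']) (rule PiE_ext[OF PiE_mem[OF D'] PiE_mem[OF A'] eq])
qed

lemma lie_bracket_in_vfields: "X \<in> vfields \<Longrightarrow> Y \<in> vfields \<Longrightarrow> lie_bracket X Y \<in> vfields"
  by (auto simp: vfields_def lie_bracket_def intro!: smooth_minus smooth_deriv_along)

lemma torsion_free_conn: "torsion_free (conn A) \<longleftrightarrow> (\<forall>u v. A u v = A v u)"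
proof
  assume "torsion_free (conn A)"
  then have "conn A (\<lambda>_. u) (\<lambda>_. v) 0 - conn A (\<lambda>_. v) (\<lambda>_. u) 0 = lie_bracket (\<lambda>_. u) (\<lambda>_. v) 0" for u v
    unfolding torsion_free_def by simp
  then show "\<forall>u v. A u v = A v u" by (simp add: conn_const lie_bracket_def)
next
  assume "\<forall>u v. A u v = A v u"
  then show "torsion_free (conn A)"
    by (auto simp: torsion_free_def conn_apply lie_bracket_def)
qed

text \<open>The second derivatives of \<open>Z\<close> cancel by symmetry and those of first order against the Lie
  bracket, so only the commutator of \<open>A X\<close> and \<open>A Y\<close> survives.\<close>

lemma curvature_conn:
  assumes A: "bilinear A" and X: "X \<in> vfields" and Y: "Y \<in> vfields" and Z: "Z \<in> vfields"
  shows "curvature (conn A) X Y Z = (\<lambda>p. A (X p) (A (Y p) (Z p)) - A (Y p) (A (X p) (Z p)))"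
proof
  fix p
  have sm: "smooth X" "smooth Y" "smooth Z" using X Y Z by (auto simp: vfields_def)
  have second: "conn A U (conn A V Z) p =
      frechet_derivative Z (at p) (deriv_along U V p)
      + frechet_derivative (\<lambda>q. frechet_derivative Z (at q) (V p)) (at p) (U p)
      + A (V p) (deriv_along U Z p) + A (deriv_along U V p) (Z p)
      + A (U p) (deriv_along V Z p) + A (U p) (A (V p) (Z p))"
    if U: "U \<in> vfields" and V: "V \<in> vfields" for U V
  proof -
    have sm': "smooth U" "smooth V" using U V by (auto simp: vfields_def)
    have "conn A U (conn A V Z) p
      = deriv_along U (\<lambda>p. deriv_along V Z p + A (V p) (Z p)) p + A (U p) (deriv_along V Z p + A (V p) (Z p))"
      using conn_in_vfields[OF A V Z] by (simp add: conn_apply U V Z)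
    also have "deriv_along U (\<lambda>p. deriv_along V Z p + A (V p) (Z p)) p
      = deriv_along U (deriv_along V Z) p + (A (V p) (deriv_along U Z p) + A (deriv_along U V p) (Z p))"
      using deriv_along_add[OF smooth_deriv_along[OF sm'(2) sm(3)] smooth_bilinear_apply[OF A sm'(2) sm(3)]]
        deriv_along_bilinear[OF A[unfolded bilinear_conv_bounded_bilinear] sm'(2) sm(3)]
      by simp
    also have "deriv_along U (deriv_along V Z) p = frechet_derivative Z (at p) (deriv_along U V p)
      + frechet_derivative (\<lambda>q. frechet_derivative Z (at q) (V p)) (at p) (U p)"
      unfolding deriv_along_def[of U] by (rule frechet_derivative_deriv_along[OF sm'(2) sm(3)])
    finally show ?thesis by (simp add: bilinear_radd[OF A] algebra_simps)
  qed
  have bracket: "conn A (lie_bracket X Y) Z p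
     = frechet_derivative Z (at p) (deriv_along X Y p) - frechet_derivative Z (at p) (deriv_along Y X p)
       + A (deriv_along X Y p) (Z p) - A (deriv_along Y X p) (Z p)"
    using linear_frechet_derivative[OF smooth_differentiable[OF sm(3)]]
    by (simp add: conn_apply lie_bracket_in_vfields X Y Z deriv_along_def[of "lie_bracket X Y"])
       (simp add: lie_bracket_def linear_diff bilinear_lsub[OF A] algebra_simps)
  show "curvature (conn A) X Y Z p = A (X p) (A (Y p) (Z p)) - A (Y p) (A (X p) (Z p))"
    unfolding curvature_def second[OF X Y] second[OF Y X] bracket
      frechet_derivative_swap[OF sm(3), of "X p" p "Y p"]
    by (simp add: algebra_simps)
qed

text \<open>The derivative of \<open>h (Y, Z)\<close> along \<open>X\<close> cancels against the derivative parts of the connection, which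
  leaves a tensor.\<close>

lemma cubic_form_conn:
  assumes h: "bilinear h" and X: "X \<in> vfields" and Y: "Y \<in> vfields" and Z: "Z \<in> vfields"
  shows "cubic_form (\<lambda>_. h) (conn A) X Y Z = (\<lambda>p. - h (A (X p) (Y p)) (Z p) - h (Y p) (A (X p) (Z p)))"
proof
  fix p
  have sm: "smooth X" "smooth Y" "smooth Z" using X Y Z by (auto simp: vfields_def)
  show "cubic_form (\<lambda>_. h) (conn A) X Y Z p = - h (A (X p) (Y p)) (Z p) - h (Y p) (A (X p) (Z p))"
    using deriv_along_bilinear[OF h[unfolded bilinear_conv_bounded_bilinear] sm(2,3), of X p]
    by (simp add: cubic_form_def metric_apply_def conn_apply X Y Z bilinear_ladd[OF h] bilinear_radd[OF h])
qed


subsection \<open>Affine transformations\<close>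

lemma linear_bij_inv_linear: "linear (L :: 'a::euclidean_space \<Rightarrow> 'a) \<Longrightarrow> bij L \<Longrightarrow> linear (inv L)"
  by (simp add: bij_is_inj inj_linear_imp_inv_linear)

lemma inv_affine:
  fixes L :: "'a::euclidean_space \<Rightarrow> 'a"
  assumes "linear L" "bij L"
  shows "inv (\<lambda>p. a + L p) = (\<lambda>p. (- inv L a) + inv L p)"
proof (rule inv_unique_comp)
  have "linear (inv L)" using assms by (simp add: linear_bij_inv_linear)
  then show "(\<lambda>p. a + L p) \<circ> (\<lambda>p. (- inv L a) + inv L p) = id" "(\<lambda>p. (- inv L a) + inv L p) \<circ> (\<lambda>p. a + L p) = id"
    using assms by (auto simp: fun_eq_iff linear_add linear_neg linear_diff surj_f_inv_f bij_is_surj inv_f_f bij_is_inj)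
qed

lemma pushforward_affine:
  assumes "linear L" "bij L"
  shows "pushforward (\<lambda>p. a + L p) X = (\<lambda>p. L (X (- inv L a + inv L p)))"
  unfolding pushforward_def inv_affine[OF assms] by (simp add: frechet_derivative_affine[OF assms(1)])

lemma pushforward_affine_in_vfields:
  assumes "linear L" "bij L" "X \<in> vfields"
  shows "pushforward (\<lambda>p. a + L p) X \<in> vfields"
proof -
  have "linear (inv L)" using assms by (simp add: linear_bij_inv_linear)
  then show ?thesis
    using smooth_linear[OF assms(1) smooth_compose_affine, of "inv L" X] assms(3)
    unfolding pushforward_affine[OF assms(1,2)] vfields_def by blast
qed

text \<open>Both translations and linear automorphisms are affine, so one computation serves left-invariance and
  the action of the automorphism group: affine maps preserve the flat connection and conjugate \<open>A\<close> by
  their linear part.\<close>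

lemma pullback_connection_conn:
  assumes L: "linear L" "bij L"
  shows "pullback_connection (\<lambda>p. a + L p) (conn A) = conn (\<lambda>u v. inv L (A (L u) (L v)))"
proof -
  let ?\<phi> = "\<lambda>p. a + L p"
  have Li: "linear (inv L)" "bij (inv L)" using L by (simp_all add: linear_bij_inv_linear bij_imp_bij_inv)
  have i: "inv L (L x) = x" "L (inv L x) = x" for x
    using L by (simp_all add: inv_f_f bij_is_inj surj_f_inv_f bij_is_surj)
  have ii: "inv (inv L) = L" using L by (simp add: inv_inv_eq)
  have "pushforward (inv ?\<phi>) (conn A (pushforward ?\<phi> X) (pushforward ?\<phi> Y)) p
      = deriv_along X Y p + inv L (A (L (X p)) (L (Y p)))"
    if X: "X \<in> vfields" and Y: "Y \<in> vfields" for X Y p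
  proof -
    have sm: "smooth X" "smooth Y" using X Y by (auto simp: vfields_def)
    let ?q = "a + L p"
    have q: "- inv L a + inv L ?q = p" using Li by (simp add: linear_add i)
    have "pushforward (inv ?\<phi>) (conn A (pushforward ?\<phi> X) (pushforward ?\<phi> Y)) p
      = inv L (conn A (pushforward ?\<phi> X) (pushforward ?\<phi> Y) ?q)"
      unfolding inv_affine[OF L] pushforward_affine[OF Li] ii
      by (simp add: linear_neg[OF L(1)] i)
    also have "\<dots> = inv L (deriv_along (pushforward ?\<phi> X) (pushforward ?\<phi> Y) ?q
         + A (pushforward ?\<phi> X ?q) (pushforward ?\<phi> Y ?q))"
      by (simp add: conn_apply pushforward_affine_in_vfields[OF L] X Y)
    also have "deriv_along (pushforward ?\<phi> X) (pushforward ?\<phi> Y) ?q = L (deriv_along X Y p)"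
    proof -
      have "frechet_derivative (\<lambda>p. L (Y (- inv L a + inv L p))) (at ?q) w
          = L (frechet_derivative Y (at p) (inv L w))" for w
        using frechet_derivative_linear_comp[OF L(1) smooth_compose_affine[OF Li(1) sm(2)], of "- inv L a" ?q w]
          frechet_derivative_compose_affine[OF Li(1) smooth_differentiable[OF sm(2)], of "- inv L a" ?q w]
        by (simp only: q)
      then show ?thesis
        unfolding deriv_along_def pushforward_affine[OF L] q by (simp add: i)
    qed
    finally show ?thesis
      unfolding pushforward_affine[OF L] q by (simp add: linear_add[OF Li(1)] i)
  qed
  then show ?thesis
    unfolding pullback_connection_def conn_def[of "\<lambda>u v. inv L (A (L u) (L v))"]
    by (intro restrict_ext) (auto simp: fun_eq_iff)
qed

text \<open>Translations fix constant vector fields, so invariance makes the covariant derivative of one constant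
  field along another constant.\<close>

lemma translation_invariant_connection:
  assumes D: "affine_connection D" and inv: "\<And>a. pullback_connection (\<lambda>p. a + p) D = D"
  shows "bilinear (\<lambda>u v. D (\<lambda>_. u) (\<lambda>_. v) 0)" and "D = conn (\<lambda>u v. D (\<lambda>_. u) (\<lambda>_. v) 0)"
proof -
  have id: "linear (\<lambda>x::'a. x)" "bij (\<lambda>x::'a. x)" "inv (\<lambda>x::'a. x) = (\<lambda>x. x)"
    using linear_id bij_id inv_id unfolding id_def by auto
  have "D (\<lambda>_. u) (\<lambda>_. v) = (\<lambda>_. D (\<lambda>_. u) (\<lambda>_. v) 0)" for u v
  proof
    fix q :: 'a
    have "D (\<lambda>_. u) (\<lambda>_. v) 0 = pullback_connection (\<lambda>p. q + p) D (\<lambda>_. u) (\<lambda>_. v) 0"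
      by (simp add: inv)
    also have "\<dots> = pushforward (inv (\<lambda>p. q + p)) (D (\<lambda>_. u) (\<lambda>_. v)) 0"
      by (simp add: pullback_connection_def pushforward_affine[OF id(1,2)])
    also have "inv (\<lambda>p. q + p) = (\<lambda>p. - q + p)"
      using inv_affine[OF id(1,2), of q] id(3) by simp
    also have "pushforward \<dots> (D (\<lambda>_. u) (\<lambda>_. v)) 0 = D (\<lambda>_. u) (\<lambda>_. v) q"
      using pushforward_affine[OF id(1,2), of "- q"] id(3) by simp
    finally show "D (\<lambda>_. u) (\<lambda>_. v) q = D (\<lambda>_. u) (\<lambda>_. v) 0" by simp
  qed
  from affine_connection_const_coefficients[where A = "\<lambda>u v. D (\<lambda>_. u) (\<lambda>_. v) 0", OF D this]
  show "bilinear (\<lambda>u v. D (\<lambda>_. u) (\<lambda>_. v) 0)" and "D = conn (\<lambda>u v. D (\<lambda>_. u) (\<lambda>_. v) 0)" .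
qed

lemma pullback_connection_translation_conn: "pullback_connection (\<lambda>p. a + p) (conn A) = conn A"
proof -
  have id: "linear (\<lambda>x::'a. x)" "bij (\<lambda>x::'a. x)" "inv (\<lambda>x::'a. x) = (\<lambda>x. x)"
    using linear_id bij_id inv_id unfolding id_def by auto
  show ?thesis using pullback_connection_conn[OF id(1,2), of a A] id(3) by simp
qed


section \<open>Orthonormal frames depending continuously on the inner product\<close>

lemma inner_productD:
  assumes "inner_product h"
  shows "bilinear h" "h u v = h v u" "u \<noteq> 0 \<Longrightarrow> h u u > 0"
  using assms by (auto simp: inner_product_def)

lemma inner_product_inner: "inner_product ((\<bullet>) :: 'a::euclidean_space form2)"
  using bounded_bilinear_inner by (auto simp: inner_product_def bilinear_conv_bounded_bilinear inner_commute)

lemma inner_product_eqI: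
  assumes "inner_product h" "\<And>w. h x w = h y w"
  shows "x = y"
proof (rule ccontr)
  assume "x \<noteq> y"
  then have "h (x - y) (x - y) > 0" using assms(1) by (simp add: inner_productD(3))
  then show False using assms by (simp add: bilinear_lsub inner_productD(1))
qed

lemma bilinear_expand:
  fixes h :: "'a::euclidean_space \<Rightarrow> 'a \<Rightarrow> real"
  assumes "bilinear h"
  shows "h u v = (\<Sum>b\<in>Basis. \<Sum>c\<in>Basis. (u \<bullet> b) * (v \<bullet> c) * h b c)"
proof -
  have l: "linear (h x)" "linear (\<lambda>x. h x y)" for x y using assms by (auto simp: bilinear_def)
  have "h u v = (\<Sum>b\<in>Basis. (u \<bullet> b) * h b v)"
    using linear_sum[OF l(2), of "\<lambda>b. (u \<bullet> b) *\<^sub>R b" Basis v]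
    by (simp add: linear_scale[OF l(2)] euclidean_representation)
  moreover have "h b v = (\<Sum>c\<in>Basis. (v \<bullet> c) * h b c)" for b
    using linear_sum[OF l(1), of b "\<lambda>b. (v \<bullet> b) *\<^sub>R b" Basis]
    by (simp add: linear_scale[OF l(1)] euclidean_representation)
  ultimately show ?thesis by (simp only: sum_distrib_left mult.assoc)
qed

text \<open>Forms carry the topology of pointwise convergence, in which evaluation at moving vectors is not
  obviously continuous; for bilinear forms it becomes so by expansion in the standard basis.\<close>

lemma continuous_on_form_apply:
  fixes f g :: "'a::euclidean_space form2 \<Rightarrow> 'a"
  assumes S: "S \<subseteq> {h. inner_product h}" and "continuous_on S f" "continuous_on S g"
  shows "continuous_on S (\<lambda>h. h (f h) (g h))"
proof -
  have co: "continuous_on S (\<lambda>h. h b c)" for b c :: 'a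

    using continuous_on_product_then_coordinatewise[where f = "\<lambda>h. h b" and i = c,
        OF continuous_on_product_then_coordinatewise[where f = "\<lambda>h. h" and i = b, OF continuous_on_id]] .
  have cont: "continuous_on S (\<lambda>h. \<Sum>b\<in>Basis. \<Sum>c\<in>Basis. (f h \<bullet> b) * (g h \<bullet> c) * h b c)"
    by (intro continuous_intros assms co)
  have eq: "h (f h) (g h) = (\<Sum>b\<in>Basis. \<Sum>c\<in>Basis. (f h \<bullet> b) * (g h \<bullet> c) * h b c)" if "h \<in> S" for h
    using that S inner_productD(1) bilinear_expand by blast
  show ?thesis by (rule continuous_on_eq[OF cont eq[symmetric]])
qed

text \<open>This is the Gram--Schmidt process: each of its steps is a continuous function of the inner
  product, because the vectors to be normalised never vanish.\<close>

lemma gram_schmidt_continuous: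
  fixes B :: "'a::euclidean_space set"
  assumes "finite B" "independent B"
  shows "\<exists>E. (\<forall>b\<in>B. continuous_on {h. inner_product h} (\<lambda>h. E h b)) \<and>
     (\<forall>h. inner_product h \<longrightarrow>
        (\<forall>b\<in>B. E h b \<in> span B \<and> (\<forall>c\<in>B. h (E h b) (E h c) = (if b = c then 1 else 0))))"
  using assms
proof (induction B rule: finite_induct)
  case empty
  then show ?case by auto
next
  case (insert x B)
  let ?IP = "{h::'a form2. inner_product h}"
  have "independent B" and x: "x \<notin> span B"
    using insert.prems insert.hyps by (auto simp: independent_insert)
  then obtain E where cE: "\<And>b. b \<in> B \<Longrightarrow> continuous_on ?IP (\<lambda>h. E h b)"
    and sE: "\<And>h b. inner_product h \<Longrightarrow> b \<in> B \<Longrightarrow> E h b \<in> span B"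
    and oE: "\<And>h b c. inner_product h \<Longrightarrow> b \<in> B \<Longrightarrow> c \<in> B \<Longrightarrow> h (E h b) (E h c) = (if b = c then 1 else 0)"
    using insert.IH by blast
  \<comment> \<open>The \<open>h\<close>-orthogonal component of the new vector, to be normalised.\<close>
  define w where "w = (\<lambda>h. x - (\<Sum>b\<in>B. h x (E h b) *\<^sub>R E h b))"
  have w0: "w h \<noteq> 0" if "inner_product h" for h
  proof
    assume "w h = 0"
    then have "x = (\<Sum>b\<in>B. h x (E h b) *\<^sub>R E h b)" by (simp add: w_def)
    also have "\<dots> \<in> span B" using sE[OF that] by (intro span_sum span_scale)
    finally show False using x by simp
  qed
  have orth: "h (w h) (E h c) = 0" if h: "inner_product h" and c: "c \<in> B" for h c
  proof -
    note bil = inner_productD(1)[OF h]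
    have l: "linear (\<lambda>u. h u (E h c))" using bil by (simp add: bilinear_def)
    have "h (w h) (E h c) = h x (E h c) - (\<Sum>b\<in>B. h x (E h b) * h (E h b) (E h c))"
      unfolding w_def using linear_sum[OF l, of "\<lambda>b. h x (E h b) *\<^sub>R E h b" B]
      by (simp add: bilinear_lsub[OF bil] bilinear_lmul[OF bil])
    also have "(\<Sum>b\<in>B. h x (E h b) * h (E h b) (E h c)) = (\<Sum>b\<in>B. if b = c then h x (E h b) else 0)"
      using oE[OF h _ c] by (intro sum.cong) auto
    also have "\<dots> = h x (E h c)" using c insert.hyps(1) by simp
    finally show ?thesis by simp
  qed
  have cw: "continuous_on ?IP w"
    unfolding w_def by (intro continuous_intros continuous_on_form_apply cE) auto
  define F where "F = (\<lambda>h. (E h)(x := (1 / sqrt (h (w h) (w h))) *\<^sub>R w h))"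
  have Fx: "F h x = (1 / sqrt (h (w h) (w h))) *\<^sub>R w h" for h by (simp add: F_def)
  have FB: "F h b = E h b" if "b \<in> B" for h b using that insert.hyps(2) by (auto simp: F_def)
  have pos: "h (w h) (w h) > 0" if "inner_product h" for h
    using that w0 by (simp add: inner_productD(3))
  have "continuous_on ?IP (\<lambda>h. F h x)"
    unfolding Fx by (intro continuous_intros continuous_on_form_apply cw) (auto dest!: pos)
  moreover have "F h x \<in> span (insert x B)" if "inner_product h" for h
    unfolding Fx w_def using sE[OF that] span_mono[of B "insert x B"]
    by (intro span_scale span_diff span_sum) (auto simp: span_base)
  moreover have "h (F h x) (F h x) = 1" if "inner_product h" for h
    using pos[OF that] by (simp add: Fx bilinear_lmul bilinear_rmul inner_productD(1)[OF that])
  moreover have "h (F h x) (F h c) = 0" "h (F h c) (F h x) = 0" if h: "inner_product h" and c: "c \<in> B" for h c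
    using orth[OF h c] inner_productD(2)[OF h, of "F h c"]
    by (simp_all add: FB[OF c] Fx bilinear_lmul inner_productD(1)[OF h])
  moreover have "span B \<subseteq> span (insert x B)" by (intro span_mono) auto
  ultimately show ?case
    using FB cE sE oE insert.hyps(2)
    by (intro exI[of _ F]) (auto simp: subset_iff)
qed

definition continuous_frame :: "('a::euclidean_space form2 \<Rightarrow> 'a \<Rightarrow> 'a) \<Rightarrow> bool" where
  "continuous_frame F \<longleftrightarrow>
     (\<forall>h. inner_product h \<longrightarrow> linear (F h) \<and> (\<forall>u v. h (F h u) (F h v) = u \<bullet> v)) \<and>
     (\<forall>u. continuous_on {h. inner_product h} (\<lambda>h. F h u))"

text \<open>One choice of orthonormal frames for all inner products at once; the Gram--Schmidt process applied to
  the standard basis provides such a choice.\<close>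

definition frame :: "'a::euclidean_space form2 \<Rightarrow> 'a \<Rightarrow> 'a" where
  "frame = (SOME F. continuous_frame F)"

lemma continuous_frame_frame: "continuous_frame (frame :: 'a::euclidean_space form2 \<Rightarrow> 'a \<Rightarrow> 'a)"
proof -
  obtain E :: "'a form2 \<Rightarrow> 'a \<Rightarrow> 'a" where cE: "\<And>b. b \<in> Basis \<Longrightarrow> continuous_on {h. inner_product h} (\<lambda>h. E h b)"
    and oE: "\<And>h b c. inner_product h \<Longrightarrow> b \<in> Basis \<Longrightarrow> c \<in> Basis \<Longrightarrow> h (E h b) (E h c) = (if b = c then 1 else 0)"
    using gram_schmidt_continuous[OF finite_Basis independent_Basis, where 'a = 'a] by blast
  define F where "F = (\<lambda>h u. \<Sum>b\<in>Basis. (u \<bullet> b) *\<^sub>R E h b)"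
  have "continuous_frame F"
    unfolding continuous_frame_def
  proof (intro conjI allI impI)
    fix h :: "'a form2" assume h: "inner_product h"
    show "linear (F h)"
      by (rule linearI) (simp_all add: F_def inner_add_left scaleR_add_left sum.distrib scaleR_sum_right)
    have l: "linear (h x)" "linear (\<lambda>x. h x y)" for x y
      using inner_productD(1)[OF h] by (auto simp: bilinear_def)
    have Fu: "F h u = (\<Sum>b\<in>Basis. (u \<bullet> b) *\<^sub>R E h b)" for u by (simp add: F_def)
    show "h (F h u) (F h v) = u \<bullet> v" for u v
    proof -
      have "h (F h u) (F h v) = (\<Sum>b\<in>Basis. (u \<bullet> b) * h (E h b) (F h v))"
        unfolding Fu[of u] by (simp add: linear_sum[OF l(2)] linear_scale[OF l(2)])
      also have "\<dots> = (\<Sum>b\<in>Basis. (u \<bullet> b) * (\<Sum>c\<in>Basis. (v \<bullet> c) * h (E h b) (E h c)))"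
        by (simp add: F_def linear_sum[OF l(1)] linear_scale[OF l(1)])
      also have "\<dots> = (\<Sum>b\<in>Basis. (u \<bullet> b) * (\<Sum>c\<in>Basis. if b = c then v \<bullet> c else 0))"
        using oE[OF h] by (intro sum.cong arg_cong2[where f = "(*)"] refl) auto
      also have "\<dots> = u \<bullet> v"
        by (subst euclidean_inner) (auto intro!: sum.cong)
      finally show ?thesis .
    qed
  next
    show "continuous_on {h. inner_product h} (\<lambda>h. F h u)" for u
      unfolding F_def by (intro continuous_intros cE) auto
  qed
  then show ?thesis unfolding frame_def by (rule someI[where P = continuous_frame])
qed

lemma
  assumes "inner_product h"
  shows linear_frame: "linear (frame h)"
    and frame_inner: "h (frame h u) (frame h v) = u \<bullet> v"
    and bij_frame: "bij (frame h)"
proof -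
  show l: "linear (frame h)" and i: "h (frame h u) (frame h v) = u \<bullet> v" for u v
    using continuous_frame_frame assms unfolding continuous_frame_def by blast+
  have "inj (frame h)"
    unfolding linear_injective_0[OF l]
  proof (intro allI impI)
    fix x assume "frame h x = 0"
    then have "x \<bullet> x = 0"
      using i[of x x] bilinear_lzero[OF inner_productD(1)[OF assms]] by simp
    then show "x = 0" by simp
  qed
  then show "bij (frame h)"
    using l linear_injective_imp_surjective by (auto simp: bij_def)
qed

lemma continuous_on_frame: "continuous_on {h. inner_product h} (\<lambda>h. frame h u)"
  using continuous_frame_frame unfolding continuous_frame_def by blast

lemma frame_inv_frame:
  assumes "inner_product h"
  shows "frame h (inv (frame h) u) = u" "inv (frame h) (frame h u) = u" "linear (inv (frame h))"
  using bij_frame[OF assms] linear_frame[OF assms]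
  by (simp_all add: surj_f_inv_f bij_is_surj inv_f_f bij_is_inj linear_bij_inv_linear)


section \<open>Left-invariant structures as pairs of an inner product and a cubic form\<close>

lemma linear_mult_const:
  fixes f :: "'a::real_vector \<Rightarrow> real"
  shows "linear f \<Longrightarrow> linear (\<lambda>x. c * f x)"
  using linear_compose_scale_right[of f c] by simp

lemma S3D:
  assumes "C \<in> S3"
  shows "linear (\<lambda>u. C u v w)" "linear (\<lambda>v. C u v w)" "linear (\<lambda>w. C u v w)"
    and "C u v w = C v u w" "C u v w = C u w v"
  using assms by (auto simp: S3_def)

lemma S3_compose_linear:
  assumes C: "C \<in> S3" and L: "linear L"
  shows "(\<lambda>u v w. r * C (L u) (L v) (L w)) \<in> S3"
proof -
  have "linear (\<lambda>u. r * C (L u) (L v) (L w))" "linear (\<lambda>v. r * C (L u) (L v) (L w))"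
    "linear (\<lambda>w. r * C (L u) (L v) (L w))" for u v w
    using linear_compose[OF L S3D(1)[OF C], of "L v" "L w"] linear_compose[OF L S3D(2)[OF C], of "L u" "L w"]
      linear_compose[OF L S3D(3)[OF C], of "L u" "L v"]
    by (auto simp: o_def intro: linear_mult_const)
  then show ?thesis
    using S3D(4,5)[OF C] by (auto simp: S3_def)
qed

text \<open>The product dual to \<open>- C / 2\<close> with respect to the standard inner product. The factor is the one in
  \<open>C = \<nabla>g\<close>, where \<open>A\<close> occurs twice with negative sign.\<close>

definition cubic_product :: "'a::euclidean_space form3 \<Rightarrow> 'a \<Rightarrow> 'a \<Rightarrow> 'a" where
  "cubic_product C u v = (\<Sum>b\<in>Basis. (- (1 / 2) * C u v b) *\<^sub>R b)"

lemma cubic_product_inner: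
  assumes "C \<in> S3"
  shows "cubic_product C u v \<bullet> w = - (1 / 2) * C u v w"
proof -
  note l = S3D(3)[OF assms, of u v]
  have "C u v w = (\<Sum>b\<in>Basis. (w \<bullet> b) * C u v b)"
    using linear_sum[OF l, of "\<lambda>b. (w \<bullet> b) *\<^sub>R b" Basis]
    by (simp add: linear_scale[OF l] euclidean_representation)
  then show ?thesis
    by (simp only: cubic_product_def inner_sum_left inner_scaleR_left sum_distrib_left inner_commute[of w] mult.assoc mult.commute[of "C u v _"])
qed

lemma cubic_product_commute: "C \<in> S3 \<Longrightarrow> cubic_product C u v = cubic_product C v u"
  unfolding cubic_product_def using S3D(4) by metis

lemma bilinear_cubic_product:
  assumes "C \<in> S3"
  shows "bilinear (cubic_product C)"
proof -
  have "linear (cubic_product C u)" for u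
    using linear_add[OF S3D(2)[OF assms]] linear_scale[OF S3D(2)[OF assms]]
    by (intro linearI)
       (simp_all add: cubic_product_def scaleR_sum_right add_divide_distrib scaleR_add_left scaleR_left_diff_distrib sum_subtractf sum_negf sum.distrib)
  moreover have "(\<lambda>u. cubic_product C u v) = cubic_product C v" for v
    by (rule ext) (rule cubic_product_commute[OF assms])
  ultimately show ?thesis
    by (simp add: bilinear_def)
qed

definition normal_cubic :: "'a::euclidean_space form2 \<Rightarrow> 'a form3 \<Rightarrow> 'a form3" where
  "normal_cubic h C = (\<lambda>u v w. C (frame h u) (frame h v) (frame h w))"

lemma normal_cubic_in_S3:
  assumes "inner_product h" "C \<in> S3"
  shows "normal_cubic h C \<in> S3"
  using S3_compose_linear[OF assms(2) linear_frame[OF assms(1)], of 1] by (simp add: normal_cubic_def)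

text \<open>Difference between the connection of the structure \<open>(h, C)\<close> and the flat one. Defining it by
  transport of \<open>cubic_product\<close> along the frame spares a separate Riesz representation for \<open>h\<close> and makes
  flatness of \<open>(h, C)\<close> visibly a property of \<open>normal_cubic h C\<close>.\<close>

definition difference_tensor :: "'a::euclidean_space form2 \<Rightarrow> 'a form3 \<Rightarrow> 'a \<Rightarrow> 'a \<Rightarrow> 'a" where
  "difference_tensor h C u v =
     frame h (cubic_product (normal_cubic h C) (inv (frame h) u) (inv (frame h) v))"

lemma difference_tensor_apply:
  assumes h: "inner_product h" and C: "C \<in> S3"
  shows "h (difference_tensor h C u v) w = - (1 / 2) * C u v w"
proof -
  have "h (difference_tensor h C u v) w
    = h (difference_tensor h C u v) (frame h (inv (frame h) w))" by (simp add: frame_inv_frame[OF h])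
  also have "\<dots> = - (1 / 2) * C u v w"
    unfolding difference_tensor_def frame_inner[OF h] cubic_product_inner[OF normal_cubic_in_S3[OF h C]]
    by (simp add: normal_cubic_def frame_inv_frame[OF h])
  finally show ?thesis .
qed

lemma difference_tensor_unique:
  assumes h: "inner_product h" and C: "C \<in> S3" and A: "\<And>u v w. h (A u v) w = - (1 / 2) * C u v w"
  shows "A = difference_tensor h C"
  by (intro ext inner_product_eqI[OF h]) (simp add: A difference_tensor_apply[OF h C])

lemma bilinear_difference_tensor:
  assumes h: "inner_product h" and C: "C \<in> S3"
  shows "bilinear (difference_tensor h C)"
proof -
  have "linear (difference_tensor h C u)" "linear (\<lambda>u. difference_tensor h C u v)" for u v
    using linear_compose[OF linear_compose[OF frame_inv_frame(3)[OF h]] linear_frame[OF h]]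
      bilinear_cubic_product[OF normal_cubic_in_S3[OF h C]]
    unfolding difference_tensor_def bilinear_def o_def by blast+
  then show ?thesis by (simp add: bilinear_def)
qed

lemma difference_tensor_commute:
  "inner_product h \<Longrightarrow> C \<in> S3 \<Longrightarrow> difference_tensor h C u v = difference_tensor h C v u"
  unfolding difference_tensor_def using cubic_product_commute normal_cubic_in_S3 by metis

definition invariant_structure :: "'a::euclidean_space form2 \<Rightarrow> 'a form3 \<Rightarrow> 'a stat" where
  "invariant_structure h C = (\<lambda>_. h, conn (difference_tensor h C))"

lemma cubic_form_invariant_structure:
  assumes h: "inner_product h" and C: "C \<in> S3" and "X \<in> vfields" "Y \<in> vfields" "Z \<in> vfields"
  shows "cubic_form (\<lambda>_. h) (conn (difference_tensor h C)) X Y Z = (\<lambda>p. C (X p) (Y p) (Z p))"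
  using cubic_form_conn[OF inner_productD(1)[OF h] assms(3-5)] S3D(5)[OF C]
  by (simp add: difference_tensor_apply[OF h C] inner_productD(2)[OF h, of "Y _"] fun_eq_iff)

lemma invariant_structure_in_LStat:
  assumes h: "inner_product h" and C: "C \<in> S3"
  shows "invariant_structure h C \<in> LStat"
proof -
  have "riemannian_metric (\<lambda>_. h)" using h by (simp add: riemannian_metric_def)
  moreover have "pullback_metric (\<lambda>p. a + p) (\<lambda>_. h) = (\<lambda>_. h)" for a
    using frechet_derivative_affine[OF linear_id, of a] by (simp add: pullback_metric_def)
  ultimately show ?thesis
    using affine_connection_conn[OF bilinear_difference_tensor[OF h C]] difference_tensor_commute[OF h C] S3D(4,5)[OF C]
    by (auto simp: LStat_def invariant_structure_def statistical_structure_def left_invariant_def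
        torsion_free_conn cubic_form_invariant_structure[OF h C] pullback_connection_translation_conn)
qed

lemma lstat_ident_invariant_structure:
  assumes h: "inner_product h" and C: "C \<in> S3"
  shows "lstat_ident (invariant_structure h C) = (h, C)"
  by (simp add: lstat_ident_def invariant_structure_def metric_apply_def cubic_form_invariant_structure[OF h C])

text \<open>Torsion-freeness makes \<open>A\<close> symmetric; exchanging the first two arguments of the cubic form then gives
  \<open>h (A u w) v = h (A v w) u\<close>. So \<open>h (A u v) w\<close> is totally symmetric, the two terms of the cubic form
  coincide, and \<open>A\<close> can be recovered from it.\<close>

lemma LStat_cases:
  assumes "s \<in> LStat"
  obtains h C where "inner_product h" "C \<in> S3" "s = invariant_structure h C"
proof -
  obtain g D where s: "s = (g, D)" by (cases s)
  have stat: "riemannian_metric g" "affine_connection D" "torsion_free D"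
    "\<And>X Y Z. X \<in> vfields \<Longrightarrow> Y \<in> vfields \<Longrightarrow> Z \<in> vfields \<Longrightarrow> cubic_form g D X Y Z = cubic_form g D Y X Z"
    and inv: "\<And>a. pullback_metric (\<lambda>p. a + p) g = g" "\<And>a. pullback_connection (\<lambda>p. a + p) D = D"
    using assms by (auto simp: s LStat_def statistical_structure_def left_invariant_def)
  define h where "h = g 0"
  have g: "g = (\<lambda>_. h)"
  proof
    fix a
    have "g 0 u v = g a u v" for u v
      using fun_cong[OF fun_cong[OF fun_cong[OF inv(1)[of a]], of 0 u], of v]
        frechet_derivative_affine[OF linear_id, of a] by (simp add: pullback_metric_def)
    then show "g a = h" by (simp add: h_def fun_eq_iff)
  qed
  have h: "inner_product h" using stat(1) by (simp add: h_def riemannian_metric_def)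
  note bil = inner_productD(1)[OF h] and sym = inner_productD(2)[OF h]
  define A where "A = (\<lambda>u v. D (\<lambda>_. u) (\<lambda>_. v) 0)"
  have A: "bilinear A" and D: "D = conn A"
    using translation_invariant_connection[OF stat(2) inv(2)] by (simp_all add: A_def)
  have symA: "A u v = A v u" for u v using stat(3) by (simp add: D torsion_free_conn)
  have symT: "h (A u w) v = h (A v w) u" for u v w
  proof -
    have "- h (A u v) w - h v (A u w) = - h (A v u) w - h u (A v w)"
      using fun_cong[OF stat(4)[OF const_vfields const_vfields const_vfields], of u v w 0]
      unfolding g D cubic_form_conn[OF bil const_vfields const_vfields const_vfields] by simp
    then show ?thesis using symA[of u v] sym[of v] sym[of u] by simp
  qed
  define C where "C = (\<lambda>u v w. (- 2) * h (A u v) w)"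
  have "linear (\<lambda>u. h (A u v) w)" for v w
    using linear_compose[of "\<lambda>u. A u v" "\<lambda>x. h x w"] A bil by (simp add: bilinear_def o_def)
  then have l1: "linear (\<lambda>u. C u v w)" for v w
    unfolding C_def by (rule linear_mult_const)
  have c1: "C u v w = C v u w" for u v w by (simp add: C_def symA[of u v])
  have c2: "C u v w = C u w v" for u v w
    using symT[of w u v] by (simp add: C_def symA[of u])
  have l2: "linear (\<lambda>v. C u v w)" for u w 
    using l1[of u w] by (subst c1)
  have l3: "linear (\<lambda>w. C u v w)" for u v 
    using l2[of u v] by (subst c2)
  have C: "C \<in> S3" using l1 l2 l3 c1 c2 by (simp add: S3_def)
  have "A = difference_tensor h C" by (rule difference_tensor_unique[OF h C]) (simp add: C_def)
  then show ?thesis using that[OF h C] by (simp add: s invariant_structure_def g D)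
qed

lemma lstat_ident_bij_betw: "bij_betw lstat_ident LStat ({h. inner_product h} \<times> S3)"
  by (rule bij_betw_byWitness[where f' = "\<lambda>(h, C). invariant_structure h C"])
     (auto elim!: LStat_cases simp: lstat_ident_invariant_structure invariant_structure_in_LStat)

lemma lstat_of_eq:
  assumes "inner_product h" "C \<in> S3"
  shows "lstat_of h C = invariant_structure h C"
  unfolding lstat_of_def
  by (rule inv_into_f_eq[OF bij_betw_imp_inj_on[OF lstat_ident_bij_betw]
      invariant_structure_in_LStat[OF assms] lstat_ident_invariant_structure[OF assms]])


section \<open>Duality, flatness and the action of automorphisms\<close>

text \<open>The operators \<open>A u\<close> are self-adjoint for \<open>h\<close>, so \<open>A\<close> and \<open>- A\<close> cancel in the defining identity of
  the dual connection; nondegeneracy of \<open>h\<close> makes the solution unique.\<close>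

lemma dual_connection_difference_tensor:
  assumes h: "inner_product h" and C: "C \<in> S3"
  shows "dual_connection (\<lambda>_. h) (conn (difference_tensor h C)) = conn (\<lambda>u v. - difference_tensor h C u v)"
proof -
  let ?A = "difference_tensor h C"
  note bil = inner_productD(1)[OF h]
  have A: "bilinear ?A" by (rule bilinear_difference_tensor[OF h C])
  have nA: "bilinear (\<lambda>u v. - ?A u v)"
    using A by (auto simp: bilinear_def intro: linear_compose_neg)
  have self_adjoint: "h (?A u v) w = h v (?A u w)" for u v w
    using S3D(5)[OF C, of u v w] by (simp add: inner_productD(2)[OF h, of v] difference_tensor_apply[OF h C])
  have leibniz: "deriv_along X (metric_apply (\<lambda>_. h) Y Z) p
      = h (deriv_along X Y p) (Z p) + h (Y p) (deriv_along X Z p)"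
    if "Y \<in> vfields" "Z \<in> vfields" for X Y Z p
    using that deriv_along_bilinear[OF bil[unfolded bilinear_conv_bounded_bilinear], of Y Z X p]
    by (simp add: vfields_def metric_apply_def)
  have dual: "deriv_along X (metric_apply (\<lambda>_. h) Y Z) p
      = metric_apply (\<lambda>_. h) (conn ?A X Y) Z p + metric_apply (\<lambda>_. h) Y (conn (\<lambda>u v. - ?A u v) X Z) p"
    if "X \<in> vfields" "Y \<in> vfields" "Z \<in> vfields" for X Y Z p
    using that by (simp add: leibniz) (simp add: metric_apply_def conn_apply bilinear_ladd[OF bil] bilinear_radd[OF bil]
        bilinear_rneg[OF bil] bilinear_rsub[OF bil] self_adjoint)
  show ?thesis
    unfolding dual_connection_def
  proof (rule the_equality)
    show "affine_connection (conn (\<lambda>u v. - ?A u v)) \<and>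
      (\<forall>X\<in>vfields. \<forall>Y\<in>vfields. \<forall>Z\<in>vfields. \<forall>p. deriv_along X (metric_apply (\<lambda>_. h) Y Z) p
      = metric_apply (\<lambda>_. h) (conn ?A X Y) Z p + metric_apply (\<lambda>_. h) Y (conn (\<lambda>u v. - ?A u v) X Z) p)"
      using affine_connection_conn[OF nA] dual by blast
  next
    fix D' assume D': "affine_connection D' \<and>
      (\<forall>X\<in>vfields. \<forall>Y\<in>vfields. \<forall>Z\<in>vfields. \<forall>p. deriv_along X (metric_apply (\<lambda>_. h) Y Z) p
      = metric_apply (\<lambda>_. h) (conn ?A X Y) Z p + metric_apply (\<lambda>_. h) Y (D' X Z) p)"
    have eq: "D' X Z = conn (\<lambda>u v. - ?A u v) X Z" if X: "X \<in> vfields" and Z: "Z \<in> vfields" for X Z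
    proof (intro ext inner_product_eqI[OF h])
      fix p w
      have "metric_apply (\<lambda>_. h) (\<lambda>_. w) (D' X Z) p = metric_apply (\<lambda>_. h) (\<lambda>_. w) (conn (\<lambda>u v. - ?A u v) X Z) p"
        using D' dual[OF X const_vfields Z, of w p] X Z const_vfields by force
      then show "h (D' X Z p) w = h (conn (\<lambda>u v. - ?A u v) X Z p) w"
        by (simp add: metric_apply_def inner_productD(2)[OF h, of w])
    qed
    have 1: "D' \<in> vfields \<rightarrow>\<^sub>E vfields \<rightarrow>\<^sub>E vfields"
      using D' unfolding affine_connection_def by blast
    have 2: "conn (\<lambda>u v. - ?A u v) \<in> vfields \<rightarrow>\<^sub>E vfields \<rightarrow>\<^sub>E vfields"
      using affine_connection_conn[OF nA] unfolding affine_connection_def by blast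
    show "D' = conn (\<lambda>u v. - ?A u v)"
      by (rule PiE_ext[OF 1 2]) (rule PiE_ext[OF PiE_mem[OF 1] PiE_mem[OF 2] eq])
  qed
qed

text \<open>Passing to the dual connection replaces the difference tensor \<open>A\<close> by \<open>- A\<close>, and the
  curvature is quadratic in \<open>A\<close>.\<close>

lemma LStat_eq_LStat_CS: "LStat = LStat_CS"
proof -
  have "conjugate_symmetric s" if s: "s \<in> LStat" for s :: "'a stat"
  proof -
    from s obtain h C where h: "inner_product h" and C: "C \<in> S3" and s: "s = invariant_structure h C"
      by (rule LStat_cases)
    have A: "bilinear (difference_tensor h C)" by (rule bilinear_difference_tensor[OF h C])
    then have nA: "bilinear (\<lambda>u v. - difference_tensor h C u v)"
      by (auto simp: bilinear_def intro: linear_compose_neg)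
    show ?thesis
      by (simp add: s conjugate_symmetric_def invariant_structure_def dual_connection_difference_tensor[OF h C]
          curvature_conn[OF A] curvature_conn[OF nA] bilinear_rneg[OF A])
  qed
  then show ?thesis by (auto simp: LStat_CS_def)
qed

text \<open>Associativity of the commutative product \<open>cubic_product C\<close>, stated as commutation of its
  multiplication operators.\<close>

definition flat_cubic :: "'a::euclidean_space form3 \<Rightarrow> bool" where
  "flat_cubic C \<longleftrightarrow> (\<forall>u v w. cubic_product C u (cubic_product C v w) = cubic_product C v (cubic_product C u w))"

lemma dually_flat_invariant_structure:
  assumes h: "inner_product h" and C: "C \<in> S3"
  shows "dually_flat (invariant_structure h C) \<longleftrightarrow>
    (\<forall>u v w. difference_tensor h C u (difference_tensor h C v w) = difference_tensor h C v (difference_tensor h C u w))"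
    (is "_ = ?R")
proof
  note curv = curvature_conn[OF bilinear_difference_tensor[OF h C]]
  assume "dually_flat (invariant_structure h C)"
  then have "curvature (conn (difference_tensor h C)) (\<lambda>_. u) (\<lambda>_. v) (\<lambda>_. w) = (\<lambda>_. 0)" for u v w
    unfolding dually_flat_def invariant_structure_def by simp
  then show ?R by (simp add: curv fun_eq_iff)
next
  assume ?R
  then show "dually_flat (invariant_structure h C)"
    by (simp add: dually_flat_def invariant_structure_def curvature_conn[OF bilinear_difference_tensor[OF h C]])
qed

lemma dually_flat_iff_flat_normal_cubic:
  assumes h: "inner_product h" and C: "C \<in> S3"
  shows "dually_flat (invariant_structure h C) \<longleftrightarrow> flat_cubic (normal_cubic h C)"
proof -
  let ?F = "frame h" and ?P = "cubic_product (normal_cubic h C)"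
  have T: "difference_tensor h C (?F u) (difference_tensor h C (?F v) (?F w)) = ?F (?P u (?P v w))" for u v w
    by (simp add: difference_tensor_def frame_inv_frame[OF h])
  have "(\<forall>u v w. difference_tensor h C u (difference_tensor h C v w) = difference_tensor h C v (difference_tensor h C u w))
    \<longleftrightarrow> (\<forall>u v w. difference_tensor h C (?F u) (difference_tensor h C (?F v) (?F w))
            = difference_tensor h C (?F v) (difference_tensor h C (?F u) (?F w)))"
    using frame_inv_frame(1)[OF h] by metis
  also have "\<dots> \<longleftrightarrow> flat_cubic (normal_cubic h C)"
    unfolding T flat_cubic_def using bij_is_inj[OF bij_frame[OF h]] by (simp add: inj_eq)
  finally show ?thesis using dually_flat_invariant_structure[OF h C] by simp
qed

lemma dually_flat_standard:
  assumes C: "C \<in> S3"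
  shows "dually_flat (invariant_structure (\<bullet>) C) \<longleftrightarrow> flat_cubic C"
proof -
  have "cubic_product C = difference_tensor (\<bullet>) C"
    by (rule difference_tensor_unique[OF inner_product_inner C]) (rule cubic_product_inner[OF C])
  then show ?thesis
    unfolding dually_flat_invariant_structure[OF inner_product_inner C] flat_cubic_def by simp
qed

text \<open>An additive map has the same derivative \<open>L\<close> at every point, so it differs from \<open>L\<close> by a
  constant, which is zero.\<close>

lemma Lie_Aut_eq: "Lie_Aut = {\<phi> :: 'a::euclidean_space \<Rightarrow> 'a. linear \<phi> \<and> bij \<phi>}"
proof (intro equalityI subsetI)
  fix \<phi> :: "'a \<Rightarrow> 'a" assume "\<phi> \<in> Lie_Aut"
  then have bij: "bij \<phi>" and add: "\<And>a b. \<phi> (a + b) = \<phi> a + \<phi> b" and sm: "smooth \<phi>"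
    by (auto simp: Lie_Aut_def)
  have zero: "\<phi> 0 = 0" using add[of 0 0] by simp
  define L where "L = frechet_derivative \<phi> (at 0)"
  have L: "linear L" unfolding L_def by (rule linear_frechet_derivative[OF smooth_differentiable[OF sm]])
  have d: "(\<phi> has_derivative L) (at p)" for p
  proof -
    have "((\<lambda>q. - p + q) has_derivative (\<lambda>x. x)) (at p)" by (auto intro!: derivative_eq_intros)
    moreover have "(\<phi> has_derivative L) (at (- p + p))" unfolding L_def using smooth_has_derivative[OF sm, of 0] by simp
    ultimately have "((\<lambda>q. \<phi> (- p + q)) has_derivative (\<lambda>x. L x)) (at p)"
      by (rule has_derivative_compose)
    then have "((\<lambda>q. \<phi> (- p + q) + \<phi> p) has_derivative (\<lambda>x. L x + 0)) (at p)"
      by (intro has_derivative_add has_derivative_const)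
    moreover have "\<phi> (- p + q) + \<phi> p = \<phi> q" for q using add[of "- p + q" p] by (simp add: add.commute)
    ultimately show ?thesis by simp
  qed
  have "((\<lambda>x. \<phi> x - L x) has_derivative (\<lambda>h. L h - L h)) (at x)" for x
    by (intro has_derivative_diff d linear_imp_has_derivative L)
  then have "\<phi> x - L x = \<phi> 0 - L 0" for x
    using has_derivative_zero_unique[of UNIV "\<lambda>x. \<phi> x - L x" x 0] by simp
  then have "\<phi> = L" using zero L by (auto simp: fun_eq_iff linear_0)
  then show "\<phi> \<in> {\<phi>. linear \<phi> \<and> bij \<phi>}" using L bij by simp
next
  fix \<phi> :: "'a \<Rightarrow> 'a" assume "\<phi> \<in> {\<phi>. linear \<phi> \<and> bij \<phi>}"
  then have l: "linear \<phi>" "bij \<phi>" "linear (inv \<phi>)" by (auto simp: linear_bij_inv_linear)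
  have "smooth L" if "linear L" for L :: "'a \<Rightarrow> 'a"
  proof -
    have "C_k k L" for k
      using frechet_derivative_affine[OF that, of 0] differentiable_affine[OF that, of 0]
        linear_continuous_on[OF that[unfolded linear_conv_bounded_linear]]
      by (cases k) (auto simp: C_k_const)
    then show ?thesis by (simp add: smooth_def)
  qed
  then show "\<phi> \<in> Lie_Aut" using l by (auto simp: Lie_Aut_def linear_add)
qed

definition form_act :: "real \<times> ('a::euclidean_space \<Rightarrow> 'a) \<Rightarrow> 'a form2 \<Rightarrow> 'a form2" where
  "form_act = (\<lambda>(r, k) h. \<lambda>u v. r * h (inv k u) (inv k v))"

lemma inner_product_form_act:
  assumes h: "inner_product h" and r: "r > 0" and k: "linear k" "bij k"
  shows "inner_product (form_act (r, k) h)"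
proof -
  have ki: "linear (inv k)" "inj (inv k)" using k by (simp_all add: linear_bij_inv_linear bij_imp_bij_inv bij_is_inj)
  have "linear (\<lambda>u. r * h (inv k u) (inv k v))" "linear (\<lambda>v. r * h (inv k u) (inv k v))" for u v
    using linear_compose[OF ki(1), of "\<lambda>u. h u (inv k v)"] linear_compose[OF ki(1), of "h (inv k u)"]
      inner_productD(1)[OF h] by (auto simp: bilinear_def o_def intro!: linear_mult_const)
  moreover have "inv k u \<noteq> 0" if "u \<noteq> 0" for u
    using that linear_injective_0[OF ki(1)] ki(2) by blast
  ultimately show ?thesis
    using r inner_productD(2,3)[OF h] by (auto simp: inner_product_def form_act_def bilinear_def)
qed

lemma cubic_act_in_S3:
  assumes "C \<in> S3" "linear k" "bij k"
  shows "cubic_act (r, k) C \<in> S3"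
  using S3_compose_linear[OF assms(1) linear_bij_inv_linear[OF assms(2,3)]] by (simp add: cubic_act_def)

text \<open>Under the identification with pairs, the group acts on inner products and on cubic forms by the same
  formula: multiplication by \<open>r\<close> and substitution of \<open>\<phi>\<^sup>-\<^sup>1\<close>.\<close>

lemma stat_act_invariant_structure:
  assumes h: "inner_product h" and C: "C \<in> S3" and r: "r > 0" and \<phi>: "linear \<phi>" "bij \<phi>"
  shows "stat_act (r, \<phi>) (invariant_structure h C) = invariant_structure (form_act (r, \<phi>) h) (cubic_act (r, \<phi>) C)"
proof -
  have \<psi>: "linear (inv \<phi>)" "bij (inv \<phi>)" "inv (inv \<phi>) = \<phi>"
    using \<phi> by (simp_all add: linear_bij_inv_linear bij_imp_bij_inv inv_inv_eq)
  have "pullback_metric (inv \<phi>) (\<lambda>_. h) = (\<lambda>p u v. h (inv \<phi> u) (inv \<phi> v))"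
    using frechet_derivative_affine[OF \<psi>(1), of 0] by (simp add: pullback_metric_def)
  moreover have "pullback_connection (inv \<phi>) (conn (difference_tensor h C))
     = conn (\<lambda>u v. \<phi> (difference_tensor h C (inv \<phi> u) (inv \<phi> v)))"
    using pullback_connection_conn[OF \<psi>(1,2), of 0 "difference_tensor h C"] by (simp add: \<psi>(3))
  moreover have "(\<lambda>u v. \<phi> (difference_tensor h C (inv \<phi> u) (inv \<phi> v)))
     = difference_tensor (form_act (r, \<phi>) h) (cubic_act (r, \<phi>) C)"
    using \<phi>(2) by (intro difference_tensor_unique inner_product_form_act[OF h r \<phi>] cubic_act_in_S3[OF C \<phi>])
      (simp add: form_act_def cubic_act_def inv_f_f bij_is_inj difference_tensor_apply[OF h C])
  ultimately show ?thesis
    by (simp add: stat_act_def invariant_structure_def form_act_def)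
qed


section \<open>Flat cubic forms are diagonal\<close>

lemma trilinear_rotate:
  assumes P: "bilinear P" and comm: "\<And>u v. P u v = P v u" and adj: "\<And>u v w. P u v \<bullet> w = v \<bullet> P u w"
  shows "P (a *\<^sub>R e + b *\<^sub>R w) (a *\<^sub>R e + b *\<^sub>R w) \<bullet> (a *\<^sub>R e + b *\<^sub>R w)
     = a ^ 3 * (P e e \<bullet> e) + 3 * a ^ 2 * b * (P e e \<bullet> w) + 3 * a * b ^ 2 * (P e w \<bullet> w) + b ^ 3 * (P w w \<bullet> w)"
proof -
  have "P w e = P e w" "P e w \<bullet> e = P e e \<bullet> w" "P w w \<bullet> e = P e w \<bullet> w"
    using comm adj inner_commute by metis+
  then show ?thesis
    by (simp add: bilinear_ladd[OF P] bilinear_radd[OF P] bilinear_lmul[OF P] bilinear_rmul[OF P]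
        inner_add_left inner_add_right power2_eq_square power3_eq_cube algebra_simps)
qed

text \<open>The basis is found one vector at a time. A maximum \<open>e\<close> of the cubic form \<open>P v v \<bullet> v\<close> on the unit
  sphere of \<open>S\<close> satisfies \<open>P e e = M e\<close>. For \<open>w\<close> orthogonal to \<open>e\<close>, commutativity of the
  multiplications gives \<open>P e (P e w) = P w (P e e) = M (P e w)\<close>, so \<open>P e w\<close> is an eigenvector for \<open>M\<close>,
  which maximality excludes unless it vanishes or \<open>M = 0\<close>, and then self-adjointness makes it vanish.
  Hence the orthogonal complement of \<open>e\<close> in \<open>S\<close> is again closed under \<open>P\<close>.\<close>

lemma orthogonal_idempotents:
  fixes P :: "'a::euclidean_space \<Rightarrow> 'a \<Rightarrow> 'a"
  assumes P: "bilinear P" and comm: "\<And>u v. P u v = P v u" and adj: "\<And>u v w. P u v \<bullet> w = v \<bullet> P u w"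
    and flat: "\<And>u v w. P u (P v w) = P v (P u w)"
  shows "subspace S \<Longrightarrow> (\<And>u v. u \<in> S \<Longrightarrow> v \<in> S \<Longrightarrow> P u v \<in> S) \<Longrightarrow>
    \<exists>B. finite B \<and> B \<subseteq> S \<and> S = span B \<and>
      (\<forall>b\<in>B. \<forall>c\<in>B. b \<bullet> c = (if b = c then 1 else 0) \<and> (b \<noteq> c \<longrightarrow> P b c = 0))"
proof (induction "dim S" arbitrary: S rule: less_induct)
  case less
  note S = less.prems(1) and closed = less.prems(2)
  show ?case
  proof (cases "S = {0}")
    case True
    then show ?thesis by (intro exI[of _ "{}"]) auto
  next
    case False
    then obtain s where s: "s \<in> S" "s \<noteq> 0" using subspace_0[OF S] by auto
    define K where "K = S \<inter> sphere 0 1"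
    define f where "f = (\<lambda>v. P v v \<bullet> v)"
    have "(1 / norm s) *\<^sub>R s \<in> K" using s subspace_scale[OF S] by (auto simp: K_def)
    moreover have "compact K" unfolding K_def by (intro closed_Int_compact closed_subspace S compact_sphere)
    moreover have "continuous_on K f"
      unfolding f_def using P bilinear_conv_bounded_bilinear
      by (intro continuous_intros bounded_bilinear.continuous_on[of P]) auto
    ultimately obtain e where e: "e \<in> K" and max: "\<And>v. v \<in> K \<Longrightarrow> f v \<le> f e"
      using continuous_attains_sup[of K f] by blast
    have eS: "e \<in> S" and ee: "e \<bullet> e = 1" using e by (auto simp: K_def dot_square_norm)
    define M where "M = f e"
    have "f (- e) = - f e" by (simp add: f_def bilinear_lneg[OF P] bilinear_rneg[OF P])
    moreover have "- e \<in> K" using e subspace_neg[OF S] by (auto simp: K_def)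
    ultimately have M: "M \<ge> 0" using max[of "- e"] by (simp add: M_def)
    have rotate: "a *\<^sub>R e + b *\<^sub>R w \<in> K"
      if "w \<in> S" "w \<bullet> w = 1" "e \<bullet> w = 0" "a ^ 2 + b ^ 2 = 1" for a b w
    proof -
      have "(a *\<^sub>R e + b *\<^sub>R w) \<bullet> (a *\<^sub>R e + b *\<^sub>R w) = 1"
        using that ee by (simp add: inner_add_left inner_add_right inner_commute[of w e] power2_eq_square)
      then show ?thesis
        using that eS S by (auto simp: K_def norm_eq_1 intro!: subspace_add subspace_scale)
    qed
    \<comment> \<open>The cubic form is stationary at \<open>e\<close> along the great circle from \<open>e\<close> through \<open>w\<close>.\<close>
    have stationary: "P e e \<bullet> w = 0" if w: "w \<in> S" "w \<bullet> w = 1" "e \<bullet> w = 0" for w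
    proof -
      define g where "g = (\<lambda>t. cos t ^ 3 * M + 3 * cos t ^ 2 * sin t * (P e e \<bullet> w)
         + 3 * cos t * sin t ^ 2 * (P e w \<bullet> w) + sin t ^ 3 * (P w w \<bullet> w))"
      have g: "g t = f (cos t *\<^sub>R e + sin t *\<^sub>R w)" for t
        unfolding f_def M_def g_def by (simp add: trilinear_rotate[OF P comm adj])
      have le: "g t \<le> g 0" for t
        using max[OF rotate[OF w, of "cos t" "sin t"]] unfolding g by simp
      have d: "(g has_real_derivative 3 * (P e e \<bullet> w)) (at 0)"
        unfolding g_def by (auto intro!: derivative_eq_intros)
      have "3 * (P e e \<bullet> w) = 0"
        by (rule DERIV_local_max[OF d zero_less_one]) (simp add: le)
      then show ?thesis by simp
    qed
    \<comment> \<open>A second eigenvector \<open>w\<close> for a positive \<open>M\<close> would give a larger value at one of the unit vectors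
      \<open>(3 e \<plusminus> 4 w) / 5\<close>.\<close>
    have M0: "M = 0" if w: "w \<in> S" "w \<bullet> w = 1" "e \<bullet> w = 0" "P e w = M *\<^sub>R w" for w
    proof -
      have "f ((3/5) *\<^sub>R e + (4/5) *\<^sub>R w) \<le> M" "f ((3/5) *\<^sub>R e + (-(4/5)) *\<^sub>R w) \<le> M"
        unfolding M_def by (rule max[OF rotate[OF w(1-3)]]; simp add: power2_eq_square)+
      then have "171 * M + 64 * (P w w \<bullet> w) \<le> 125 * M" "171 * M - 64 * (P w w \<bullet> w) \<le> 125 * M"
        unfolding f_def trilinear_rotate[OF P comm adj] using stationary[OF w(1-3)] w(2,4)
        by (simp_all add: M_def f_def power2_eq_square power3_eq_cube)
      then show ?thesis using M by linarith
    qed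
    have Pee: "P e e = M *\<^sub>R e"
    proof (rule ccontr)
      assume neq: "P e e \<noteq> M *\<^sub>R e"
      define w where "w = P e e - M *\<^sub>R e"
      have w: "w \<in> S" "w \<noteq> 0" using neq closed eS S by (auto simp: w_def intro: subspace_diff subspace_scale)
      have ew: "e \<bullet> w = 0" using ee by (simp add: w_def M_def f_def inner_diff_right inner_commute)
      have "P e e \<bullet> ((1 / norm w) *\<^sub>R w) = 0"
        using w ew S by (intro stationary) (auto simp: subspace_scale power2_norm_eq_inner[symmetric] power2_eq_square)
      then have "P e e \<bullet> w = 0" using w by simp
      then have "w \<bullet> w = 0" using ew by (simp add: w_def inner_diff_left inner_diff_right inner_commute)
      then show False using w by simp
    qed
    have Pe: "P e w = 0" if w: "w \<in> S" "e \<bullet> w = 0" for w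
    proof (rule ccontr)
      assume y: "P e w \<noteq> 0"
      \<comment> \<open>The computation below shows that this unit vector is an eigenvector of \<open>P e\<close> for \<open>M\<close>.\<close>
    define y' where "y' = (1 / norm (P e w)) *\<^sub>R P e w"
      have yS: "y' \<in> S" unfolding y'_def using closed[OF eS w(1)] S by (rule subspace_scale[rotated])
      have "e \<bullet> P e w = P e e \<bullet> w" using adj by simp
      then have ey: "e \<bullet> y' = 0" by (simp add: y'_def Pee w)
      have "P e (P e w) = P e (P w e)" using comm by simp
      also have "\<dots> = P w (P e e)" by (rule flat)
      also have "\<dots> = M *\<^sub>R P e w" by (simp add: Pee bilinear_rmul[OF P] comm)
      finally have Py: "P e (P e w) = M *\<^sub>R P e w" .
      have "M = 0"
        using y by (intro M0[OF yS _ ey])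
          (auto simp: y'_def Py bilinear_rmul[OF P] power2_norm_eq_inner[symmetric] power2_eq_square)
      then have "P e w \<bullet> P e w = 0" using adj[of e w "P e w"] Py by simp
      then show False using y by simp
    qed
    define S' where "S' = S \<inter> {w. e \<bullet> w = 0}"
    have S': "subspace S'" unfolding S'_def using S subspace_hyperplane by (rule subspace_inter)
    have "P u v \<in> S'" if "u \<in> S'" "v \<in> S'" for u v
    proof -
      have "e \<bullet> P u v = P u e \<bullet> v" using adj[of u e v] by simp
      then show ?thesis using that Pe comm[of u e] closed by (auto simp: S'_def)
    qed
    moreover have "dim S' < dim S"
    proof (rule dim_psubset)
      have "e \<notin> S'" "S' \<subseteq> S" using ee by (simp_all add: S'_def)
      then have "S' \<subset> S" using eS by blast
      then show "span S' \<subset> span S"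
        by (simp only: span_eq_iff[THEN iffD2, OF S] span_eq_iff[THEN iffD2, OF S'])
    qed
    ultimately obtain B where B: "finite B" "B \<subseteq> S'" "S' = span B"
      "\<And>b c. b \<in> B \<Longrightarrow> c \<in> B \<Longrightarrow> b \<bullet> c = (if b = c then 1 else 0) \<and> (b \<noteq> c \<longrightarrow> P b c = 0)"
      using less.hyps[OF _ S'] by metis
    have Be: "e \<bullet> b = 0" "b \<bullet> e = 0" "P e b = 0" "P b e = 0" "b \<noteq> e" if "b \<in> B" for b
      using that B(2) Pe comm[of b e] ee by (auto simp: S'_def inner_commute)
    have "S \<subseteq> span (insert e B)"
    proof
      fix v assume v: "v \<in> S"
      have "v - (e \<bullet> v) *\<^sub>R e \<in> S'"
        using v eS S ee by (auto simp: S'_def inner_diff_right intro!: subspace_diff subspace_scale)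
      then have "v - (e \<bullet> v) *\<^sub>R e \<in> span (insert e B)"
        using B(3) span_mono[of B "insert e B"] by blast
      then have "(v - (e \<bullet> v) *\<^sub>R e) + (e \<bullet> v) *\<^sub>R e \<in> span (insert e B)"
        by (rule span_add[OF _ span_scale[OF span_base[OF insertI1]]])
      then show "v \<in> span (insert e B)" by simp
    qed
    moreover have "span (insert e B) \<subseteq> S"
      using eS B(2) S by (intro span_minimal) (auto simp: S'_def)
    ultimately show ?thesis
      using B Be ee eS by (intro exI[of _ "insert e B"]) (auto simp: S'_def)
  qed
qed


subsection \<open>Diagonal cubic forms\<close>

text \<open>The form \<open>diag_cubic\<close> with the dual basis of an orthonormal basis \<open>e\<close> written through inner products.\<close>

definition diag_form :: "('n::finite \<Rightarrow> real ^ 'n) \<Rightarrow> real ^ 'n \<Rightarrow> (real ^ 'n) form3" where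
  "diag_form e l = (\<lambda>u v w. \<Sum>i\<in>UNIV. l $ i * ((e i \<bullet> u) * (e i \<bullet> v) * (e i \<bullet> w)))"

lemma orthonormal_basisD: "orthonormal_basis e \<Longrightarrow> e i \<bullet> e j = (if i = j then 1 else 0)"
  by (simp add: orthonormal_basis_def)

lemma orthonormal_basis_expand:
  assumes "orthonormal_basis e"
  shows "v = (\<Sum>i\<in>UNIV. (e i \<bullet> v) *\<^sub>R e i)"
proof -
  define w where "w = v - (\<Sum>i\<in>UNIV. (e i \<bullet> v) *\<^sub>R e i)"
  have "w \<bullet> e j = 0" for j
    using inner_commute[of v "e j"]
    by (simp add: w_def inner_diff_left inner_sum_left orthonormal_basisD[OF assms] if_distrib cong: if_cong)
  then have "range e \<subseteq> {y. w \<bullet> y = 0}" by auto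
  then have "span (range e) \<subseteq> {y. w \<bullet> y = 0}" by (rule span_minimal) (rule subspace_hyperplane)
  then have "w \<in> {y. w \<bullet> y = 0}" using assms unfolding orthonormal_basis_def by blast
  then show ?thesis by (simp add: w_def)
qed

lemma orthonormal_basis_inner_sum:
  "orthonormal_basis e \<Longrightarrow> e i \<bullet> (\<Sum>j\<in>UNIV. c j *\<^sub>R e j) = c i"
  by (simp add: orthonormal_basisD inner_sum_right if_distrib cong: if_cong)

lemma orthonormal_basis_eqI:
  assumes "orthonormal_basis e" "\<And>i. e i \<bullet> u = e i \<bullet> v"
  shows "u = v"
proof -
  have "u = (\<Sum>i\<in>UNIV. (e i \<bullet> u) *\<^sub>R e i)" by (rule orthonormal_basis_expand[OF assms(1)])
  also have "\<dots> = (\<Sum>i\<in>UNIV. (e i \<bullet> v) *\<^sub>R e i)" by (simp only: assms(2))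
  also have "\<dots> = v" by (rule orthonormal_basis_expand[OF assms(1), symmetric])
  finally show ?thesis .
qed

lemma orthonormal_basis_inner:
  assumes "orthonormal_basis e"
  shows "u \<bullet> v = (\<Sum>i\<in>UNIV. (e i \<bullet> u) * (e i \<bullet> v))"
  by (subst orthonormal_basis_expand[OF assms, of u]) (simp add: inner_sum_left)

lemma orthonormal_basisI:
  fixes e :: "'n::finite \<Rightarrow> real ^ 'n"
  assumes "\<And>i j. e i \<bullet> e j = (if i = j then 1 else 0)"
  shows "orthonormal_basis e"
proof -
  have inj: "inj e"
    using assms by (metis injI zero_neq_one)
  have "independent (range e)"
    using assms by (intro pairwise_orthogonal_independent)
      (auto simp: pairwise_def orthogonal_def, metis inner_zero_left zero_neq_one)
  then have "UNIV \<subseteq> span (range e)"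
    by (intro card_ge_dim_independent) (simp_all add: card_image[OF inj])
  then show ?thesis using assms by (auto simp: orthonormal_basis_def)
qed

lemma orthonormal_basis_image:
  "orthonormal_basis e \<Longrightarrow> orthogonal_transformation k \<Longrightarrow> orthonormal_basis (\<lambda>i. k (e i))"
  by (intro orthonormal_basisI) (simp add: orthogonal_transformation_def orthonormal_basis_def)

lemma orthonormal_basis_transitive:
  assumes e: "orthonormal_basis e" and e': "orthonormal_basis e'"
  obtains k where "orthogonal_transformation k" "\<And>i. k (e i) = e' i"
proof
  define k where "k = (\<lambda>v. \<Sum>i\<in>UNIV. (e i \<bullet> v) *\<^sub>R e' i)"
  have "linear k"
    by (rule linearI) (simp_all add: k_def inner_add_right scaleR_add_left sum.distrib scaleR_sum_right)
  moreover have "k u \<bullet> k v = u \<bullet> v" for u v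
    unfolding orthonormal_basis_inner[OF e', of "k u" "k v"] orthonormal_basis_inner[OF e, of u v]
    by (simp add: k_def orthonormal_basis_inner_sum[OF e'])
  ultimately show "orthogonal_transformation k" by (simp add: orthogonal_transformation_def)
  show "k (e i) = e' i" for i
    using e by (simp add: k_def orthonormal_basis_def if_distrib[of "\<lambda>c. c *\<^sub>R _"] cong: if_cong)
qed

lemma dual_basis_orthonormal:
  assumes e: "orthonormal_basis e"
  shows "dual_basis e x \<longleftrightarrow> x = (\<lambda>i v. e i \<bullet> v)"
proof
  assume x: "dual_basis e x"
  show "x = (\<lambda>i v. e i \<bullet> v)"
  proof (intro ext)
    fix i v
    have l: "linear (x i)" using x by (simp add: dual_basis_def)
    have "x i v = (\<Sum>j\<in>UNIV. (e j \<bullet> v) * x i (e j))"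
      by (subst orthonormal_basis_expand[OF e, of v]) (simp add: linear_sum[OF l] linear_scale[OF l])
    also have "\<dots> = e i \<bullet> v"
    proof -
      have xe: "x i (e j) = (if i = j then 1 else 0)" for j using x by (simp add: dual_basis_def)
      show ?thesis by (simp add: xe if_distrib cong: if_cong)
    qed
    finally show "x i v = e i \<bullet> v" .
  qed
next
  assume "x = (\<lambda>i v. e i \<bullet> v)"
  then show "dual_basis e x"
    using e by (auto simp: dual_basis_def orthonormal_basis_def bounded_linear.linear[OF bounded_linear_inner_right])
qed

text \<open>All \<open>3!\<close> summands of the symmetrised product of three equal covectors coincide.\<close>

lemma sym_prod_cube: "sym_prod [y, y, y] [u, v, w] = y u * y v * y w"
proof -
  have "(\<Prod>i<3. ([y, y, y] ! \<sigma> i) ([u, v, w] ! i)) = y u * y v * y w" if "\<sigma> permutes {..<3}" for \<sigma>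
  proof -
    have "[y, y, y] ! \<sigma> i = y" if "i < 3" for i
    proof -
      have "\<sigma> i < 3" using that permutes_in_image[OF \<open>\<sigma> permutes {..<3}\<close>, of i] by simp
      then consider "\<sigma> i = 0" | "\<sigma> i = 1" | "\<sigma> i = 2" by linarith
      then show ?thesis by cases simp_all
    qed
    then have "(\<Prod>i<3. ([y, y, y] ! \<sigma> i) ([u, v, w] ! i)) = (\<Prod>i<3. y ([u, v, w] ! i))"
      by (intro prod.cong) auto
    also have "\<dots> = y u * y v * y w" by (simp add: eval_nat_numeral)
    finally show ?thesis .
  qed
  then have "(\<Sum>\<sigma> | \<sigma> permutes {..<3}. \<Prod>i<3. ([y, y, y] ! \<sigma> i) ([u, v, w] ! i))
      = (\<Sum>\<sigma> | \<sigma> permutes {..<3::nat}. y u * y v * y w)"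
    by (intro sum.cong) auto
  also have "\<dots> = fact 3 * (y u * y v * y w)"
    using card_permutations[of "{..<3::nat}" 3] by simp
  finally show ?thesis by (simp add: sym_prod_def eval_nat_numeral)
qed

lemma diag_cubic_eq_diag_form:
  "orthonormal_basis e \<Longrightarrow> dual_basis e x \<Longrightarrow> diag_cubic x l = diag_form e l"
  by (simp add: dual_basis_orthonormal diag_cubic_def diag_form_def sym_prod_cube)

lemma diag_form_in_S3: "diag_form e l \<in> S3"
proof -
  have "linear (\<lambda>u. diag_form e l u v w)" for v w
    by (rule linearI) (simp_all add: diag_form_def inner_add_right algebra_simps sum.distrib sum_distrib_left)
  note l1 = this
  have c: "diag_form e l u v w = diag_form e l v u w" "diag_form e l u v w = diag_form e l u w v" for u v w
    by (simp_all add: diag_form_def mult_ac)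
  have l2: "linear (\<lambda>v. diag_form e l u v w)" for u w using l1[of u w] by (subst c(1))
  have l3: "linear (\<lambda>w. diag_form e l u v w)" for u v using l2[of u v] by (subst c(2))
  show ?thesis unfolding S3_def using c l1 l2 l3 by blast
qed

lemma cubic_act_diag_form:
  assumes "orthogonal_transformation k"
  shows "cubic_act (r, k) (diag_form e l) = diag_form (\<lambda>i. k (e i)) (r *\<^sub>R l)"
proof -
  have "e i \<bullet> inv k u = k (e i) \<bullet> u" for i u
  proof -
    have "k (inv k u) = u" using assms by (simp add: orthogonal_transformation_surj surj_f_inv_f)
    then show ?thesis using assms unfolding orthogonal_transformation_def by metis
  qed
  then show ?thesis by (simp add: cubic_act_def diag_form_def sum_distrib_left mult_ac)
qed

lemma flat_diag_form:
  assumes e: "orthonormal_basis e"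
  shows "flat_cubic (diag_form e l)"
proof -
  have prod: "e i \<bullet> cubic_product (diag_form e l) u v = - (1 / 2) * l $ i * (e i \<bullet> u) * (e i \<bullet> v)" for i u v
  proof -
    have "e i \<bullet> cubic_product (diag_form e l) u v = - (1 / 2) * diag_form e l u v (e i)"
      using cubic_product_inner[OF diag_form_in_S3, of e l u v "e i"] by (simp add: inner_commute)
    also have "diag_form e l u v (e i) = l $ i * (e i \<bullet> u) * (e i \<bullet> v)"
      by (simp add: diag_form_def orthonormal_basisD[OF e] if_distrib cong: if_cong)
    finally show ?thesis by simp
  qed
  show ?thesis
    unfolding flat_cubic_def
    by (intro allI orthonormal_basis_eqI[OF e]) (simp add: prod)
qed

text \<open>For two different vectors \<open>b, c\<close> of a basis as in \<open>orthogonal_idempotents\<close>, \<open>C b c\<close> vanishes, so by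
  symmetry only the values \<open>C b b b\<close> survive. Conversely, the product of a diagonal form multiplies
  coordinates, up to constant factors.\<close>

lemma flat_cubic_iff_diag_form:
  fixes C :: "(real ^ 'n::finite) form3"
  assumes C: "C \<in> S3"
  shows "flat_cubic C \<longleftrightarrow> (\<exists>e l. orthonormal_basis e \<and> C = diag_form e l)"
proof
  assume flat: "flat_cubic C"
  let ?P = "cubic_product C"
  note P = cubic_product_inner[OF C]
  have adj: "?P u v \<bullet> w = v \<bullet> ?P u w" for u v w
    using S3D(5)[OF C, of u v w] by (simp add: inner_commute[of v] P)
  obtain B where B: "finite B" "UNIV = span B"
    "\<And>b c. b \<in> B \<Longrightarrow> c \<in> B \<Longrightarrow> b \<bullet> c = (if b = c then 1 else 0) \<and> (b \<noteq> c \<longrightarrow> ?P b c = 0)"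
    using orthogonal_idempotents[OF bilinear_cubic_product[OF C] cubic_product_commute[OF C] adj, of UNIV] flat
    by (auto simp: flat_cubic_def)
  have "independent B"
    using B(3) by (intro pairwise_orthogonal_independent)
      (fastforce simp: pairwise_def orthogonal_def)+
  then have "card B = dim (UNIV :: (real ^ 'n) set)"
    using B(2) dim_eq_card_independent dim_span by metis
  then have "card (UNIV :: 'n set) = card B" by simp
  then obtain e where e: "bij_betw e (UNIV :: 'n set) B"
    using B(1) finite_same_card_bij[of "UNIV :: 'n set" B] by auto
  have eB: "e i \<in> B" for i using e by (auto simp: bij_betw_def)
  have ee: "e i = e j \<longleftrightarrow> i = j" for i j using e by (auto simp: bij_betw_def inj_eq)
  have onb: "orthonormal_basis e"
    using B(3)[OF eB eB] ee by (intro orthonormal_basisI) simp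
  define l where "l = (\<chi> i. C (e i) (e i) (e i))"
  have off: "C (e i) (e j) w = 0" if "i \<noteq> j" for i j w
    using P[of "e i" "e j" w] B(3)[OF eB eB, of i j] that ee by simp
  have Cw: "C (e i) (e i) w = l $ i * (e i \<bullet> w)" for i w
  proof -
    note lin = S3D(3)[OF C, of "e i" "e i"]
    have sum: "C (e i) (e i) w = (\<Sum>j\<in>UNIV. (e j \<bullet> w) * C (e i) (e i) (e j))"
      by (subst orthonormal_basis_expand[OF onb, of w]) (simp add: linear_sum[OF lin] linear_scale[OF lin])
    have coeff: "C (e i) (e i) (e j) = (if j = i then l $ i else 0)" for j
      using off[of i j "e i"] S3D(5)[OF C, of "e i" "e i" "e j"] by (auto simp: l_def)
    show ?thesis unfolding sum coeff by (simp add: if_distrib mult.commute cong: if_cong)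
  qed
  have "C u v w = diag_form e l u v w" for u v w
  proof -
    note l1 = S3D(1)[OF C, of v w]
    have sum: "C u v w = (\<Sum>i\<in>UNIV. (e i \<bullet> u) * C (e i) v w)"
      by (subst orthonormal_basis_expand[OF onb, of u]) (simp add: linear_sum[OF l1] linear_scale[OF l1])
    have coeff: "C (e i) v w = (e i \<bullet> v) * (l $ i * (e i \<bullet> w))" for i
    proof -
      note l2 = S3D(2)[OF C, of "e i" w]
      have sum: "C (e i) v w = (\<Sum>j\<in>UNIV. (e j \<bullet> v) * C (e i) (e j) w)"
        by (subst orthonormal_basis_expand[OF onb, of v]) (simp add: linear_sum[OF l2] linear_scale[OF l2])
      have coeff: "C (e i) (e j) w = (if j = i then l $ i * (e i \<bullet> w) else 0)" for j
        using off Cw by auto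
      show ?thesis unfolding sum coeff by (simp add: if_distrib cong: if_cong)
    qed
    show ?thesis unfolding sum coeff by (simp add: diag_form_def mult_ac)
  qed
  then show "\<exists>e l. orthonormal_basis e \<and> C = diag_form e l" using onb by blast
qed (auto simp: flat_diag_form)

lemma O_orbit_V_eq:
  fixes e :: "'n::finite \<Rightarrow> real ^ 'n"
  assumes e: "orthonormal_basis e" and x: "dual_basis e x"
  shows "O_orbit_V x = {diag_form e' l | e' l. orthonormal_basis e'}"
proof (intro equalityI subsetI)
  fix C :: "(real ^ 'n) form3" assume "C \<in> O_orbit_V x"
  then obtain k l where "orthogonal_transformation k" "C = cubic_act (1, k) (diag_form e l)"
    using diag_cubic_eq_diag_form[OF e x] by (auto simp: O_orbit_V_def V_diag_def O_group_def)
  then show "C \<in> {diag_form e' l | e' l. orthonormal_basis e'}"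
    using orthonormal_basis_image[OF e] cubic_act_diag_form by force
next
  fix C :: "(real ^ 'n) form3" assume "C \<in> {diag_form e' l | e' l. orthonormal_basis e'}"
  then obtain e' l where e': "orthonormal_basis e'" and C: "C = diag_form e' l" by blast
  obtain k where k: "orthogonal_transformation k" "\<And>i. k (e i) = e' i"
    using orthonormal_basis_transitive[OF e e'] by blast
  have "C = cubic_act (1, k) (diag_cubic x l)"
    by (simp add: C diag_cubic_eq_diag_form[OF e x] cubic_act_diag_form[OF k(1)] k(2))
  moreover have "diag_cubic x l \<in> V_diag x" "k \<in> O_group"
    using k(1) by (auto simp: V_diag_def O_group_def)
  ultimately show "C \<in> O_orbit_V x"
    unfolding O_orbit_V_def by blast
qed


section \<open>Homeomorphisms between orbit spaces\<close>

lemma topspace_orbit_space: "topspace (orbit_space G act T) = orbit G act ` topspace T"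
proof
  show "topspace (orbit_space G act T) \<subseteq> orbit G act ` topspace T"
    unfolding topspace_def[of "orbit_space G act T"] by (auto simp: openin_orbit_space)
  have "{x \<in> topspace T. orbit G act x \<in> orbit G act ` topspace T} = topspace T" by auto
  then show "orbit G act ` topspace T \<subseteq> topspace (orbit_space G act T)"
    by (intro openin_subset) (simp add: openin_orbit_space)
qed

text \<open>A set of orbits is open precisely if its union is, so continuity descends to orbit spaces.\<close>

lemma continuous_map_orbit_space:
  assumes f: "continuous_map T U f"
    and F: "\<And>x. x \<in> topspace T \<Longrightarrow> F (orbit G a x) = orbit H b (f x)"
  shows "continuous_map (orbit_space G a T) (orbit_space H b U) F"
  unfolding continuous_map topspace_orbit_space
proof (intro conjI allI impI)
  have fU: "f x \<in> topspace U" if "x \<in> topspace T" for x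
    using f that by (auto simp: continuous_map_def)
  show "F ` orbit G a ` topspace T \<subseteq> orbit H b ` topspace U"
    using F fU by auto
  fix V assume "openin (orbit_space H b U) V"
  then have "openin U {y \<in> topspace U. orbit H b y \<in> V}" by (simp add: openin_orbit_space)
  then have "openin T {x \<in> topspace T. f x \<in> {y \<in> topspace U. orbit H b y \<in> V}}"
    using f by (rule openin_continuous_map_preimage[rotated])
  also have "{x \<in> topspace T. f x \<in> {y \<in> topspace U. orbit H b y \<in> V}}
      = {x \<in> topspace T. orbit G a x \<in> {P \<in> orbit G a ` topspace T. F P \<in> V}}"
    using F fU by auto
  finally show "openin (orbit_space G a T) {P \<in> orbit G a ` topspace T. F P \<in> V}"
    by (simp add: openin_orbit_space)
qed

text \<open>The maps \<open>f\<close> and \<open>g\<close> are inverse to each other only up to the group actions, so the total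
  spaces may have different dimensions, as those of structures and of cubic forms do.\<close>

lemma orbit_spaces_homeomorphic:
  assumes f: "continuous_map T U f" and g: "continuous_map U T g"
    and of: "\<And>x x'. x \<in> topspace T \<Longrightarrow> x' \<in> topspace T \<Longrightarrow> orbit G a x = orbit G a x'
      \<Longrightarrow> orbit H b (f x) = orbit H b (f x')"
    and og: "\<And>y y'. y \<in> topspace U \<Longrightarrow> y' \<in> topspace U \<Longrightarrow> orbit H b y = orbit H b y'
      \<Longrightarrow> orbit G a (g y) = orbit G a (g y')"
    and gf: "\<And>x. x \<in> topspace T \<Longrightarrow> orbit G a (g (f x)) = orbit G a x"
    and fg: "\<And>y. y \<in> topspace U \<Longrightarrow> orbit H b (f (g y)) = orbit H b y"
  shows "orbit_space G a T homeomorphic_space orbit_space H b U"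
proof -
  define F where "F = (\<lambda>P. orbit H b (f (SOME x. x \<in> topspace T \<and> orbit G a x = P)))"
  define K where "K = (\<lambda>Q. orbit G a (g (SOME y. y \<in> topspace U \<and> orbit H b y = Q)))"
  have F: "F (orbit G a x) = orbit H b (f x)" if "x \<in> topspace T" for x
  proof -
    have "(SOME x'. x' \<in> topspace T \<and> orbit G a x' = orbit G a x) \<in> topspace T \<and>
        orbit G a (SOME x'. x' \<in> topspace T \<and> orbit G a x' = orbit G a x) = orbit G a x"
      by (rule someI[of _ x]) (simp add: that)
    then show ?thesis unfolding F_def using of that by blast
  qed
  have K: "K (orbit H b y) = orbit G a (g y)" if "y \<in> topspace U" for y
  proof -
    have "(SOME y'. y' \<in> topspace U \<and> orbit H b y' = orbit H b y) \<in> topspace U \<and>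
        orbit H b (SOME y'. y' \<in> topspace U \<and> orbit H b y' = orbit H b y) = orbit H b y"
      by (rule someI[of _ y]) (simp add: that)
    then show ?thesis unfolding K_def using og that by blast
  qed
  have "f x \<in> topspace U" if "x \<in> topspace T" for x using f that by (auto simp: continuous_map_def)
  moreover have "g y \<in> topspace T" if "y \<in> topspace U" for y using g that by (auto simp: continuous_map_def)
  ultimately have "homeomorphic_maps (orbit_space G a T) (orbit_space H b U) F K"
    unfolding homeomorphic_maps_def topspace_orbit_space
    using continuous_map_orbit_space[OF f F] continuous_map_orbit_space[OF g K]
    by (auto simp: F K gf fg)
  then show ?thesis by (rule homeomorphic_maps_imp_homeomorphic_space)
qed

text \<open>The closure properties are those of a group action, phrased without a group structure on \<open>G\<close>. They
  are required only on the invariant set \<open>X\<close>, since statistical structures are acted upon in a controlled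
  way only when they are left-invariant.\<close>

lemma orbit_act_eq:
  assumes x: "x \<in> X" and g: "g \<in> G"
    and closed: "\<And>g x. g \<in> G \<Longrightarrow> x \<in> X \<Longrightarrow> act g x \<in> X"
    and comp: "\<And>g h x. g \<in> G \<Longrightarrow> h \<in> G \<Longrightarrow> x \<in> X \<Longrightarrow> \<exists>k\<in>G. act g (act h x) = act k x"
    and inverse: "\<And>g x. g \<in> G \<Longrightarrow> x \<in> X \<Longrightarrow> \<exists>k\<in>G. act k (act g x) = x"
  shows "orbit G act (act g x) = orbit G act x"
proof
  show "orbit G act (act g x) \<subseteq> orbit G act x"
  proof
    fix y assume "y \<in> orbit G act (act g x)"
    then obtain h where "h \<in> G" "y = act h (act g x)" by (auto simp: orbit_def)
    then show "y \<in> orbit G act x" using comp[OF _ g x] by (auto simp: orbit_def)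
  qed
  show "orbit G act x \<subseteq> orbit G act (act g x)"
  proof
    fix y assume "y \<in> orbit G act x"
    then obtain h where h: "h \<in> G" "y = act h x" by (auto simp: orbit_def)
    obtain k where k: "k \<in> G" "act k (act g x) = x" using inverse[OF g x] by blast
    then have "y = act h (act k (act g x))" using h by simp
    then show "y \<in> orbit G act (act g x)"
      using comp[OF h(1) k(1) closed[OF g x]] by (auto simp: orbit_def)
  qed
qed

lemma cubic_act_comp:
  "bij k \<Longrightarrow> bij j \<Longrightarrow> cubic_act (r, k) (cubic_act (s, j) C) = cubic_act (r * s, k \<circ> j) C"
  by (simp add: cubic_act_def o_inv_distrib mult.assoc)

lemma form_act_comp:
  "bij k \<Longrightarrow> bij j \<Longrightarrow> form_act (r, k) (form_act (s, j) h) = form_act (r * s, k \<circ> j) h"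
  by (simp add: form_act_def o_inv_distrib mult.assoc)

lemma cubic_act_id: "cubic_act (1, id) C = C"
  by (simp add: cubic_act_def)

lemma form_act_id: "form_act (1, id) h = h"
  by (simp add: form_act_def)

lemma orbit_cubic_act:
  fixes k :: "'a::euclidean_space \<Rightarrow> 'a"
  assumes "r > 0" "orthogonal_transformation k"
  shows "orbit ({0<..} \<times> O_group) cubic_act (cubic_act (r, k) C) = orbit ({0<..} \<times> O_group) cubic_act C"
proof (rule orbit_act_eq[where X = UNIV])
  have bij: "bij k" if "k \<in> O_group" for k :: "'a \<Rightarrow> 'a"
    using that by (simp add: O_group_def orthogonal_transformation_bij)
  fix p q :: "real \<times> ('a \<Rightarrow> 'a)" and D :: "'a form3"
  assume p: "p \<in> {0<..} \<times> O_group"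
  obtain s j where sj: "p = (s, j)" "s > 0" "j \<in> O_group" using p by auto
  show "\<exists>t\<in>{0<..} \<times> O_group. cubic_act t (cubic_act p D) = D"
    using sj bij[of j] orthogonal_transformation_inv[of j]
    by (intro bexI[of _ "(inverse s, inv j)"])
       (auto simp: O_group_def cubic_act_comp bij_imp_bij_inv inv_o_cancel bij_is_inj cubic_act_id)
  assume q: "q \<in> {0<..} \<times> O_group"
  obtain s' j' where sj': "q = (s', j')" "s' > 0" "j' \<in> O_group" using q by auto
  show "\<exists>t\<in>{0<..} \<times> O_group. cubic_act p (cubic_act q D) = cubic_act t D"
    using sj sj' bij[of j] bij[of j'] orthogonal_transformation_compose[of j j']
    by (intro bexI[of _ "(s * s', j \<circ> j')"]) (auto simp: O_group_def cubic_act_comp)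
qed (use assms in \<open>auto simp: O_group_def\<close>)

lemma orbit_cubic_act_eqD:
  fixes C :: "'a::euclidean_space form3"
  assumes "orbit ({0<..} \<times> O_group) cubic_act C = orbit ({0<..} \<times> O_group) cubic_act C'"
  obtains r k where "r > 0" "orthogonal_transformation k" "C' = cubic_act (r, k) C"
proof -
  have "orthogonal_transformation (id :: 'a \<Rightarrow> 'a)" by (simp add: id_def)
  then have "C' \<in> orbit ({0<..} \<times> O_group) cubic_act C'"
    unfolding orbit_def by (intro image_eqI[of _ _ "(1, id)"]) (auto simp: cubic_act_id O_group_def)
  then have "C' \<in> orbit ({0<..} \<times> O_group) cubic_act C" by (simp add: assms)
  then show ?thesis using that by (auto simp: orbit_def O_group_def)
qed

lemma stat_act_in_LStat:
  assumes "p \<in> {0<..} \<times> Lie_Aut" "s \<in> LStat"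
  shows "stat_act p s \<in> LStat"
proof -
  obtain r \<phi> where p: "p = (r, \<phi>)" "r > 0" "linear \<phi>" "bij \<phi>" using assms(1) by (auto simp: Lie_Aut_eq)
  show ?thesis
    using assms(2) by (rule LStat_cases)
      (simp add: p stat_act_invariant_structure invariant_structure_in_LStat inner_product_form_act cubic_act_in_S3)
qed

lemma stat_act_comp:
  assumes s: "s \<in> LStat" and "r > 0" "linear k" "bij k" "r' > 0" "linear j" "bij j"
  shows "stat_act (r, k) (stat_act (r', j) s) = stat_act (r * r', k \<circ> j) s"
proof -
  obtain h C where hC: "inner_product h" "C \<in> S3" "s = invariant_structure h C" using s by (rule LStat_cases)
  show ?thesis
    using assms hC by (simp add: stat_act_invariant_structure inner_product_form_act cubic_act_in_S3
        form_act_comp cubic_act_comp linear_compose bij_comp)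
qed

lemma stat_act_id: "s \<in> LStat \<Longrightarrow> stat_act (1, id) s = s"
  by (erule LStat_cases)
     (simp add: stat_act_invariant_structure linear_id form_act_id cubic_act_id)

lemma orbit_stat_act:
  fixes \<phi> :: "'a::euclidean_space \<Rightarrow> 'a"
  assumes s: "s \<in> LStat" and "r > 0" "linear \<phi>" "bij \<phi>"
  shows "orbit ({0<..} \<times> Lie_Aut) stat_act (stat_act (r, \<phi>) s) = orbit ({0<..} \<times> Lie_Aut) stat_act s"
proof (rule orbit_act_eq[where X = LStat])
  fix p q :: "real \<times> ('a \<Rightarrow> 'a)" and z :: "'a stat"
  assume p: "p \<in> {0<..} \<times> Lie_Aut"
  obtain s j where sj: "p = (s, j)" "s > 0" "linear j" "bij j" using p by (auto simp: Lie_Aut_eq)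
  assume z: "z \<in> LStat"
  show "\<exists>t\<in>{0<..} \<times> Lie_Aut. stat_act t (stat_act p z) = z"
    using sj z by (intro bexI[of _ "(inverse s, inv j)"])
       (auto simp: Lie_Aut_eq stat_act_comp bij_imp_bij_inv linear_bij_inv_linear inv_o_cancel bij_is_inj stat_act_id)
next
  fix p q :: "real \<times> ('a \<Rightarrow> 'a)" and z :: "'a stat"
  assume p: "p \<in> {0<..} \<times> Lie_Aut" and q: "q \<in> {0<..} \<times> Lie_Aut" and z: "z \<in> LStat"
  obtain s j where sj: "p = (s, j)" "s > 0" "linear j" "bij j" using p by (auto simp: Lie_Aut_eq)
  obtain s' j' where sj': "q = (s', j')" "s' > 0" "linear j'" "bij j'" using q by (auto simp: Lie_Aut_eq)
  show "\<exists>t\<in>{0<..} \<times> Lie_Aut. stat_act p (stat_act q z) = stat_act t z"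
    using sj sj' z
    by (intro bexI[of _ "(s * s', j \<circ> j')"]) (auto simp: Lie_Aut_eq stat_act_comp linear_compose bij_comp)
qed (use assms in \<open>auto simp: Lie_Aut_eq intro: stat_act_in_LStat\<close>)

lemma orbit_stat_act_eqD:
  fixes s :: "'a::euclidean_space stat"
  assumes "s' \<in> LStat" and "orbit ({0<..} \<times> Lie_Aut) stat_act s = orbit ({0<..} \<times> Lie_Aut) stat_act s'"
  obtains r \<phi> where "r > 0" "linear \<phi>" "bij \<phi>" "s' = stat_act (r, \<phi>) s"
proof -
  have "s' \<in> orbit ({0<..} \<times> Lie_Aut) stat_act s'"
    unfolding orbit_def using assms(1)
    by (intro image_eqI[of _ _ "(1, id)"]) (auto simp: stat_act_id Lie_Aut_eq linear_id)
  then have "s' \<in> orbit ({0<..} \<times> Lie_Aut) stat_act s" by (simp add: assms)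
  then show ?thesis using that by (auto simp: orbit_def Lie_Aut_eq)
qed


section \<open>Moduli spaces of structures as moduli spaces of cubic forms\<close>

text \<open>The projection from structures to cubic forms that induces the homeomorphisms of moduli spaces.\<close>

definition lstat_cubic :: "'a::euclidean_space stat \<Rightarrow> 'a form3" where
  "lstat_cubic s = normal_cubic (fst (lstat_ident s)) (snd (lstat_ident s))"

lemma lstat_cubic_invariant_structure:
  "inner_product h \<Longrightarrow> C \<in> S3 \<Longrightarrow> lstat_cubic (invariant_structure h C) = normal_cubic h C"
  by (simp add: lstat_cubic_def lstat_ident_invariant_structure)

text \<open>The frames of \<open>h\<close> and of its image under \<open>(r, \<phi>)\<close> differ, up to the factor \<open>\<surd>r\<close>, by an
  orthogonal map \<open>k\<close>; the cubic form scales with one more power of \<open>\<phi>\<close> than the metric, whence the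
  factor \<open>1 / \<surd>r\<close>.\<close>

lemma normal_cubic_act:
  assumes h: "inner_product h" and C: "C \<in> S3" and r: "r > 0" and \<phi>: "linear \<phi>" "bij \<phi>"
  obtains k where "orthogonal_transformation k"
    "normal_cubic (form_act (r, \<phi>) h) (cubic_act (r, \<phi>) C) = cubic_act (1 / sqrt r, k) (normal_cubic h C)"
proof -
  let ?h = "form_act (r, \<phi>) h"
  have h': "inner_product ?h" by (rule inner_product_form_act[OF h r \<phi>])
  note bil = inner_productD(1)[OF h]
  have \<psi>: "linear (inv \<phi>)" using \<phi> by (simp add: linear_bij_inv_linear)
  define k where "k = (\<lambda>u. inv (frame h) (sqrt r *\<^sub>R inv \<phi> (frame ?h u)))"
  have fk: "frame h (k u) = sqrt r *\<^sub>R inv \<phi> (frame ?h u)" for u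
    by (simp add: k_def frame_inv_frame[OF h])
  have "linear k"
    using linear_frame[OF h'] \<psi> frame_inv_frame(3)[OF h]
    by (auto simp: k_def linear_iff scaleR_add_right)
  moreover have "k u \<bullet> k v = u \<bullet> v" for u v
  proof -
    have "k u \<bullet> k v = h (frame h (k u)) (frame h (k v))" by (simp add: frame_inner[OF h])
    also have "\<dots> = ?h (frame ?h u) (frame ?h v)"
      using r by (simp add: fk form_act_def bilinear_lmul[OF bil] bilinear_rmul[OF bil])
    also have "\<dots> = u \<bullet> v" by (rule frame_inner[OF h'])
    finally show ?thesis .
  qed
  ultimately have k: "orthogonal_transformation k" by (simp add: orthogonal_transformation_def)
  then have bij: "bij k" by (rule orthogonal_transformation_bij)
  have scale: "C (a *\<^sub>R u) (a *\<^sub>R v) (a *\<^sub>R w) = a ^ 3 * C u v w" for a u v w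
    using linear_scale[OF S3D(1)[OF C]] linear_scale[OF S3D(2)[OF C]] linear_scale[OF S3D(3)[OF C]]
    by (simp add: power3_eq_cube)
  have "sqrt r ^ 3 * x / sqrt r = r * x" for x using r by (simp add: power3_eq_cube)
  then have "normal_cubic ?h (cubic_act (r, \<phi>) C) = cubic_act (1 / sqrt r, inv k) (normal_cubic h C)"
    using bij by (simp add: normal_cubic_def cubic_act_def inv_inv_eq fk scale)
  then show ?thesis using that[OF orthogonal_transformation_inv[OF k]] by blast
qed

lemma S3_expand:
  assumes "C \<in> S3"
  shows "C u v w = (\<Sum>a\<in>Basis. \<Sum>b\<in>Basis. \<Sum>c\<in>Basis. (u \<bullet> a) * (v \<bullet> b) * (w \<bullet> c) * C a b c)"
proof -
  have "C u v w = (\<Sum>a\<in>Basis. (u \<bullet> a) * C a v w)"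
    using linear_sum[OF S3D(1)[OF assms], of "\<lambda>a. (u \<bullet> a) *\<^sub>R a" Basis v w]
    by (simp add: linear_scale[OF S3D(1)[OF assms]] euclidean_representation)
  moreover have "C a v w = (\<Sum>b\<in>Basis. \<Sum>c\<in>Basis. (v \<bullet> b) * (w \<bullet> c) * C a b c)" for a
    by (rule bilinear_expand) (simp add: bilinear_def S3D(2,3)[OF assms])
  ultimately show ?thesis by (simp only: sum_distrib_left mult.assoc)
qed

lemma continuous_on_form3_eval: "continuous_on S (\<lambda>C :: 'a \<Rightarrow> 'a \<Rightarrow> 'a \<Rightarrow> real. C u v w)"
  using continuous_on_product_then_coordinatewise[where f = "\<lambda>C. C u v" and i = w,
      OF continuous_on_product_then_coordinatewise[where f = "\<lambda>C. C u" and i = v,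
      OF continuous_on_product_then_coordinatewise[where f = "\<lambda>C. C" and i = u, OF continuous_on_id]]] .

lemma continuous_on_into_form3:
  assumes "\<And>u v w. continuous_on S (\<lambda>x. F x u v w)"
  shows "continuous_on S (F :: 'b::topological_space \<Rightarrow> 'a \<Rightarrow> 'a \<Rightarrow> 'a \<Rightarrow> real)"
  by (intro continuous_on_coordinatewise_then_product assms)

lemma continuous_on_normal_cubic:
  "continuous_on ({h. inner_product h} \<times> S3) (\<lambda>p. normal_cubic (fst p) (snd p))"
proof (rule continuous_on_into_form3)
  fix u v w :: 'a
  let ?P = "{h. inner_product h} \<times> (S3 :: 'a form3 set)"
  have fr: "continuous_on ?P (\<lambda>p. frame (fst p) x)" for x :: 'a
    by (rule continuous_on_compose2[OF continuous_on_frame continuous_on_fst[OF continuous_on_id]]) auto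
  have ev: "continuous_on ?P (\<lambda>p. snd p a b c)" for a b c :: 'a
    by (rule continuous_on_compose2[OF continuous_on_form3_eval[of UNIV] continuous_on_snd[OF continuous_on_id]]) auto
  have cont: "continuous_on ?P (\<lambda>p. \<Sum>a\<in>Basis. \<Sum>b\<in>Basis. \<Sum>c\<in>Basis.
      (frame (fst p) u \<bullet> a) * (frame (fst p) v \<bullet> b) * (frame (fst p) w \<bullet> c) * snd p a b c)"
    by (intro continuous_on_sum continuous_on_mult continuous_on_inner fr ev continuous_on_const)
  show "continuous_on ?P (\<lambda>p. normal_cubic (fst p) (snd p) u v w)"
    by (rule continuous_on_eq[OF cont]) (auto simp: normal_cubic_def S3_expand[symmetric])
qed

lemma topspace_lstat_topology: "topspace lstat_topology = LStat"
  by (simp add: lstat_topology_def topspace_pullback_topology)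

text \<open>Every structure can be moved to one whose metric is the standard inner product, continuously in
  the structure, by the frame of its metric.\<close>

lemma moduli_space_homeomorphic:
  fixes Y :: "'a::euclidean_space form3 set"
  assumes Y: "Y \<subseteq> S3" and S: "S = {s \<in> LStat. lstat_cubic s \<in> Y}"
    and std: "\<And>C. C \<in> Y \<Longrightarrow> lstat_of (\<bullet>) C \<in> S"
  shows "moduli_space S homeomorphic_space orbit_space ({0<..} \<times> O_group) cubic_act (top_of_set Y)"
proof -
  have SL: "S \<subseteq> LStat" using S by auto
  have top: "topspace (subtopology lstat_topology S) = S"
    using SL by (auto simp: topspace_subtopology topspace_lstat_topology)
  have ident: "continuous_map (subtopology lstat_topology S) (top_of_set ({h. inner_product h} \<times> S3)) lstat_ident"
  proof -
    have "continuous_map lstat_topology euclidean (id \<circ> lstat_ident :: 'a stat \<Rightarrow> _)"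
      unfolding lstat_topology_def by (rule continuous_map_pullback) (rule continuous_map_id)
    then have "continuous_map (subtopology lstat_topology S) euclidean lstat_ident"
      by (simp add: continuous_map_from_subtopology)
    moreover have "lstat_ident s \<in> {h. inner_product h} \<times> S3" if "s \<in> S" for s
      using bij_betwE[OF lstat_ident_bij_betw] that SL by blast
    ultimately show ?thesis by (auto simp: continuous_map_in_subtopology top)
  qed
  have cm: "continuous_map (top_of_set ({h. inner_product h} \<times> S3)) euclidean (\<lambda>p. normal_cubic (fst p) (snd p :: 'a form3))"
    using continuous_on_normal_cubic by simp
  moreover have "lstat_cubic = (\<lambda>s :: 'a stat. normal_cubic (fst (lstat_ident s)) (snd (lstat_ident s)))"
    by (rule ext) (rule lstat_cubic_def)
  ultimately have "continuous_map (subtopology lstat_topology S) euclidean lstat_cubic"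
    using continuous_map_compose[OF ident cm] by (simp add: o_def)
  moreover have "lstat_cubic s \<in> Y" if "s \<in> S" for s using that S by blast
  ultimately have f: "continuous_map (subtopology lstat_topology S) (top_of_set Y) lstat_cubic"
    by (simp add: continuous_map_in_subtopology top image_subset_iff Pi_iff)
  have g: "continuous_map (top_of_set Y) (subtopology lstat_topology S) (lstat_of (\<bullet>))"
  proof -
    have "continuous_on Y (\<lambda>C. ((\<bullet>), C))" by (intro continuous_intros)
    then have "continuous_on Y (lstat_ident \<circ> lstat_of (\<bullet>))"
      by (rule continuous_on_eq)
         (use Y in \<open>auto simp: lstat_of_eq inner_product_inner lstat_ident_invariant_structure subset_iff\<close>)
    then have "continuous_map (top_of_set Y) lstat_topology (lstat_of (\<bullet>))"
      unfolding lstat_topology_def using std SL by (intro continuous_map_pullback') auto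
    then show ?thesis using std by (auto simp: continuous_map_in_subtopology)
  qed
  show ?thesis
    unfolding moduli_space_def
  proof (rule orbit_spaces_homeomorphic[OF f g])
    fix s s' :: "'a stat"
    assume "s \<in> topspace (subtopology lstat_topology S)" "s' \<in> topspace (subtopology lstat_topology S)"
      and orb: "orbit ({0<..} \<times> Lie_Aut) stat_act s = orbit ({0<..} \<times> Lie_Aut) stat_act s'"
    then have s: "s \<in> LStat" "s' \<in> LStat" using SL by (auto simp: top)
    obtain r \<phi> where a: "r > 0" "linear \<phi>" "bij \<phi>" "s' = stat_act (r, \<phi>) s"
      using orbit_stat_act_eqD[OF s(2) orb] by blast
    obtain h C where hC: "inner_product h" "C \<in> S3" "s = invariant_structure h C" using s(1) by (rule LStat_cases)
    obtain k where k: "orthogonal_transformation k"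
      "normal_cubic (form_act (r, \<phi>) h) (cubic_act (r, \<phi>) C) = cubic_act (1 / sqrt r, k) (normal_cubic h C)"
      using normal_cubic_act[OF hC(1,2) a(1-3)] by blast
    have "lstat_cubic s' = cubic_act (1 / sqrt r, k) (lstat_cubic s)"
      using a hC k(2) by (simp add: stat_act_invariant_structure lstat_cubic_invariant_structure
          inner_product_form_act cubic_act_in_S3)
    then show "orbit ({0<..} \<times> O_group) cubic_act (lstat_cubic s) = orbit ({0<..} \<times> O_group) cubic_act (lstat_cubic s')"
      using orbit_cubic_act[of "1 / sqrt r" k "lstat_cubic s"] k(1) a(1) by simp
  next
    fix C C' :: "'a form3"
    assume "C \<in> topspace (top_of_set Y)" "C' \<in> topspace (top_of_set Y)"
      and orb: "orbit ({0<..} \<times> O_group) cubic_act C = orbit ({0<..} \<times> O_group) cubic_act C'"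
    then have C: "C \<in> S3" "C' \<in> S3" using Y by auto
    obtain r k where a: "r > 0" "orthogonal_transformation k" "C' = cubic_act (r, k) C"
      using orbit_cubic_act_eqD[OF orb] by blast
    \<comment> \<open>The map \<open>k / r\<close> together with the factor \<open>1 / r\<^sup>2\<close> fixes the inner product and multiplies
      the cubic form by \<open>r\<close>.\<close>
    define \<phi> where "\<phi> = (\<lambda>u. (1 / r) *\<^sub>R k u)"
    have k: "linear k" "bij k" using a(2) by (auto simp: orthogonal_transformation_linear orthogonal_transformation_bij)
    have ki: "k (inv k u) = u" "inv k (k u) = u" for u
      using k by (simp_all add: surj_f_inv_f bij_is_surj inv_f_f bij_is_inj)
    have \<phi>: "linear \<phi>" unfolding \<phi>_def by (rule linear_compose_scale_right[OF k(1)])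
    have inv\<phi>: "inv \<phi> = (\<lambda>u. r *\<^sub>R inv k u)"
      by (rule inv_unique_comp)
         (use a(1) ki linear_scale[OF k(1)] linear_scale[OF linear_bij_inv_linear[OF k]] in \<open>auto simp: \<phi>_def fun_eq_iff\<close>)
    have bij: "bij \<phi>"
      by (rule o_bij[of "\<lambda>u. r *\<^sub>R inv k u"])
         (use a(1) ki linear_scale[OF k(1)] linear_scale[OF linear_bij_inv_linear[OF k]] in \<open>auto simp: \<phi>_def fun_eq_iff\<close>)
    have "inv k u \<bullet> inv k v = u \<bullet> v" for u v
      using orthogonal_transformation_inv[OF a(2)] by (simp add: orthogonal_transformation_def)
    then have h: "form_act (1 / r\<^sup>2, \<phi>) (\<bullet>) = (\<bullet>)"
      using a(1) by (auto simp: form_act_def inv\<phi> power2_eq_square fun_eq_iff)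
    have "C' = cubic_act (1 / r\<^sup>2, \<phi>) C"
      using a(1) linear_scale[OF S3D(1)[OF C(1)]] linear_scale[OF S3D(2)[OF C(1)]] linear_scale[OF S3D(3)[OF C(1)]]
      by (auto simp: a(3) cubic_act_def inv\<phi> power2_eq_square fun_eq_iff)
    then have "lstat_of (\<bullet>) C' = stat_act (1 / r\<^sup>2, \<phi>) (lstat_of (\<bullet>) C)"
      using a(1) \<phi> bij C h by (simp add: lstat_of_eq inner_product_inner stat_act_invariant_structure)
    then show "orbit ({0<..} \<times> Lie_Aut) stat_act (lstat_of (\<bullet>) C) = orbit ({0<..} \<times> Lie_Aut) stat_act (lstat_of (\<bullet>) C')"
      using orbit_stat_act[of "lstat_of (\<bullet>) C" "1 / r\<^sup>2" \<phi>] a(1) \<phi> bij C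
      by (simp add: lstat_of_eq inner_product_inner invariant_structure_in_LStat)
  next
    fix s :: "'a stat" assume "s \<in> topspace (subtopology lstat_topology S)"
    then have s: "s \<in> LStat" using SL by (auto simp: top)
    obtain h C where hC: "inner_product h" "C \<in> S3" "s = invariant_structure h C" using s by (rule LStat_cases)
    let ?\<phi> = "inv (frame h)"
    have \<phi>: "linear ?\<phi>" "bij ?\<phi>" "inv ?\<phi> = frame h"
      using bij_frame[OF hC(1)] frame_inv_frame(3)[OF hC(1)] by (auto simp: bij_imp_bij_inv inv_inv_eq)
    have "form_act (1, ?\<phi>) h = (\<bullet>)" by (auto simp: form_act_def \<phi>(3) frame_inner[OF hC(1)] fun_eq_iff)
    moreover have "cubic_act (1, ?\<phi>) C = normal_cubic h C" by (simp add: cubic_act_def \<phi>(3) normal_cubic_def)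
    ultimately have "lstat_of (\<bullet>) (lstat_cubic s) = stat_act (1, ?\<phi>) s"
      using hC \<phi> by (simp add: lstat_cubic_invariant_structure stat_act_invariant_structure lstat_of_eq
          inner_product_inner normal_cubic_in_S3)
    then show "orbit ({0<..} \<times> Lie_Aut) stat_act (lstat_of (\<bullet>) (lstat_cubic s)) = orbit ({0<..} \<times> Lie_Aut) stat_act s"
      using orbit_stat_act[OF s, of 1 ?\<phi>] \<phi> by simp
  next
    fix C :: "'a form3" assume "C \<in> topspace (top_of_set Y)"
    then have C: "C \<in> S3" using Y by auto
    let ?k = "inv (frame ((\<bullet>) :: 'a form2))"
    have "orthogonal_transformation (frame ((\<bullet>) :: 'a form2))"
      by (simp add: orthogonal_transformation_def linear_frame frame_inner inner_product_inner)
    then have k: "orthogonal_transformation ?k" by (rule orthogonal_transformation_inv)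
    have "lstat_cubic (lstat_of (\<bullet>) C) = cubic_act (1, ?k) C"
      using C by (simp add: lstat_of_eq inner_product_inner lstat_cubic_invariant_structure cubic_act_def
          normal_cubic_def inv_inv_eq bij_frame)
    then show "orbit ({0<..} \<times> O_group) cubic_act (lstat_cubic (lstat_of (\<bullet>) C)) = orbit ({0<..} \<times> O_group) cubic_act C"
      using orbit_cubic_act[of 1 ?k C] k by simp
  qed
qed


section \<open>The moduli space of diagonal cubic forms\<close>

text \<open>Sort the index type by decreasing value of \<open>f\<close> and send the position in the order of indices to the
  position in the sorted list.\<close>

lemma antimono_rearrangement:
  fixes f :: "'n::{finite,linorder} \<Rightarrow> real"
  obtains \<pi> :: "'n \<Rightarrow> 'n" where "bij \<pi>" "\<And>i j. i \<le> j \<Longrightarrow> f (\<pi> j) \<le> f (\<pi> i)"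
proof -
  define xs where "xs = sorted_list_of_set (UNIV :: 'n set)"
  define ys where "ys = sort_key (\<lambda>i. - f i) xs"
  let ?I = "{..<length xs}"
  have xs: "set xs = UNIV" "distinct xs" "sorted xs" by (simp_all add: xs_def)
  have ys: "set ys = UNIV" "distinct ys" "length ys = length xs" "sorted (map (\<lambda>i. - f i) ys)"
    using xs by (simp_all add: ys_def)
  have bx: "bij_betw ((!) xs) ?I UNIV" using bij_betw_nth[OF xs(2), of ?I UNIV] xs by simp
  have bY: "bij_betw ((!) ys) ?I UNIV" using bij_betw_nth[OF ys(2), of ?I UNIV] ys by simp
  define \<pi> where "\<pi> = (!) ys \<circ> inv_into ?I ((!) xs)"
  have "bij \<pi>" unfolding \<pi>_def using bij_betw_trans[OF bij_betw_inv_into[OF bx] bY] .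
  moreover have "f (\<pi> j) \<le> f (\<pi> i)" if ij: "i \<le> j" for i j
  proof -
    let ?a = "inv_into ?I ((!) xs) i" and ?b = "inv_into ?I ((!) xs) j"
    have ab: "?a < length xs" "?b < length xs" "xs ! ?a = i" "xs ! ?b = j"
      using bij_betwE[OF bij_betw_inv_into[OF bx]] bij_betw_inv_into_right[OF bx] by auto
    have "?a \<le> ?b"
    proof (rule ccontr)
      assume "\<not> ?a \<le> ?b"
      then have "j \<le> i" using sorted_nth_mono[OF xs(3), of ?b ?a] ab by simp
      then have "i = j" using ij by simp
      then show False using \<open>\<not> ?a \<le> ?b\<close> by simp
    qed
    then show ?thesis
      using sorted_nth_mono[OF ys(4), of ?a ?b] ab ys(3) by (simp add: \<pi>_def)
  qed
  ultimately show ?thesis using that by blast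
qed

text \<open>Signs of the coefficients can be absorbed into the basis vectors, because the form is of odd degree;
  a rearrangement of the basis sorts what remains.\<close>

lemma diag_form_ordered:
  fixes e :: "'n::{finite,linorder} \<Rightarrow> real ^ 'n::_"
  assumes e: "orthonormal_basis e"
  obtains e' l' where "orthonormal_basis e'" "l' \<in> ordered_cone" "diag_form e l = diag_form e' l'"
proof -
  obtain \<pi> :: "'n \<Rightarrow> 'n" where \<pi>: "bij \<pi>" "\<And>i j. i \<le> j \<Longrightarrow> \<bar>l $ \<pi> j\<bar> \<le> \<bar>l $ \<pi> i\<bar>"
    using antimono_rearrangement[of "\<lambda>i. \<bar>l $ i\<bar>"] by blast
  define s where "s = (\<lambda>i. if l $ i < 0 then - 1 else 1 :: real)"
  have s: "s i * s i = 1" "l $ i = s i * \<bar>l $ i\<bar>" for i by (auto simp: s_def)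
  define e' where "e' = (\<lambda>i. s (\<pi> i) *\<^sub>R e (\<pi> i))"
  define l' where "l' = (\<chi> i. \<bar>l $ \<pi> i\<bar>)"
  have "e' i \<bullet> e' j = (if i = j then 1 else 0)" for i j
    using bij_is_inj[OF \<pi>(1)] by (simp add: s(1) e'_def orthonormal_basisD[OF e] inj_eq)
  then have "orthonormal_basis e'" by (rule orthonormal_basisI)
  moreover have "l' \<in> ordered_cone" using \<pi>(2) by (simp add: ordered_cone_def l'_def)
  moreover have "diag_form e l u v w = diag_form e' l' u v w" for u v w
  proof -
    have "l' $ i * ((e' i \<bullet> u) * (e' i \<bullet> v) * (e' i \<bullet> w))
        = l $ \<pi> i * ((e (\<pi> i) \<bullet> u) * (e (\<pi> i) \<bullet> v) * (e (\<pi> i) \<bullet> w))" for i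
    proof -
      have "l' $ i * ((e' i \<bullet> u) * (e' i \<bullet> v) * (e' i \<bullet> w))
        = (s (\<pi> i) * s (\<pi> i)) * (s (\<pi> i) * \<bar>l $ \<pi> i\<bar>) * ((e (\<pi> i) \<bullet> u) * (e (\<pi> i) \<bullet> v) * (e (\<pi> i) \<bullet> w))"
        by (simp add: l'_def e'_def mult_ac)
      then show ?thesis using s(1)[of "\<pi> i"] s(2)[of "\<pi> i", symmetric] by simp
    qed
    then have "diag_form e' l' u v w = (\<Sum>i\<in>UNIV. l $ \<pi> i * ((e (\<pi> i) \<bullet> u) * (e (\<pi> i) \<bullet> v) * (e (\<pi> i) \<bullet> w)))"
      by (simp add: diag_form_def)
    also have "\<dots> = diag_form e l u v w"
      unfolding diag_form_def
      using sum.reindex_bij_betw[OF \<pi>(1), of "\<lambda>i. l $ i * ((e i \<bullet> u) * (e i \<bullet> v) * (e i \<bullet> w))"] .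
    finally show ?thesis by simp
  qed
  ultimately show ?thesis using that by blast
qed

text \<open>The squared norm of the bilinear form \<open>C v\<close>. As a quadratic form in \<open>v\<close> it has, for a diagonal
  cubic form, the eigenvalues \<open>(l $ i)\<^sup>2\<close>; the entries of its matrix are \<open>energy_coeff\<close>.\<close>

definition energy :: "'a::euclidean_space form3 \<Rightarrow> 'a \<Rightarrow> real" where
  "energy C v = (\<Sum>a\<in>Basis. \<Sum>b\<in>Basis. (C v a b)\<^sup>2)"

definition energy_coeff :: "'a::euclidean_space form3 \<Rightarrow> 'a \<Rightarrow> 'a \<Rightarrow> real" where
  "energy_coeff C c d = (\<Sum>a\<in>Basis. \<Sum>b\<in>Basis. C c a b * C d a b)"

lemma energy_expand:
  assumes C: "C \<in> S3"
  shows "energy C v = (\<Sum>c\<in>Basis. \<Sum>d\<in>Basis. (v \<bullet> c) * (v \<bullet> d) * energy_coeff C c d)"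
proof -
  have l: "linear (\<lambda>u. energy_coeff C u w)" for w
    by (rule linearI) (simp_all add: energy_coeff_def linear_add[OF S3D(1)[OF C]] linear_scale[OF S3D(1)[OF C]]
        distrib_right sum.distrib sum_distrib_left mult.assoc)
  have "energy_coeff C w = (\<lambda>u. energy_coeff C u w)" for w
    by (rule ext) (simp add: energy_coeff_def mult.commute)
  then have "linear (energy_coeff C w)" for w using l[of w] by metis
  then have "energy_coeff C v v = (\<Sum>c\<in>Basis. \<Sum>d\<in>Basis. (v \<bullet> c) * (v \<bullet> d) * energy_coeff C c d)"
    using l by (intro bilinear_expand) (simp add: bilinear_def)
  then show ?thesis by (simp add: energy_def energy_coeff_def power2_eq_square)
qed

lemma energy_diag_form:
  assumes e: "orthonormal_basis e"
  shows "energy (diag_form e l) v = (\<Sum>i\<in>UNIV. (l $ i)\<^sup>2 * (e i \<bullet> v)\<^sup>2)"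
proof -
  define c where "c = (\<lambda>i. l $ i * (e i \<bullet> v))"
  have inner: "(\<Sum>b\<in>Basis. (diag_form e l v a b)\<^sup>2) = (\<Sum>i\<in>UNIV. (c i)\<^sup>2 * (e i \<bullet> a)\<^sup>2)" for a
  proof -
    define y where "y = (\<Sum>i\<in>UNIV. (c i * (e i \<bullet> a)) *\<^sub>R e i)"
    have "diag_form e l v a b = y \<bullet> b" for b
      by (simp add: y_def diag_form_def c_def inner_sum_left mult_ac)
    then have "(\<Sum>b\<in>Basis. (diag_form e l v a b)\<^sup>2) = y \<bullet> y"
      by (subst euclidean_inner) (simp add: power2_eq_square)
    also have "\<dots> = (\<Sum>i\<in>UNIV. (c i)\<^sup>2 * (e i \<bullet> a)\<^sup>2)"
      unfolding orthonormal_basis_inner[OF e, of y y]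
      by (simp add: y_def orthonormal_basis_inner_sum[OF e] power2_eq_square mult_ac)
    finally show ?thesis .
  qed
  have unit: "(\<Sum>a\<in>Basis. (e i \<bullet> a)\<^sup>2) = 1" for i
    using orthonormal_basisD[OF e, of i i] euclidean_inner[of "e i" "e i"] by (simp add: power2_eq_square)
  have "energy (diag_form e l) v = (\<Sum>i\<in>UNIV. \<Sum>a\<in>Basis. (c i)\<^sup>2 * (e i \<bullet> a)\<^sup>2)"
    unfolding energy_def inner by (rule sum.swap)
  also have "\<dots> = (\<Sum>i\<in>UNIV. (c i)\<^sup>2)"
    by (simp add: sum_distrib_left[symmetric] unit)
  finally show ?thesis by (simp add: c_def power_mult_distrib)
qed

lemma dim_span_orthonormal:
  fixes e :: "'n::finite \<Rightarrow> real ^ 'n::_"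
  assumes e: "orthonormal_basis e"
  shows "dim (span (e ` I)) = card I"
proof -
  have ne: "e i \<noteq> 0" for i using orthonormal_basisD[OF e, of i i] by force
  have inj: "inj_on e I"
    using orthonormal_basisD[OF e] by (metis inj_onI zero_neq_one)
  have "independent (e ` I)"
    using orthonormal_basisD[OF e] ne by (intro pairwise_orthogonal_independent) (auto simp: pairwise_def orthogonal_def)
  then show ?thesis by (simp add: dim_eq_card_independent card_image[OF inj])
qed

text \<open>This is Weyl's argument: the span of \<open>e i\<close> for \<open>i \<le> k\<close> and that of \<open>e' i\<close> for \<open>i \<ge> k\<close> have
  dimensions adding up to more than the dimension of the space, so they share a unit vector.\<close>

lemma eigenvalue_compare:
  fixes e e' :: "'n::{finite,linorder} \<Rightarrow> real ^ 'n::_"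
  assumes e: "orthonormal_basis e" and e': "orthonormal_basis e'"
    and l: "l \<in> ordered_cone" and l': "l' \<in> ordered_cone"
  obtains v where "norm v = 1" "(l $ k)\<^sup>2 \<le> energy (diag_form e l) v" "energy (diag_form e' l') v \<le> (l' $ k)\<^sup>2"
proof -
  let ?A = "span (e ` {..k})" and ?B = "span (e' ` {k..})"
  have "card {..k} + card {k..} = card ({..k} \<union> {k..}) + card ({..k} \<inter> {k..})"
    by (rule card_Un_Int) auto
  moreover have "{..k} \<union> {k..} = UNIV" "{..k} \<inter> {k..} = {k}" by auto
  ultimately have "dim ?A + dim ?B = CARD('n) + 1"
    unfolding dim_span_orthonormal[OF e] dim_span_orthonormal[OF e'] by simp
  moreover have "dim {x + y |x y. x \<in> ?A \<and> y \<in> ?B} + dim (?A \<inter> ?B) = dim ?A + dim ?B"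
    by (rule dim_sums_Int) (rule subspace_span)+
  moreover have "dim {x + y |x y. x \<in> ?A \<and> y \<in> ?B} \<le> CARD('n)"
    using dim_subset_UNIV[of "{x + y |x y. x \<in> ?A \<and> y \<in> ?B}"] by simp
  ultimately have "dim (?A \<inter> ?B) \<noteq> 0" by linarith
  then obtain w where w: "w \<in> ?A" "w \<in> ?B" "w \<noteq> 0" by auto
  define v where "v = (1 / norm w) *\<^sub>R w"
  have v: "v \<in> ?A" "v \<in> ?B" "norm v = 1" using w by (auto simp: v_def intro: span_scale)
  have vA: "e j \<bullet> v = 0" if "\<not> j \<le> k" for j
  proof -
    have "?A \<subseteq> {x. e j \<bullet> x = 0}"
      using that by (intro span_minimal subspace_hyperplane) (auto simp: orthonormal_basisD[OF e])
    then show ?thesis using v by blast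
  qed
  have vB: "e' j \<bullet> v = 0" if "\<not> k \<le> j" for j
  proof -
    have "?B \<subseteq> {x. e' j \<bullet> x = 0}"
      using that by (intro span_minimal subspace_hyperplane) (auto simp: orthonormal_basisD[OF e'])
    then show ?thesis using v by blast
  qed
  have unit: "(\<Sum>i\<in>UNIV. (e i \<bullet> v)\<^sup>2) = 1" "(\<Sum>i\<in>UNIV. (e' i \<bullet> v)\<^sup>2) = 1"
    using orthonormal_basis_inner[OF e, of v v] orthonormal_basis_inner[OF e', of v v] v(3)
    by (simp_all add: power2_eq_square norm_eq_1)
  have "(l $ k)\<^sup>2 * (e i \<bullet> v)\<^sup>2 \<le> (l $ i)\<^sup>2 * (e i \<bullet> v)\<^sup>2" for i
    using vA[of i] l by (cases "i \<le> k") (auto simp: ordered_cone_def intro!: mult_right_mono power_mono)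
  then have "(\<Sum>i\<in>UNIV. (l $ k)\<^sup>2 * (e i \<bullet> v)\<^sup>2) \<le> energy (diag_form e l) v"
    unfolding energy_diag_form[OF e] by (rule sum_mono)
  then have 1: "(l $ k)\<^sup>2 \<le> energy (diag_form e l) v" by (simp add: sum_distrib_left[symmetric] unit)
  have "(l' $ i)\<^sup>2 * (e' i \<bullet> v)\<^sup>2 \<le> (l' $ k)\<^sup>2 * (e' i \<bullet> v)\<^sup>2" for i
    using vB[of i] l' by (cases "k \<le> i") (auto simp: ordered_cone_def intro!: mult_right_mono power_mono)
  then have "energy (diag_form e' l') v \<le> (\<Sum>i\<in>UNIV. (l' $ k)\<^sup>2 * (e' i \<bullet> v)\<^sup>2)"
    unfolding energy_diag_form[OF e'] by (rule sum_mono)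
  then have 2: "energy (diag_form e' l') v \<le> (l' $ k)\<^sup>2" by (simp add: sum_distrib_left[symmetric] unit)
  show ?thesis using that[OF v(3) 1 2] .
qed

text \<open>A bound, over the unit sphere, for the difference of the quadratic forms \<open>energy C\<close> and \<open>energy C'\<close>
  (see \<open>energy_diff_le\<close>) that is manifestly continuous in the cubic forms.\<close>

definition energy_dist :: "'a::euclidean_space form3 \<Rightarrow> 'a form3 \<Rightarrow> real" where
  "energy_dist C C' = (\<Sum>c\<in>Basis. \<Sum>d\<in>Basis. \<bar>energy_coeff C c d - energy_coeff C' c d\<bar>)"

lemma energy_diff_le:
  assumes C: "C \<in> S3" "C' \<in> S3" and v: "norm v = 1"
  shows "energy C v - energy C' v \<le> energy_dist C C'"
proof -
  have "energy C v - energy C' v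
      = (\<Sum>c\<in>Basis. \<Sum>d\<in>Basis. ((v \<bullet> c) * (v \<bullet> d)) * (energy_coeff C c d - energy_coeff C' c d))"
    by (simp add: energy_expand C sum_subtractf[symmetric] right_diff_distrib)
  also have "\<dots> \<le> energy_dist C C'"
    unfolding energy_dist_def
  proof (intro sum_mono)
    fix c d :: 'a assume "c \<in> Basis" "d \<in> Basis"
    then have "\<bar>v \<bullet> c\<bar> \<le> 1" "\<bar>v \<bullet> d\<bar> \<le> 1" using Basis_le_norm v by metis+
    then have "\<bar>(v \<bullet> c) * (v \<bullet> d)\<bar> \<le> 1" by (simp add: abs_mult mult_le_one)
    then have "\<bar>(v \<bullet> c) * (v \<bullet> d)\<bar> * \<bar>energy_coeff C c d - energy_coeff C' c d\<bar> \<le> 1 * \<bar>energy_coeff C c d - energy_coeff C' c d\<bar>"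
      by (rule mult_right_mono) simp
    then show "((v \<bullet> c) * (v \<bullet> d)) * (energy_coeff C c d - energy_coeff C' c d) \<le> \<bar>energy_coeff C c d - energy_coeff C' c d\<bar>"
      using abs_ge_self[of "((v \<bullet> c) * (v \<bullet> d)) * (energy_coeff C c d - energy_coeff C' c d)"]
      unfolding abs_mult mult_1 by linarith
  qed
  finally show ?thesis .
qed

lemma eigenvalue_diff_le:
  assumes "orthonormal_basis e" "orthonormal_basis e'" "l \<in> ordered_cone" "l' \<in> ordered_cone"
  shows "\<bar>(l $ k)\<^sup>2 - (l' $ k)\<^sup>2\<bar> \<le> energy_dist (diag_form e l) (diag_form e' l')"
proof -
  have half: "(l $ k)\<^sup>2 - (l' $ k)\<^sup>2 \<le> energy_dist (diag_form e l) (diag_form e' l')"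
    if "orthonormal_basis e" "orthonormal_basis e'" "l \<in> ordered_cone" "l' \<in> ordered_cone" for e e' l l'
  proof -
    obtain v where "norm v = 1" "(l $ k)\<^sup>2 \<le> energy (diag_form e l) v" "energy (diag_form e' l') v \<le> (l' $ k)\<^sup>2"
      using eigenvalue_compare[OF \<open>orthonormal_basis e\<close> \<open>orthonormal_basis e'\<close> \<open>l \<in> ordered_cone\<close> \<open>l' \<in> ordered_cone\<close>]
      by blast
    then show ?thesis using energy_diff_le[OF diag_form_in_S3 diag_form_in_S3, of v e l e' l'] by linarith
  qed
  have "energy_dist (diag_form e' l') (diag_form e l) = energy_dist (diag_form e l) (diag_form e' l')"
    by (simp add: energy_dist_def abs_minus_commute)
  then show ?thesis using half[OF assms] half[OF assms(2,1,4,3)] by linarith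
qed

lemma eigenvalues_unique:
  assumes "orthonormal_basis e" "orthonormal_basis e'" "l \<in> ordered_cone" "l' \<in> ordered_cone"
    and "diag_form e l = diag_form e' l'"
  shows "l = l'"
proof -
  have "l $ k = l' $ k" for k
  proof -
    have "energy_dist (diag_form e l) (diag_form e' l') = 0" by (simp add: assms(5) energy_dist_def)
    then have "(l $ k)\<^sup>2 = (l' $ k)\<^sup>2" using eigenvalue_diff_le[OF assms(1-4), of k] by simp
    then show ?thesis using assms(3,4) by (simp add: ordered_cone_def power2_eq_iff_nonneg)
  qed
  then show ?thesis by (simp add: vec_eq_iff)
qed

text \<open>These are the numbers \<open>C b b b\<close> for the vectors \<open>b\<close> of a diagonalising basis, made nonnegative by the
  choice of signs of the vectors and listed in decreasing order.\<close>

definition eigenvalues :: "(real ^ 'n::{finite,linorder}) form3 \<Rightarrow> real ^ 'n::_" where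
  "eigenvalues C = (THE l. l \<in> ordered_cone \<and> (\<exists>e. orthonormal_basis e \<and> C = diag_form e l))"

lemma eigenvalues_diag_form:
  assumes "orthonormal_basis e" "l \<in> ordered_cone"
  shows "eigenvalues (diag_form e l) = l"
  unfolding eigenvalues_def
  by (rule the_equality) (use assms eigenvalues_unique in blast)+

lemma eigenvalues_cases:
  fixes e :: "'n::{finite,linorder} \<Rightarrow> real ^ 'n::_"
  assumes "orthonormal_basis e"
  obtains e' where "orthonormal_basis e'" "eigenvalues (diag_form e l) \<in> ordered_cone"
    "diag_form e l = diag_form e' (eigenvalues (diag_form e l))"
proof -
  obtain e' l' where "orthonormal_basis e'" "l' \<in> ordered_cone" "diag_form e l = diag_form e' l'"
    using diag_form_ordered[OF assms] by blast
  then show ?thesis using that[of e'] eigenvalues_diag_form[of e' l'] by simp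
qed

text \<open>The squares of the eigenvalues are Lipschitz with respect to \<open>energy_dist\<close>, and the eigenvalues are
  recovered as square roots since they are nonnegative.\<close>

lemma continuous_on_eigenvalues:
  "continuous_on {diag_form e l | e l. orthonormal_basis e} (eigenvalues :: (real ^ 'n::{finite,linorder}) form3 \<Rightarrow> _)"
proof -
  let ?Y = "{diag_form e l | (e :: 'n \<Rightarrow> real ^ 'n::_) l. orthonormal_basis e}"
  have bound: "\<bar>(eigenvalues C $ k)\<^sup>2 - (eigenvalues C' $ k)\<^sup>2\<bar> \<le> energy_dist C C'"
    if C: "C \<in> ?Y" "C' \<in> ?Y" for C C' k
  proof -
    obtain e where "orthonormal_basis e" "eigenvalues C \<in> ordered_cone" "C = diag_form e (eigenvalues C)"
      using C(1) eigenvalues_cases by blast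
    moreover obtain e' where "orthonormal_basis e'" "eigenvalues C' \<in> ordered_cone" "C' = diag_form e' (eigenvalues C')"
      using C(2) eigenvalues_cases by blast
    ultimately show ?thesis using eigenvalue_diff_le by metis
  qed
  have square: "continuous_on ?Y (\<lambda>C. (eigenvalues C $ k)\<^sup>2)" for k
    unfolding continuous_on_def
  proof
    fix C0 assume C0: "C0 \<in> ?Y"
    have "continuous_on ?Y (\<lambda>C. energy_dist C C0)"
      unfolding energy_dist_def energy_coeff_def
      by (intro continuous_on_sum continuous_on_rabs continuous_on_diff continuous_on_mult
          continuous_on_form3_eval continuous_on_const)
    then have "((\<lambda>C. energy_dist C C0) \<longlongrightarrow> energy_dist C0 C0) (at C0 within ?Y)"
      using C0 by (simp add: continuous_on_def)
    then have "((\<lambda>C. energy_dist C C0) \<longlongrightarrow> 0) (at C0 within ?Y)" by (simp add: energy_dist_def)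
    then have "((\<lambda>C. (eigenvalues C $ k)\<^sup>2 - (eigenvalues C0 $ k)\<^sup>2) \<longlongrightarrow> 0) (at C0 within ?Y)"
      by (rule Lim_null_comparison[rotated])
         (use bound[OF _ C0] in \<open>auto simp: eventually_at_filter intro!: always_eventually\<close>)
    then show "((\<lambda>C. (eigenvalues C $ k)\<^sup>2) \<longlongrightarrow> (eigenvalues C0 $ k)\<^sup>2) (at C0 within ?Y)"
      by (rule LIM_zero_cancel)
  qed
  have "continuous_on ?Y (\<lambda>C. eigenvalues C $ k)" for k
  proof (rule continuous_on_eq[OF continuous_on_real_sqrt[OF square[of k]]])
    fix C assume "C \<in> ?Y"
    then have "eigenvalues C \<in> ordered_cone" using eigenvalues_cases by blast
    then show "sqrt ((eigenvalues C $ k)\<^sup>2) = eigenvalues C $ k" by (simp add: ordered_cone_def)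
  qed
  then have "continuous_on ?Y (\<lambda>C. \<chi> k. eigenvalues C $ k)" by (rule continuous_on_vec_lambda)
  then show ?thesis by (simp add: vec_nth_inverse)
qed

lemma orbit_scaleR:
  fixes l :: "'a::real_vector"
  assumes "r > 0"
  shows "orbit {0<..} (*\<^sub>R) (r *\<^sub>R l) = orbit {0<..} (*\<^sub>R) l"
proof (rule orbit_act_eq[where X = UNIV])
  fix s t :: real and y :: 'a assume s: "s \<in> {0<..}"
  show "\<exists>k\<in>{0<..}. k *\<^sub>R s *\<^sub>R y = y" using s by (intro bexI[of _ "inverse s"]) auto
  assume "t \<in> {0<..}"
  then show "\<exists>k\<in>{0<..}. s *\<^sub>R t *\<^sub>R y = k *\<^sub>R y" using s by (intro bexI[of _ "s * t"]) auto
qed (use assms in auto)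

lemma orbit_scaleR_eqD:
  fixes l :: "'a::real_vector"
  assumes "orbit {0<..} (*\<^sub>R) l = orbit {0<..} (*\<^sub>R) l'"
  obtains r :: real where "r > 0" "l' = r *\<^sub>R l"
proof -
  have "l' \<in> orbit {0<..} (*\<^sub>R) l'" unfolding orbit_def by (rule image_eqI[of _ _ 1]) auto
  then have "l' \<in> orbit {0<..} (*\<^sub>R) l" by (simp add: assms)
  then show ?thesis using that by (auto simp: orbit_def)
qed

text \<open>The two maps are \<open>eigenvalues\<close> and \<open>diag_form e\<close> for the fixed basis \<open>e\<close>. They are inverse to each
  other on the cone, and up to an orthogonal change of basis on the diagonal forms.\<close>

lemma diagonal_moduli_homeomorphic:
  fixes e :: "'n::{finite,linorder} \<Rightarrow> real ^ 'n::_"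
  assumes e: "orthonormal_basis e"
  shows "orbit_space ({0<..} \<times> O_group) cubic_act (top_of_set {diag_form e l | (e :: 'n \<Rightarrow> real ^ 'n::_) l. orthonormal_basis e})
    homeomorphic_space orbit_space {0<..} (*\<^sub>R) (top_of_set (ordered_cone :: (real ^ 'n::_) set))"
    (is "orbit_space _ _ (top_of_set ?Y) homeomorphic_space _")
proof -
  have cases: "\<exists>e'. orthonormal_basis e' \<and> eigenvalues C \<in> ordered_cone \<and> C = diag_form e' (eigenvalues C)"
    if "C \<in> ?Y" for C
    using that eigenvalues_cases by blast
  have f: "continuous_map (top_of_set ?Y) (top_of_set ordered_cone) eigenvalues"
    using continuous_on_eigenvalues cases by (auto simp: continuous_map_in_subtopology)
  have "continuous_on ordered_cone (diag_form e)"
    unfolding diag_form_def by (intro continuous_on_into_form3 continuous_intros)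
  then have g: "continuous_map (top_of_set ordered_cone) (top_of_set ?Y) (diag_form e)"
    using e by (auto simp: continuous_map_in_subtopology)
  show ?thesis
  proof (rule orbit_spaces_homeomorphic[OF f g])
    fix C C' :: "(real ^ 'n::_) form3" assume C: "C \<in> topspace (top_of_set ?Y)" "C' \<in> topspace (top_of_set ?Y)"
      and orb: "orbit ({0<..} \<times> O_group) cubic_act C = orbit ({0<..} \<times> O_group) cubic_act C'"
    obtain r k where rk: "r > 0" "orthogonal_transformation k" "C' = cubic_act (r, k) C"
      using orbit_cubic_act_eqD[OF orb] by blast
    obtain e1 where e1: "orthonormal_basis e1" "eigenvalues C \<in> ordered_cone" "C = diag_form e1 (eigenvalues C)"
      using cases C by auto
    have "C' = diag_form (\<lambda>i. k (e1 i)) (r *\<^sub>R eigenvalues C)"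
      using e1(3) rk(3) cubic_act_diag_form[OF rk(2)] by metis
    moreover have "r *\<^sub>R eigenvalues C \<in> ordered_cone"
      using e1(2) rk(1) by (auto simp: ordered_cone_def)
    ultimately have "eigenvalues C' = r *\<^sub>R eigenvalues C"
      using eigenvalues_diag_form[OF orthonormal_basis_image[OF e1(1) rk(2)]] by simp
    then show "orbit {0<..} (*\<^sub>R) (eigenvalues C) = orbit {0<..} (*\<^sub>R) (eigenvalues C')"
      using orbit_scaleR[OF rk(1), of "eigenvalues C"] by simp
  next
    fix l l' :: "real ^ 'n::_" assume orb: "orbit {0<..} (*\<^sub>R) l = orbit {0<..} (*\<^sub>R) l'"
    obtain r where r: "r > 0" "l' = r *\<^sub>R l" using orbit_scaleR_eqD[OF orb] by blast
    have id: "orthogonal_transformation (\<lambda>x::real ^ 'n::_. x)" by simp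
    have "diag_form e l' = cubic_act (r, \<lambda>x. x) (diag_form e l)"
      using cubic_act_diag_form[OF id, of r e l] r(2) by simp
    then show "orbit ({0<..} \<times> O_group) cubic_act (diag_form e l) = orbit ({0<..} \<times> O_group) cubic_act (diag_form e l')"
      using orbit_cubic_act[OF r(1) id, of "diag_form e l"] by simp
  next
    fix C assume "C \<in> topspace (top_of_set ?Y)"
    then obtain e1 where e1: "orthonormal_basis e1" "C = diag_form e1 (eigenvalues C)" using cases by auto
    obtain k where k: "orthogonal_transformation k" "\<And>i. k (e1 i) = e i"
      using orthonormal_basis_transitive[OF e1(1) e] by blast
    have "diag_form e (eigenvalues C) = cubic_act (1, k) (diag_form e1 (eigenvalues C))"
      by (simp add: cubic_act_diag_form[OF k(1)] k(2))
    then have "diag_form e (eigenvalues C) = cubic_act (1, k) C" using e1(2) by simp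
    then show "orbit ({0<..} \<times> O_group) cubic_act (diag_form e (eigenvalues C)) = orbit ({0<..} \<times> O_group) cubic_act C"
      using orbit_cubic_act[of 1 k C] k(1) by simp
  next
    fix l :: "real ^ 'n::_" assume "l \<in> topspace (top_of_set ordered_cone)"
    then show "orbit {0<..} (*\<^sub>R) (eigenvalues (diag_form e l)) = orbit {0<..} (*\<^sub>R) l"
      using eigenvalues_diag_form[OF e] by simp
  qed
qed


section \<open>The classification\<close>

theorem theorem5p1:
  shows
   "((LStat :: (real ^ 'n::{finite,linorder}) stat set) = LStat_CS)
  \<and> (\<forall>C \<in> (S3 :: (real ^ 'n::_) form3 set).
       lstat_of (\<bullet>) C \<in> LStat_DF \<longleftrightarrow>
       (\<exists>e x l. orthonormal_basis e \<and> dual_basis e x \<and> C = diag_cubic x l))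
  \<and> ((MLStat :: (real ^ 'n::_) stat set topology) = MLStat_CS \<and>
     (MLStat :: (real ^ 'n::_) stat set topology) homeomorphic_space
       orbit_space ({0<..} \<times> O_group) cubic_act (top_of_set (S3 :: (real ^ 'n::_) form3 set)))
  \<and> (\<forall>(e :: 'n::_ \<Rightarrow> real ^ 'n::_) x. orthonormal_basis e \<and> dual_basis e x \<longrightarrow>
       (MLStat_DF :: (real ^ 'n::_) stat set topology) homeomorphic_space
         orbit_space ({0<..} \<times> O_group) cubic_act (top_of_set (O_orbit_V x)) \<and>
       orbit_space ({0<..} \<times> O_group) cubic_act (top_of_set (O_orbit_V x)) homeomorphic_space
         orbit_space {0<..} (*\<^sub>R) (top_of_set (ordered_cone :: (real ^ 'n::_) set)))"
proof (intro conjI ballI allI impI)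
  show CS: "(LStat :: (real ^ 'n::_) stat set) = LStat_CS" by (rule LStat_eq_LStat_CS)
  show "(MLStat :: (real ^ 'n::_) stat set topology) = MLStat_CS"
    by (simp add: MLStat_def MLStat_CS_def CS)
  have flat: "lstat_of (\<bullet>) C \<in> LStat_DF \<longleftrightarrow> flat_cubic C" if "C \<in> S3" for C :: "(real ^ 'n::_) form3"
    using that by (simp add: LStat_DF_def lstat_of_eq inner_product_inner invariant_structure_in_LStat dually_flat_standard)
  show "lstat_of (\<bullet>) C \<in> LStat_DF \<longleftrightarrow> (\<exists>e x l. orthonormal_basis e \<and> dual_basis e x \<and> C = diag_cubic x l)"
    if "C \<in> S3" for C :: "(real ^ 'n::_) form3"
  proof -
    have "(\<exists>x. dual_basis e x \<and> C = diag_cubic x l) \<longleftrightarrow> C = diag_form e l" if "orthonormal_basis e" for e l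
      using diag_cubic_eq_diag_form[OF that, of "\<lambda>i v. e i \<bullet> v"] by (simp add: dual_basis_orthonormal[OF that])
    then show ?thesis
      unfolding flat[OF that] flat_cubic_iff_diag_form[OF that] by blast
  qed
  show "(MLStat :: (real ^ 'n::_) stat set topology) homeomorphic_space
      orbit_space ({0<..} \<times> O_group) cubic_act (top_of_set (S3 :: (real ^ 'n::_) form3 set))"
    unfolding MLStat_def
  proof (rule moduli_space_homeomorphic)
    have "lstat_cubic s \<in> S3" if "s \<in> LStat" for s :: "(real ^ 'n::_) stat"
      using that by (rule LStat_cases) (simp add: lstat_cubic_invariant_structure normal_cubic_in_S3)
    then show "LStat = {s \<in> LStat. lstat_cubic s \<in> (S3 :: (real ^ 'n::_) form3 set)}" by blast
    show "lstat_of (\<bullet>) C \<in> LStat" if "C \<in> S3" for C :: "(real ^ 'n::_) form3"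
      using that by (simp add: lstat_of_eq inner_product_inner invariant_structure_in_LStat)
  qed simp
  fix e :: "'n \<Rightarrow> real ^ 'n::_" and x assume "orthonormal_basis e \<and> dual_basis e x"
  then have e: "orthonormal_basis e" and x: "dual_basis e x" by auto
  have Y: "O_orbit_V x = {C \<in> S3. flat_cubic C}"
    unfolding O_orbit_V_eq[OF e x] using flat_cubic_iff_diag_form diag_form_in_S3 flat_diag_form by blast
  show "(MLStat_DF :: (real ^ 'n::_) stat set topology) homeomorphic_space
      orbit_space ({0<..} \<times> O_group) cubic_act (top_of_set (O_orbit_V x))"
    unfolding MLStat_DF_def
  proof (rule moduli_space_homeomorphic)
    show "O_orbit_V x \<subseteq> S3" by (auto simp: Y)
    have "dually_flat s \<longleftrightarrow> lstat_cubic s \<in> O_orbit_V x" if "s \<in> LStat" for s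
      using that by (rule LStat_cases)
        (simp add: Y lstat_cubic_invariant_structure normal_cubic_in_S3 dually_flat_iff_flat_normal_cubic)
    then show "LStat_DF = {s \<in> LStat. lstat_cubic s \<in> O_orbit_V x}" by (auto simp: LStat_DF_def)
    show "lstat_of (\<bullet>) C \<in> LStat_DF" if "C \<in> O_orbit_V x" for C
      using that flat by (simp add: Y)
  qed
  show "orbit_space ({0<..} \<times> O_group) cubic_act (top_of_set (O_orbit_V x)) homeomorphic_space
      orbit_space {0<..} (*\<^sub>R) (top_of_set (ordered_cone :: (real ^ 'n::_) set))"
    unfolding O_orbit_V_eq[OF e x] by (rule diagonal_moduli_homeomorphic[OF e])
qed

end
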